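(* Let $T>0$, let $(L_t)_{t\ge0}$ be an $m$-dimensional Lévy process, let $X_0$ be an $\mathbb{R}^d$-valued random vector with $\mathrm{E}[\|X_0\|^2]<\infty$, and let $a:\mathbb{R}^d\to\mathbb{R}^{d\times m}$ satisfy, for some positive constants $L_a,B_a$, $\|a(x)-a(x')\|\le L_a\|x-x'\|$ and $\|a(x)\|^2\le B_a^2(1+\|x\|^2)$ for all $x,x'\in\mathbb{R}^d$. Let $X$ be the solution of $X_t=X_0+\int_0^t a(X_{s-})\,dL_s$. Suppose that the function $f:\mathbb{R}^d\to\mathbb{R}$ is Lipschitz continuous and that the distribution of the random matrix $\boldsymbol{\zeta}_L$ of finest-level increments (see context) is chosen in such a way that $$\bigl|\mathrm{E}[f(X^L_T(\boldsymbol{\zeta}_L))]-\mathrm{E}[f(X_T)]\bigr|\le c\,\Delta_L^{\alpha}$$ for some $c>0$ and $\alpha\ge1/2$. Suppose further that the following holds for the coupling of consecutive levels, i.e. with $\Delta_f=\Delta_l$, $\zeta^f_j=\zeta_{l,j}$ and $\zeta^c_j=\varsigma_j(\boldsymbol{\zeta}_l)$: the vectors $\zeta^f_j$ are i.i.d.; the differences $\mathcal{R}_j=\zeta^c_j-\zeta^f_{2j-1}-\zeta^f_{2j}$ are zero mean i.i.d. random vectors; and $$\mathrm{E}\bigl[\|\zeta^f_1\|^2\bigr]=O(\Delta_f),\qquad \bigl\|\mathrm{E}[\zeta^f_1]\bigr\|=O(\Delta_f),\qquad \mathrm{E}\bigl[\|\mathcal{R}_1\|^2\bigr]=O(\Delta_f^2)\qquad\text{for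 }\Delta_f\to0.$$ Then, under a proper choice of $\mathbf{N}$ and $L$, the complexity of the weak multilevel Monte Carlo estimate $Y_{L,\mathbf{N}}$ (see context) needed to achieve the accuracy $\varepsilon$, as measured by the root mean square error for estimating $\mathrm{E}[f(X_T)]$, is of order $\varepsilon^{-2}\log^2(\varepsilon)$.
   Context: $\|\cdot\|$ is the Euclidean norm on vectors and a compatible norm on matrices. Fix $L>0$ and set $\Delta_l=2^{-l}T$, $l=0,\dots,L$. Random matrices and coupling. $\boldsymbol{\zeta}_L=(\zeta_{L,1},\dots,\zeta_{L,2^L})$ has i.i.d. columns with values in $\mathbb{R}^m$. Independent random matrices $\boldsymbol{\zeta}_{L-1},\dots,\boldsymbol{\zeta}_0$, where $\boldsymbol{\zeta}_l=(\zeta_{l,1},\dots,\zeta_{l,2^l})$ has columns in $\mathbb{R}^m$, are defined recursively by requiring that $\boldsymbol{\zeta}_{l-1}$ has the law of $\boldsymbol{\varsigma}(\boldsymbol{\zeta}_l)=(\varsigma_1(\boldsymbol{\zeta}_l),\dots,\varsigma_{2^{l-1}}(\boldsymbol{\zeta}_l))$, where each vector $\varsigma_j(\boldsymbol{\zeta}_l)$ is coupled with $\zeta_{l,2j-1}$ and $\zeta_{l,2j}$ in such a way that all differences $\varsigma_j(\boldsymbol{\zeta}_l)-\zeta_{l,2j-1}-\zeta_{l,2j}$, $j=1,\dots,2^{l-1}$, are small. For example, $\varsigma_j(\boldsymbol{\zeta}_l)=\zeta_{l,2j-1}+\zeta_{l,2j}$. Euler approximations. For a random matrix $\boldsymbol{\zeta}=(\zeta_1,\dots,\zeta_{2^l})$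 with columns in $\mathbb{R}^m$: $X^l_0(\boldsymbol{\zeta})=X_0$ and $X^l_{j\Delta_l}(\boldsymbol{\zeta})=X^l_{(j-1)\Delta_l}(\boldsymbol{\zeta})+a\bigl(X^l_{(j-1)\Delta_l}(\boldsymbol{\zeta})\bigr)\zeta_j$, $j=1,\dots,2^l$. Weak multilevel Monte Carlo estimate. For a vector of natural numbers $\mathbf{N}=(N_0,\dots,N_L)$, $$Y_{L,\mathbf{N}}=\frac1{N_0}\sum_{n=1}^{N_0}f\bigl(X^0_T(\boldsymbol{\zeta}_0^{(n)})\bigr)+\sum_{l=1}^L\frac1{N_l}\sum_{n=1}^{N_l}\Bigl[f\bigl(X^l_T(\boldsymbol{\zeta}_l^{(n)})\bigr)-f\bigl(X^{l-1}_T(\overline{\boldsymbol{\zeta}}_l^{(n)})\bigr)\Bigr],$$ where $\overline{\boldsymbol{\zeta}}_l^{(n)}=\boldsymbol{\varsigma}(\boldsymbol{\zeta}_l^{(n)})$ and $\boldsymbol{\zeta}_l^{(n)}$, $n=1,\dots,N_l$, are i.i.d. copies of $\boldsymbol{\zeta}_l$. Complexity means the computational cost of the estimate; a path at level $l$ consists of $2^l$ time steps.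
   Formalization: Each sampled path uses its own independent copy of X_0 (a shared random X_0 leaves the error bounded below); X_0 is independent of the matrices; the triples of two fine columns and their coarse vector are independent over j; the O-bounds hold uniformly in L at every level. *)

theory Defs
  imports "HOL-Probability.Probability" "HOL-Probability.Stopping_Time"
    "HOL-Library.Landau_Symbols"
begin

section \<open>Levy processes and Levy-driven stochastic differential equations\<close>

text \<open>Time is indexed by the reals, but only nonnegative times matter: a filtration on
  \<open>[0,\<infinity>)\<close> extends constantly to negative times.\<close>

definition filtered_space :: "'w measure \<Rightarrow> (real \<Rightarrow> 'w measure) \<Rightarrow> bool" where
  "filtered_space M F \<longleftrightarrow> prob_space M \<and> filtration (space M) F \<and>
     (\<forall>t. sets (F t) \<subseteq> sets M) \<and>
     (\<forall>t\<ge>0. (\<Inter>u\<in>{t<..}. sets (F u)) \<subseteq> sets (F t))"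

definition cadlag :: "(real \<Rightarrow> 'b::topological_space) \<Rightarrow> bool" where
  "cadlag x \<longleftrightarrow> (\<forall>t\<ge>0. (x \<longlongrightarrow> x t) (at_right t)) \<and> (\<forall>t>0. \<exists>l. (x \<longlongrightarrow> l) (at_left t))"

definition adapted_cadlag ::
  "'w measure \<Rightarrow> (real \<Rightarrow> 'w measure) \<Rightarrow> (real \<Rightarrow> 'w \<Rightarrow> 'b::topological_space) \<Rightarrow> bool" where
  "adapted_cadlag M F X \<longleftrightarrow>
     (\<forall>t\<ge>0. X t \<in> borel_measurable (F t)) \<and> (\<forall>\<omega>\<in>space M. cadlag (\<lambda>t. X t \<omega>))"

definition levy_process ::
  "'w measure \<Rightarrow> (real \<Rightarrow> 'w measure) \<Rightarrow> (real \<Rightarrow> 'w \<Rightarrow> real ^ 'm) \<Rightarrow> bool" where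
  "levy_process M F Z \<longleftrightarrow>
     adapted_cadlag M F Z \<and>
     (AE \<omega> in M. Z 0 \<omega> = 0) \<and>
     (\<forall>s t. 0 \<le> s \<and> s \<le> t \<longrightarrow> prob_space.indep_set M (sets (F s))
        (sets (vimage_algebra (space M) (\<lambda>\<omega>. Z t \<omega> - Z s \<omega>) borel))) \<and>
     (\<forall>s t. 0 \<le> s \<and> s \<le> t \<longrightarrow>
        distr M borel (\<lambda>\<omega>. Z t \<omega> - Z s \<omega>) = distr M borel (Z (t - s))) \<and>
     (\<forall>t\<ge>0. \<forall>e>0.
        ((\<lambda>s. measure M {\<omega>\<in>space M. norm (Z s \<omega> - Z t \<omega>) > e}) \<longlongrightarrow> 0) (at t within {0..}))"

text \<open>The stochastic integral is the extension of the elementary integral of simple predictable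
  processes \<open>\<Sum>i<n. C i 1\<close> on \<open>(T i, T (i+1)]\<close>, with stopping times \<open>T i\<close>, by continuity with
  respect to uniform convergence in probability on compact time intervals (ucp).\<close>

definition simple_predictable ::
  "'w measure \<Rightarrow> (real \<Rightarrow> 'w measure) \<Rightarrow> nat \<Rightarrow> (nat \<Rightarrow> 'w \<Rightarrow> real) \<Rightarrow>
   (nat \<Rightarrow> 'w \<Rightarrow> real ^ 'm ^ 'd) \<Rightarrow> bool" where
  "simple_predictable M F n T C \<longleftrightarrow>
     (\<forall>i\<le>n. stopping_time F (T i)) \<and>
     (\<forall>\<omega>\<in>space M. 0 \<le> T 0 \<omega> \<and> (\<forall>i<n. T i \<omega> \<le> T (Suc i) \<omega>)) \<and>
     (\<forall>i<n. C i \<in> borel_measurable (filtration.pre_sigma (space M) F (T i)))"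

definition simple_process ::
  "nat \<Rightarrow> (nat \<Rightarrow> 'w \<Rightarrow> real) \<Rightarrow> (nat \<Rightarrow> 'w \<Rightarrow> real ^ 'm ^ 'd) \<Rightarrow> real \<Rightarrow> 'w \<Rightarrow> real ^ 'm ^ 'd" where
  "simple_process n T C s \<omega> =
     (\<Sum>i<n. if T i \<omega> < s \<and> s \<le> T (Suc i) \<omega> then C i \<omega> else 0)"

definition simple_integral ::
  "nat \<Rightarrow> (nat \<Rightarrow> 'w \<Rightarrow> real) \<Rightarrow> (nat \<Rightarrow> 'w \<Rightarrow> real ^ 'm ^ 'd) \<Rightarrow>
   (real \<Rightarrow> 'w \<Rightarrow> real ^ 'm) \<Rightarrow> real \<Rightarrow> 'w \<Rightarrow> real ^ 'd" where
  "simple_integral n T C Z t \<omega> =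
     (\<Sum>i<n. C i \<omega> *v (Z (min t (T (Suc i) \<omega>)) \<omega> - Z (min t (T i \<omega>)) \<omega>))"

definition ucp_tendsto ::
  "'w measure \<Rightarrow> (nat \<Rightarrow> real \<Rightarrow> 'w \<Rightarrow> 'b::real_normed_vector) \<Rightarrow> (real \<Rightarrow> 'w \<Rightarrow> 'b) \<Rightarrow> bool" where
  "ucp_tendsto M Y X \<longleftrightarrow>
     (\<forall>t>0. \<forall>e>0.
        (\<lambda>k. measure M {\<omega>\<in>space M. \<exists>s\<in>{0<..t}. norm (Y k s \<omega> - X s \<omega>) > e}) \<longlonglongrightarrow> 0)"

text \<open>For adapted left-continuous integrands \<open>H\<close> with right limits and integrators that are
  semimartingales, approximating sequences exist and all of them have the same limit.\<close>

definition is_stochastic_integral ::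
  "'w measure \<Rightarrow> (real \<Rightarrow> 'w measure) \<Rightarrow> (real \<Rightarrow> 'w \<Rightarrow> real ^ 'm ^ 'd) \<Rightarrow>
   (real \<Rightarrow> 'w \<Rightarrow> real ^ 'm) \<Rightarrow> (real \<Rightarrow> 'w \<Rightarrow> real ^ 'd) \<Rightarrow> bool" where
  "is_stochastic_integral M F H Z I \<longleftrightarrow>
     adapted_cadlag M F I \<and>
     (\<exists>n T C. (\<forall>k. simple_predictable M F (n k) (T k) (C k)) \<and>
        ucp_tendsto M (\<lambda>k. simple_process (n k) (T k) (C k)) H) \<and>
     (\<forall>n T C. (\<forall>k. simple_predictable M F (n k) (T k) (C k)) \<and>
        ucp_tendsto M (\<lambda>k. simple_process (n k) (T k) (C k)) H \<longrightarrow>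
        ucp_tendsto M (\<lambda>k. simple_integral (n k) (T k) (C k) Z) I)"

text \<open>\<open>X t = X0 + \<integral>\<^sub>0\<^sup>t a (X (s-)) dZ s\<close>\<close>

definition levy_sde_solution ::
  "'w measure \<Rightarrow> (real \<Rightarrow> 'w measure) \<Rightarrow> (real \<Rightarrow> 'w \<Rightarrow> real ^ 'm) \<Rightarrow>
   (real ^ 'd \<Rightarrow> real ^ 'm ^ 'd) \<Rightarrow> ('w \<Rightarrow> real ^ 'd) \<Rightarrow> (real \<Rightarrow> 'w \<Rightarrow> real ^ 'd) \<Rightarrow> bool" where
  "levy_sde_solution M F Z a X0 X \<longleftrightarrow>
     adapted_cadlag M F X \<and>
     (\<exists>I. is_stochastic_integral M F (\<lambda>s \<omega>. a (Lim (at_left s) (\<lambda>u. X u \<omega>))) Z I \<and>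
        (AE \<omega> in M. \<forall>t\<ge>0. X t \<omega> = X0 \<omega> + I t \<omega>))"

definition compatible_matrix_norm :: "(real ^ 'm ^ 'd \<Rightarrow> real) \<Rightarrow> bool" where
  "compatible_matrix_norm \<nu> \<longleftrightarrow>
     (\<forall>A. 0 \<le> \<nu> A \<and> (\<nu> A = 0 \<longleftrightarrow> A = 0)) \<and>
     (\<forall>A B. \<nu> (A + B) \<le> \<nu> A + \<nu> B) \<and>
     (\<forall>c A. \<nu> (c *\<^sub>R A) = \<bar>c\<bar> * \<nu> A) \<and>
     (\<forall>A x. norm (A *v x) \<le> \<nu> A * norm x)"

section \<open>Weak multilevel Monte Carlo\<close>

definition iid_vars ::
  "'w measure \<Rightarrow> 'b measure \<Rightarrow> ('i \<Rightarrow> 'w \<Rightarrow> 'b) \<Rightarrow> 'i set \<Rightarrow> bool" where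
  "iid_vars M N X I \<longleftrightarrow>
     prob_space.indep_vars M (\<lambda>_. N) X I \<and> (\<forall>i\<in>I. \<forall>j\<in>I. distr M N (X i) = distr M N (X j))"

text \<open>Matrices with columns \<open>1, \<dots>, 2 ^ l\<close> in \<open>\<real>\<^sup>m\<close>.\<close>

definition mat_space :: "nat \<Rightarrow> (nat \<Rightarrow> real ^ 'm) measure" where
  "mat_space l = PiM {1..2 ^ l} (\<lambda>_. borel)"

definition step :: "real \<Rightarrow> nat \<Rightarrow> real" where
  "step T l = T / 2 ^ l"

primrec euler ::
  "(real ^ 'd \<Rightarrow> real ^ 'm ^ 'd) \<Rightarrow> real ^ 'd \<Rightarrow> (nat \<Rightarrow> real ^ 'm) \<Rightarrow> nat \<Rightarrow> real ^ 'd" where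
  "euler a x z 0 = x"
| "euler a x z (Suc j) = euler a x z j + a (euler a x z j) *v z (Suc j)"

abbreviation euler_end ::
  "(real ^ 'd \<Rightarrow> real ^ 'm ^ 'd) \<Rightarrow> nat \<Rightarrow> real ^ 'd \<Rightarrow> (nat \<Rightarrow> real ^ 'm) \<Rightarrow> real ^ 'd" where
  "euler_end a l x z \<equiv> euler a x z (2 ^ l)"

text \<open>\<open>\<zeta> l\<close> and \<open>\<sigma> l\<close> are the random matrix of level \<open>l\<close> and the map that produces the matrix of
  level \<open>l - 1\<close> from it; the finest level is \<open>L\<close>. The last condition makes precise that the
  \<open>j\<close>-th column of \<open>\<sigma> l (\<zeta> l)\<close> is coupled with columns \<open>2j-1\<close> and \<open>2j\<close> of \<open>\<zeta> l\<close> only.\<close>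

definition coupled_matrices ::
  "'w measure \<Rightarrow> nat \<Rightarrow> (nat \<Rightarrow> 'w \<Rightarrow> nat \<Rightarrow> real ^ 'm) \<Rightarrow>
   (nat \<Rightarrow> (nat \<Rightarrow> real ^ 'm) \<Rightarrow> nat \<Rightarrow> real ^ 'm) \<Rightarrow> bool" where
  "coupled_matrices M L \<zeta> \<sigma> \<longleftrightarrow>
     iid_vars M borel (\<lambda>j \<omega>. \<zeta> L \<omega> j) {1..2 ^ L} \<and>
     prob_space.indep_vars M mat_space \<zeta> {..L} \<and>
     (\<forall>l\<in>{1..L}.
        \<sigma> l \<in> measurable (mat_space l) (mat_space (l - 1)) \<and>
        distr M (mat_space (l - 1)) (\<zeta> (l - 1)) =
          distr M (mat_space (l - 1)) (\<lambda>\<omega>. \<sigma> l (\<zeta> l \<omega>)) \<and>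
        prob_space.indep_vars M (\<lambda>_. borel)
          (\<lambda>j \<omega>. (\<zeta> l \<omega> (2 * j - 1), \<zeta> l \<omega> (2 * j), \<sigma> l (\<zeta> l \<omega>) j)) {1..2 ^ (l - 1)})"

definition coupling_residual ::
  "(nat \<Rightarrow> 'w \<Rightarrow> nat \<Rightarrow> real ^ 'm) \<Rightarrow> (nat \<Rightarrow> (nat \<Rightarrow> real ^ 'm) \<Rightarrow> nat \<Rightarrow> real ^ 'm) \<Rightarrow>
   nat \<Rightarrow> nat \<Rightarrow> 'w \<Rightarrow> real ^ 'm" where
  "coupling_residual \<zeta> \<sigma> l j \<omega> = \<sigma> l (\<zeta> l \<omega>) j - \<zeta> l \<omega> (2 * j - 1) - \<zeta> l \<omega> (2 * j)"

text \<open>\<open>(U l n, W l n)\<close>, for \<open>n = 1, 2, \<dots>\<close>, are i.i.d. copies of \<open>(X0, \<zeta> l)\<close>, independent over the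
  levels \<open>l\<close>: every sampled path has its own initial value, which its fine and its coarse
  version share.\<close>

definition iid_copies ::
  "'w measure \<Rightarrow> nat \<Rightarrow> ('w \<Rightarrow> real ^ 'd) \<Rightarrow> (nat \<Rightarrow> 'w \<Rightarrow> nat \<Rightarrow> real ^ 'm) \<Rightarrow>
   (nat \<Rightarrow> nat \<Rightarrow> 'w \<Rightarrow> real ^ 'd) \<Rightarrow> (nat \<Rightarrow> nat \<Rightarrow> 'w \<Rightarrow> nat \<Rightarrow> real ^ 'm) \<Rightarrow> bool" where
  "iid_copies M L X0 \<zeta> U W \<longleftrightarrow>
     prob_space.indep_vars M (\<lambda>(l, n). borel \<Otimes>\<^sub>M mat_space l)
       (\<lambda>(l, n) \<omega>. (U l n \<omega>, W l n \<omega>)) ({..L} \<times> {1..}) \<and>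
     (\<forall>l\<le>L. \<forall>n\<ge>1.
        distr M (borel \<Otimes>\<^sub>M mat_space l) (\<lambda>\<omega>. (U l n \<omega>, W l n \<omega>)) =
        distr M (borel \<Otimes>\<^sub>M mat_space l) (\<lambda>\<omega>. (X0 \<omega>, \<zeta> l \<omega>)))"

definition mlmc_estimate ::
  "(real ^ 'd \<Rightarrow> real) \<Rightarrow> (real ^ 'd \<Rightarrow> real ^ 'm ^ 'd) \<Rightarrow>
   (nat \<Rightarrow> (nat \<Rightarrow> real ^ 'm) \<Rightarrow> nat \<Rightarrow> real ^ 'm) \<Rightarrow>
   (nat \<Rightarrow> nat \<Rightarrow> 'w \<Rightarrow> real ^ 'd) \<Rightarrow> (nat \<Rightarrow> nat \<Rightarrow> 'w \<Rightarrow> nat \<Rightarrow> real ^ 'm) \<Rightarrow>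
   nat \<Rightarrow> (nat \<Rightarrow> nat) \<Rightarrow> 'w \<Rightarrow> real" where
  "mlmc_estimate f a \<sigma> U W L N \<omega> =
     1 / real (N 0) * (\<Sum>n=1..N 0. f (euler_end a 0 (U 0 n \<omega>) (W 0 n \<omega>))) +
     (\<Sum>l=1..L. 1 / real (N l) *
        (\<Sum>n=1..N l. f (euler_end a l (U l n \<omega>) (W l n \<omega>)) -
           f (euler_end a (l - 1) (U l n \<omega>) (\<sigma> l (W l n \<omega>)))))"

text \<open>The cost is the total number of Euler steps; a sample of level \<open>l \<ge> 1\<close> needs a path of level
  \<open>l\<close> and one of level \<open>l - 1\<close>.\<close>

definition mlmc_cost :: "nat \<Rightarrow> (nat \<Rightarrow> nat) \<Rightarrow> nat" where
  "mlmc_cost L N = N 0 + (\<Sum>l=1..L. N l * (2 ^ l + 2 ^ (l - 1)))"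

end

theory Submission
  imports Defs
begin

text \<open>Let \<open>x\<close> and \<open>y\<close> be the fine and the coarse Euler path of level \<open>l\<close>, driven by the same noise.
  Over one coarse step, the second moment of \<open>x - y\<close> is multiplied by at most \<open>1 + O(\<Delta>)\<close> and
  increased by \<open>O(\<Delta>\<^sup>2)\<close>: the residuals of the coupling are centred and independent of the past, so
  they contribute only their second moment \<open>O(\<Delta>\<^sup>2)\<close>, and of the remaining noise only the mean
  \<open>O(\<Delta>)\<close> enters the cross terms. By the discrete Gronwall inequality the second moment of \<open>x - y\<close>
  at the final time, and hence the variance of a sample of level \<open>l\<close>, is \<open>O(2\<^sup>-\<^sup>l)\<close>, while its cost
  is of order \<open>2\<^sup>l\<close>. The bias of the estimate telescopes to that of level \<open>L\<close>, which is
  \<open>O(2\<^sup>-\<^sup>L\<^sup>/\<^sup>2)\<close> because \<open>\<alpha> \<ge> 1/2\<close>. It therefore suffices to take \<open>2\<^sup>L\<close> of order \<open>\<epsilon>\<^sup>-\<^sup>2\<close> and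
  \<open>N\<^sub>l\<close> of order \<open>\<epsilon>\<^sup>-\<^sup>2 L 2\<^sup>-\<^sup>l\<close>, which makes each of the \<open>L + 1\<close> levels cost \<open>\<epsilon>\<^sup>-\<^sup>2 L\<close>.\<close>

section \<open>Independence\<close>

text \<open>The obstacle is dependence inside a block: a coarse increment may depend on its two fine
  increments in any way, so neither it nor the residual need be independent of them. Only the
  triples of two fine increments and one coarse one are independent across blocks. A coarse step
  therefore starts from a pair of states independent of the whole triple, and the local error is
  split so that every noise term meets a coefficient independent of it:
  \<open>\<xi>1 + \<xi>2\<close> meets \<open>a x - a y\<close>, \<open>\<xi>2\<close> meets
  \<open>a x' - a x\<close>, and the residual meets \<open>a y\<close>. Second moments then
  factorise, and the three terms may depend on each other because their sum is bounded by convexity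
  only. Independence is expressed by product laws, so that the past absorbs a new increment by
  reassociating a product measure. The noise enters the constants only through one \<open>K\<close>,
  so they do not change when the finest level grows as \<open>\<epsilon>\<close> decreases. The
  moment bounds begin at level 1; level 0 is controlled as the coarse partner of level 1.\<close>

context prob_space
begin

text \<open>Unlike \<open>indep_var\<close>, this relates variables with values in different types.\<close>

definition indep_rv ::
  "'b measure \<Rightarrow> ('a \<Rightarrow> 'b) \<Rightarrow> 'c measure \<Rightarrow> ('a \<Rightarrow> 'c) \<Rightarrow> bool" where
  "indep_rv S X T Y \<longleftrightarrow> random_variable S X \<and> random_variable T Y \<and>
     distr M S X \<Otimes>\<^sub>M distr M T Y = distr M (S \<Otimes>\<^sub>M T) (\<lambda>\<omega>. (X \<omega>, Y \<omega>))"

text \<open>The typing forces both variables into one type; in that case the library facts about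
  \<open>indep_var\<close> become available.\<close>

lemma indep_rv_eq_indep_var: "indep_rv S X T Y \<longleftrightarrow> indep_var S X T Y"
  by (simp add: indep_rv_def indep_var_distribution_eq)

lemma indep_rv_measurable:
  assumes "indep_rv S X T Y"
  shows "random_variable S X" "random_variable T Y"
  using assms by (auto simp: indep_rv_def)

text \<open>Product measures are determined on rectangles, where the claim is the product rule for
  preimages. It turns independence of generated sigma-algebras, the form in which the initial value
  and the noise are assumed independent, into a product law.\<close>

lemma indep_rvI:
  assumes rv[measurable]: "random_variable S X" "random_variable T Y"
    and indep: "indep_set (sets (vimage_algebra (space M) X S)) (sets (vimage_algebra (space M) Y T))"
  shows "indep_rv S X T Y"
proof -
  interpret X: prob_space "distr M S X" by (rule prob_space_distr) fact
  interpret Y: prob_space "distr M T Y" by (rule prob_space_distr) fact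
  have "distr M S X \<Otimes>\<^sub>M distr M T Y = distr M (S \<Otimes>\<^sub>M T) (\<lambda>\<omega>. (X \<omega>, Y \<omega>))"
  proof (rule pair_measure_eqI)
    fix A B assume "A \<in> sets (distr M S X)" "B \<in> sets (distr M T Y)"
    hence AB[measurable]: "A \<in> sets S" "B \<in> sets T" by auto
    have "X -` A \<inter> space M \<in> sets (vimage_algebra (space M) X S)"
      "Y -` B \<inter> space M \<in> sets (vimage_algebra (space M) Y T)"
      using AB by (auto intro: in_vimage_algebra)
    with indep have "prob ((X -` A \<inter> space M) \<inter> (Y -` B \<inter> space M))
        = prob (X -` A \<inter> space M) * prob (Y -` B \<inter> space M)"
      by (auto simp: indep_sets2_eq)
    moreover have "(\<lambda>\<omega>. (X \<omega>, Y \<omega>)) -` (A \<times> B) \<inter> space M = (X -` A \<inter> space M) \<inter> (Y -` B \<inter> space M)"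
      by auto
    ultimately show "emeasure (distr M S X) A * emeasure (distr M T Y) B
        = emeasure (distr M (S \<Otimes>\<^sub>M T) (\<lambda>\<omega>. (X \<omega>, Y \<omega>))) (A \<times> B)"
      by (simp add: emeasure_distr emeasure_eq_measure ennreal_mult)
  qed (auto simp: X.sigma_finite_measure_axioms Y.sigma_finite_measure_axioms cong: sets_pair_measure_cong)
  with rv show ?thesis by (simp add: indep_rv_def)
qed

lemma indep_rv_compose:
  assumes XY: "indep_rv S X T Y" and [measurable]: "g \<in> measurable S S'" "h \<in> measurable T T'"
  shows "indep_rv S' (\<lambda>\<omega>. g (X \<omega>)) T' (\<lambda>\<omega>. h (Y \<omega>))"
proof -
  note [measurable] = indep_rv_measurable[OF XY]
  have h: "prob_space (distr M T' (\<lambda>\<omega>. h (Y \<omega>)))" by (rule prob_space_distr) measurable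
  have "distr M S' (\<lambda>\<omega>. g (X \<omega>)) \<Otimes>\<^sub>M distr M T' (\<lambda>\<omega>. h (Y \<omega>))
      = distr (distr M S X) S' g \<Otimes>\<^sub>M distr (distr M T Y) T' h"
    by (simp add: distr_distr o_def)
  also have "\<dots> = distr (distr M S X \<Otimes>\<^sub>M distr M T Y) (S' \<Otimes>\<^sub>M T') (\<lambda>(x, y). (g x, h y))"
    using h by (intro pair_measure_distr) (simp_all add: distr_distr o_def prob_space_imp_sigma_finite)
  also have "\<dots> = distr M (S' \<Otimes>\<^sub>M T') (\<lambda>\<omega>. (g (X \<omega>), h (Y \<omega>)))"
    using XY by (simp add: indep_rv_def distr_distr o_def)
  finally show ?thesis by (simp add: indep_rv_def)
qed

lemma indep_rv_cong:
  assumes "\<And>\<omega>. \<omega> \<in> space M \<Longrightarrow> X \<omega> = X' \<omega>" "\<And>\<omega>. \<omega> \<in> space M \<Longrightarrow> Y \<omega> = Y' \<omega>"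
  shows "indep_rv S X T Y \<longleftrightarrow> indep_rv S X' T Y'"
  using assms by (simp add: indep_rv_def cong: measurable_cong distr_cong)

text \<open>Both assumptions together say that the law of the triple is a threefold product;
  bracketing it to the left gives the claim. This is how a past \<open>P\<close> absorbs the
  increment \<open>A\<close> and stays independent of \<open>B\<close>.\<close>

lemma indep_rv_pair_assoc:
  assumes P: "indep_rv S P (T1 \<Otimes>\<^sub>M T2) (\<lambda>\<omega>. (A \<omega>, B \<omega>))" and AB: "indep_rv T1 A T2 B"
  shows "indep_rv (S \<Otimes>\<^sub>M T1) (\<lambda>\<omega>. (P \<omega>, A \<omega>)) T2 B"
proof -
  have rv[measurable]: "random_variable S P" "random_variable T1 A" "random_variable T2 B"
    using indep_rv_measurable(1)[OF P] indep_rv_measurable[OF AB] by auto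
  interpret P: prob_space "distr M S P" by (rule prob_space_distr) fact
  interpret A: prob_space "distr M T1 A" by (rule prob_space_distr) fact
  interpret B: prob_space "distr M T2 B" by (rule prob_space_distr) fact
  interpret PA: prob_space "distr M (S \<Otimes>\<^sub>M T1) (\<lambda>\<omega>. (P \<omega>, A \<omega>))"
    by (rule prob_space_distr) measurable
  interpret AB: pair_prob_space "distr M T1 A" "distr M T2 B" ..
  have "indep_rv S P T1 A"
    using indep_rv_compose[OF P, of "\<lambda>x. x" S fst T1] by simp
  hence PA: "distr M S P \<Otimes>\<^sub>M distr M T1 A = distr M (S \<Otimes>\<^sub>M T1) (\<lambda>\<omega>. (P \<omega>, A \<omega>))"
    by (simp add: indep_rv_def)
  have ABd: "distr M T1 A \<Otimes>\<^sub>M distr M T2 B = distr M (T1 \<Otimes>\<^sub>M T2) (\<lambda>\<omega>. (A \<omega>, B \<omega>))"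
    using AB by (simp add: indep_rv_def)
  have PABd: "distr M S P \<Otimes>\<^sub>M (distr M T1 A \<Otimes>\<^sub>M distr M T2 B)
      = distr M (S \<Otimes>\<^sub>M (T1 \<Otimes>\<^sub>M T2)) (\<lambda>\<omega>. (P \<omega>, A \<omega>, B \<omega>))"
    using P by (simp add: indep_rv_def ABd)
  have "distr M (S \<Otimes>\<^sub>M T1) (\<lambda>\<omega>. (P \<omega>, A \<omega>)) \<Otimes>\<^sub>M distr M T2 B
      = distr M ((S \<Otimes>\<^sub>M T1) \<Otimes>\<^sub>M T2) (\<lambda>\<omega>. ((P \<omega>, A \<omega>), B \<omega>))"
  proof (rule pair_measure_eqI)
    fix E G
    assume E: "E \<in> sets (distr M (S \<Otimes>\<^sub>M T1) (\<lambda>\<omega>. (P \<omega>, A \<omega>)))" and G: "G \<in> sets (distr M T2 B)"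
    \<comment> \<open>\<open>H\<close> is the event \<open>E \<times> G\<close> rewritten for the
      right-hand bracketing, where the product law is known.\<close>
    define H where "H = {(p, q). (p, fst q) \<in> E \<and> snd q \<in> G} \<inter> space (S \<Otimes>\<^sub>M (T1 \<Otimes>\<^sub>M T2))"
    have [measurable]: "E \<in> sets (S \<Otimes>\<^sub>M T1)" "G \<in> sets T2" using E G by auto
    have "H = (\<lambda>z. ((fst z, fst (snd z)), snd (snd z))) -` (E \<times> G) \<inter> space (S \<Otimes>\<^sub>M (T1 \<Otimes>\<^sub>M T2))"
      by (auto simp: H_def)
    also have "\<dots> \<in> sets (S \<Otimes>\<^sub>M (T1 \<Otimes>\<^sub>M T2))"
      by (rule measurable_sets[where A = "(S \<Otimes>\<^sub>M T1) \<Otimes>\<^sub>M T2"]) measurable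
    finally have H[measurable]: "H \<in> sets (S \<Otimes>\<^sub>M (T1 \<Otimes>\<^sub>M T2))" .
    \<comment> \<open>For fixed \<open>p\<close> the event is a rectangle, so the inner measure
      factorises and the \<open>G\<close> factor leaves the integral over \<open>p\<close>.\<close>
    have slice: "Pair p -` H = (Pair p -` E) \<times> G" if "p \<in> space S" for p
      using that sets.sets_into_space[OF \<open>E \<in> sets (S \<Otimes>\<^sub>M T1)\<close>] sets.sets_into_space[OF \<open>G \<in> sets T2\<close>]
      by (fastforce simp: H_def space_pair_measure)
    have "emeasure (distr M ((S \<Otimes>\<^sub>M T1) \<Otimes>\<^sub>M T2) (\<lambda>\<omega>. ((P \<omega>, A \<omega>), B \<omega>))) (E \<times> G)
        = emeasure (distr M (S \<Otimes>\<^sub>M (T1 \<Otimes>\<^sub>M T2)) (\<lambda>\<omega>. (P \<omega>, A \<omega>, B \<omega>))) H"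
      using rv[THEN measurable_space]
      by (auto simp: emeasure_distr H_def space_pair_measure intro!: arg_cong[where f = "emeasure M"])
    also have "\<dots> = (\<integral>\<^sup>+p. emeasure (distr M T1 A \<Otimes>\<^sub>M distr M T2 B) (Pair p -` H) \<partial>distr M S P)"
      unfolding PABd[symmetric] by (rule AB.P.emeasure_pair_measure_alt) (simp add: H cong: sets_pair_measure_cong)
    also have "\<dots> = (\<integral>\<^sup>+p. emeasure (distr M T1 A) (Pair p -` E) * emeasure (distr M T2 B) G \<partial>distr M S P)"
      by (rule nn_integral_cong) (simp add: slice B.emeasure_pair_measure_Times sets_Pair1)
    also have "\<dots> = (\<integral>\<^sup>+p. emeasure (distr M T1 A) (Pair p -` E) \<partial>distr M S P) * emeasure (distr M T2 B) G"
      by (rule nn_integral_multc)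
        (simp, rule A.measurable_emeasure_Pair, simp cong: sets_pair_measure_cong)
    also have "(\<integral>\<^sup>+p. emeasure (distr M T1 A) (Pair p -` E) \<partial>distr M S P)
        = emeasure (distr M (S \<Otimes>\<^sub>M T1) (\<lambda>\<omega>. (P \<omega>, A \<omega>))) E"
      unfolding PA[symmetric]
      by (rule A.emeasure_pair_measure_alt[symmetric]) (simp cong: sets_pair_measure_cong)
    finally show "emeasure (distr M (S \<Otimes>\<^sub>M T1) (\<lambda>\<omega>. (P \<omega>, A \<omega>))) E * emeasure (distr M T2 B) G
      = emeasure (distr M ((S \<Otimes>\<^sub>M T1) \<Otimes>\<^sub>M T2) (\<lambda>\<omega>. ((P \<omega>, A \<omega>), B \<omega>))) (E \<times> G)" by simp
  qed (auto simp: PA.sigma_finite_measure_axioms B.sigma_finite_measure_axioms cong: sets_pair_measure_cong)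
  thus ?thesis by (simp add: indep_rv_def)
qed

text \<open>A state driven by independent blocks never looks ahead: after \<open>j\<close> updates
  it is a function of the initial state and the first \<open>j\<close> blocks.\<close>

lemma indep_rv_recursion:
  assumes B: "indep_vars (\<lambda>_. S) B {1..J}"
    and P0: "indep_rv R (P 0) (PiM {1..J} (\<lambda>_. S)) (\<lambda>\<omega>. \<lambda>i\<in>{1..J}. B i \<omega>)"
    and step: "\<And>j \<omega>. j < J \<Longrightarrow> \<omega> \<in> space M \<Longrightarrow> P (Suc j) \<omega> = h (P j \<omega>, B (Suc j) \<omega>)"
    and h: "h \<in> measurable (R \<Otimes>\<^sub>M S) R"
    and j: "j < J"
  shows "indep_rv R (P j) S (B (Suc j))"
proof -
  let ?Q = "\<lambda>j. PiM {Suc j..J} (\<lambda>_. S)" and ?C = "\<lambda>j \<omega>. \<lambda>i\<in>{Suc j..J}. B i \<omega>"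
  have [measurable]: "random_variable S (B i)" if "i \<in> {1..J}" for i
    using B that by (auto simp: indep_vars_def)
  \<comment> \<open>The induction needs a stronger invariant: independence of all remaining blocks
    jointly. The first remaining block is split off, moved to the past, and consumed by
    \<open>h\<close>.\<close>
  have main: "indep_rv R (P j) (?Q j) (?C j)" if "j \<le> J" for j
    using that
  proof (induction j)
    case 0
    then show ?case using P0 by (simp only: One_nat_def)
  next
    case (Suc j)
    have IH: "indep_rv R (P j) (?Q j) (?C j)" by (rule Suc.IH) (use Suc.prems in simp)
    have "indep_rv R (P j) (S \<Otimes>\<^sub>M ?Q (Suc j))
        (\<lambda>\<omega>. (?C j \<omega> (Suc j), restrict (?C j \<omega>) {Suc (Suc j)..J}))"
    proof (rule indep_rv_compose[OF IH, where g = "\<lambda>x. x"])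
      show "(\<lambda>x. (x (Suc j), restrict x {Suc (Suc j)..J})) \<in> ?Q j \<rightarrow>\<^sub>M S \<Otimes>\<^sub>M ?Q (Suc j)"
        by (intro measurable_Pair measurable_component_singleton measurable_restrict_subset)
          (use Suc.prems in auto)
    qed simp
    also have "(\<lambda>\<omega>. (?C j \<omega> (Suc j), restrict (?C j \<omega>) {Suc (Suc j)..J}))
        = (\<lambda>\<omega>. (B (Suc j) \<omega>, ?C (Suc j) \<omega>))"
      using Suc.prems by (auto simp: fun_eq_iff restrict_def)
    finally have 1: "indep_rv R (P j) (S \<Otimes>\<^sub>M ?Q (Suc j)) (\<lambda>\<omega>. (B (Suc j) \<omega>, ?C (Suc j) \<omega>))" .
    have "indep_rv (PiM {Suc j} (\<lambda>_. S)) (\<lambda>\<omega>. \<lambda>i\<in>{Suc j}. B i \<omega>) (?Q (Suc j)) (?C (Suc j))"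
      using Suc.prems unfolding indep_rv_eq_indep_var by (intro indep_var_restrict[OF B]) auto
    from indep_rv_compose[OF this, of "\<lambda>x. x (Suc j)" S "\<lambda>x. x"]
    have 2: "indep_rv S (B (Suc j)) (?Q (Suc j)) (?C (Suc j))" by simp
    have "indep_rv R (\<lambda>\<omega>. h (P j \<omega>, B (Suc j) \<omega>)) (?Q (Suc j)) (?C (Suc j))"
      by (rule indep_rv_compose[OF indep_rv_pair_assoc[OF 1 2] h, where h = "\<lambda>x. x"]) simp
    thus ?case using step Suc.prems by (subst indep_rv_cong) auto
  qed
  have "indep_rv R (P j) S (\<lambda>\<omega>. ?C j \<omega> (Suc j))"
    using j by (intro indep_rv_compose[OF main, where g = "\<lambda>x. x"]) auto
  thus ?thesis using j by simp
qed

text \<open>The second moment is taken about an arbitrary constant in order to include the bias.\<close>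

lemma sum_indep_second_moment:
  fixes V :: "'i \<Rightarrow> 'a \<Rightarrow> real"
  assumes I: "finite I" and indep: "indep_vars (\<lambda>_. borel) V I"
    and sq: "\<And>i. i \<in> I \<Longrightarrow> integrable M (\<lambda>\<omega>. (V i \<omega>)\<^sup>2)"
  shows "integrable M (\<lambda>\<omega>. ((\<Sum>i\<in>I. V i \<omega>) - v)\<^sup>2)"
    and "(\<integral>\<omega>. ((\<Sum>i\<in>I. V i \<omega>) - v)\<^sup>2 \<partial>M)
      = (\<Sum>i\<in>I. variance (V i)) + ((\<Sum>i\<in>I. expectation (V i)) - v)\<^sup>2"
proof -
  have rv[measurable]: "V i \<in> borel_measurable M" if "i \<in> I" for i
    using indep that by (auto simp: indep_vars_def)
  have int: "integrable M (V i)" if "i \<in> I" for i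
    by (rule square_integrable_imp_integrable) (use that sq in auto)
  define D where "D i \<omega> = V i \<omega> - expectation (V i)" for i \<omega>
  have D: "integrable M (D i)" "expectation (D i) = 0" if "i \<in> I" for i
    using int[OF that] by (auto simp: D_def[abs_def] prob_space)
  have DD: "integrable M (\<lambda>\<omega>. D i \<omega> * D j \<omega>)"
    and DD0: "i \<noteq> j \<Longrightarrow> (\<integral>\<omega>. D i \<omega> * D j \<omega> \<partial>M) = 0" if ij: "i \<in> I" "j \<in> I" for i j
  proof -
    have ind: "indep_var borel (D i) borel (D j)" if "i \<noteq> j"
    proof -
      have "indep_var (PiM {i} (\<lambda>_. borel)) (\<lambda>\<omega>. \<lambda>k\<in>{i}. V k \<omega>) (PiM {j} (\<lambda>_. borel)) (\<lambda>\<omega>. \<lambda>k\<in>{j}. V k \<omega>)"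
        using that ij by (intro indep_var_restrict[OF indep]) auto
      from indep_rv_compose[OF this[folded indep_rv_eq_indep_var], of "\<lambda>x. x i - expectation (V i)" borel
          "\<lambda>x. x j - expectation (V j)" borel]
      show ?thesis unfolding D_def indep_rv_eq_indep_var by simp
    qed
    show "i \<noteq> j \<Longrightarrow> (\<integral>\<omega>. D i \<omega> * D j \<omega> \<partial>M) = 0"
      using indep_var_lebesgue_integral[OF ind D(1)[OF ij(1)] D(1)[OF ij(2)]] D ij by simp
    show "integrable M (\<lambda>\<omega>. D i \<omega> * D j \<omega>)"
    proof (cases "i = j")
      case True
      have "integrable M (\<lambda>\<omega>. (V i \<omega>)\<^sup>2 - 2 * expectation (V i) * V i \<omega> + (expectation (V i))\<^sup>2)"
        using sq int ij by auto
      moreover have "(\<lambda>\<omega>. D i \<omega> * D j \<omega>) = (\<lambda>\<omega>. (V i \<omega>)\<^sup>2 - 2 * expectation (V i) * V i \<omega> + (expectation (V i))\<^sup>2)"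
        using True by (simp add: D_def fun_eq_iff power2_eq_square algebra_simps)
      ultimately show ?thesis by simp
    next
      case False
      show ?thesis by (rule indep_var_integrable[OF ind[OF False] D(1)[OF ij(1)] D(1)[OF ij(2)]])
    qed
  qed
  \<comment> \<open>\<open>b\<close> is the deterministic part left after centring: in the expansion
    below only the diagonal terms of the \<open>D i\<close> and \<open>b\<^sup>2\<close> survive
    integration.\<close>
  define b where "b = (\<Sum>i\<in>I. expectation (V i)) - v"
  have eq: "((\<Sum>i\<in>I. V i \<omega>) - v)\<^sup>2
    = (\<Sum>i\<in>I. \<Sum>j\<in>I. D i \<omega> * D j \<omega>) + (2 * b * (\<Sum>i\<in>I. D i \<omega>) + b\<^sup>2)" for \<omega>
  proof -
    have "(\<Sum>i\<in>I. V i \<omega>) - v = (\<Sum>i\<in>I. D i \<omega>) + b" by (simp add: D_def b_def sum_subtractf)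
    thus ?thesis by (simp add: power2_sum sum_product power2_eq_square algebra_simps)
  qed
  show "integrable M (\<lambda>\<omega>. ((\<Sum>i\<in>I. V i \<omega>) - v)\<^sup>2)"
    unfolding eq using D DD by (intro Bochner_Integration.integrable_add Bochner_Integration.integrable_sum
      integrable_mult_right) auto
  have "(\<integral>\<omega>. ((\<Sum>i\<in>I. V i \<omega>) - v)\<^sup>2 \<partial>M) = (\<Sum>i\<in>I. \<Sum>j\<in>I. (\<integral>\<omega>. D i \<omega> * D j \<omega> \<partial>M)) + b\<^sup>2"
    unfolding eq using D DD by (simp add: prob_space)
  also have "(\<Sum>i\<in>I. \<Sum>j\<in>I. (\<integral>\<omega>. D i \<omega> * D j \<omega> \<partial>M)) = (\<Sum>i\<in>I. \<Sum>j\<in>I. if i = j then variance (V i) else 0)"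
    by (intro sum.cong refl) (auto simp: DD0, simp add: D_def power2_eq_square)
  also have "\<dots> = (\<Sum>i\<in>I. variance (V i))" using I by simp
  finally show "(\<integral>\<omega>. ((\<Sum>i\<in>I. V i \<omega>) - v)\<^sup>2 \<partial>M)
      = (\<Sum>i\<in>I. variance (V i)) + ((\<Sum>i\<in>I. expectation (V i)) - v)\<^sup>2"
    by (simp add: b_def)
qed

end

section \<open>Square integrable variables\<close>

text \<open>State pairs and noise triples take values in \<open>borel\<close> of a product type
  rather than in a product of measures; continuity of the projections makes their components
  measurable.\<close>

lemma borel_measurable_fst_borel[measurable (raw)]:
  assumes "g \<in> borel_measurable N"
  shows "(\<lambda>x. fst (g x)) \<in> borel_measurable N"
  by (rule measurable_compose[OF assms borel_measurable_continuous_onI]) (intro continuous_intros)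

lemma borel_measurable_snd_borel[measurable (raw)]:
  assumes "g \<in> borel_measurable N"
  shows "(\<lambda>x. snd (g x)) \<in> borel_measurable N"
  by (rule measurable_compose[OF assms borel_measurable_continuous_onI]) (intro continuous_intros)

context prob_space
begin

lemma indep_rv_real_mult:
  fixes X Y :: "'a \<Rightarrow> real"
  assumes "indep_rv borel X borel Y" "integrable M X" "integrable M Y"
  shows "integrable M (\<lambda>\<omega>. X \<omega> * Y \<omega>)"
    and "(\<integral>\<omega>. X \<omega> * Y \<omega> \<partial>M) = (\<integral>\<omega>. X \<omega> \<partial>M) * (\<integral>\<omega>. Y \<omega> \<partial>M)"
  using indep_var_integrable indep_var_lebesgue_integral assms by (auto simp: indep_rv_eq_indep_var)

text \<open>The scalar product rule applied in each coordinate. The mean of \<open>Y\<close> is kept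
  inside the integral so that the integrand can afterwards be estimated pointwise.\<close>

lemma indep_rv_inner:
  fixes X Y :: "'a \<Rightarrow> 'b::euclidean_space"
  assumes XY: "indep_rv borel X borel Y" and X: "integrable M X" and Y: "integrable M Y"
  shows "integrable M (\<lambda>\<omega>. X \<omega> \<bullet> Y \<omega>)"
    and "(\<integral>\<omega>. X \<omega> \<bullet> Y \<omega> \<partial>M) = (\<integral>\<omega>. X \<omega> \<bullet> (\<integral>\<omega>. Y \<omega> \<partial>M) \<partial>M)"
proof -
  have ind: "indep_rv borel (\<lambda>\<omega>. X \<omega> \<bullet> b) borel (\<lambda>\<omega>. Y \<omega> \<bullet> b)" for b
    by (rule indep_rv_compose[OF XY]) auto
  have iX: "integrable M (\<lambda>\<omega>. X \<omega> \<bullet> b)" and iY: "integrable M (\<lambda>\<omega>. Y \<omega> \<bullet> b)" for b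
    using X Y by auto
  note mult = indep_rv_real_mult[OF ind iX iY]
  show "integrable M (\<lambda>\<omega>. X \<omega> \<bullet> Y \<omega>)"
    by (subst euclidean_inner) (intro Bochner_Integration.integrable_sum mult)
  have "(\<integral>\<omega>. X \<omega> \<bullet> Y \<omega> \<partial>M) = (\<Sum>b\<in>Basis. (\<integral>\<omega>. X \<omega> \<bullet> b \<partial>M) * (\<integral>\<omega>. Y \<omega> \<bullet> b \<partial>M))"
    by (subst euclidean_inner) (simp add: mult)
  also have "\<dots> = (\<integral>\<omega>. X \<omega> \<partial>M) \<bullet> (\<integral>\<omega>. Y \<omega> \<partial>M)"
    using X Y by (subst euclidean_inner) simp
  also have "\<dots> = (\<integral>\<omega>. X \<omega> \<bullet> (\<integral>\<omega>. Y \<omega> \<partial>M) \<partial>M)" using X by simp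
  finally show "(\<integral>\<omega>. X \<omega> \<bullet> Y \<omega> \<partial>M) = (\<integral>\<omega>. X \<omega> \<bullet> (\<integral>\<omega>. Y \<omega> \<partial>M) \<partial>M)" .
qed

definition sq_integrable :: "('a \<Rightarrow> 'b::{real_normed_vector,second_countable_topology}) \<Rightarrow> bool" where
  "sq_integrable X \<longleftrightarrow> X \<in> borel_measurable M \<and> integrable M (\<lambda>\<omega>. (norm (X \<omega>))\<^sup>2)"

lemma sq_integrableD:
  assumes "sq_integrable X"
  shows "X \<in> borel_measurable M" "integrable M (\<lambda>\<omega>. (norm (X \<omega>))\<^sup>2)"
  using assms by (auto simp: sq_integrable_def)

lemma sq_integrable_bound:
  assumes g: "integrable M g" and X: "X \<in> borel_measurable M"
    and le: "\<And>\<omega>. \<omega> \<in> space M \<Longrightarrow> (norm (X \<omega>))\<^sup>2 \<le> g \<omega>"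
  shows "sq_integrable X"
  unfolding sq_integrable_def
proof (intro conjI X Bochner_Integration.integrable_bound[OF g] AE_I2)
  fix \<omega> assume "\<omega> \<in> space M"
  from le[OF this] show "norm ((norm (X \<omega>))\<^sup>2) \<le> norm (g \<omega>)" by simp
qed (use X in simp)

lemma sq_integrable_add:
  fixes X Y :: "'a \<Rightarrow> 'b::{real_normed_vector,second_countable_topology}"
  assumes X: "sq_integrable X" and Y: "sq_integrable Y"
  shows "sq_integrable (\<lambda>\<omega>. X \<omega> + Y \<omega>)"
proof (rule sq_integrable_bound)
  note [measurable] = sq_integrableD(1)[OF X] sq_integrableD(1)[OF Y]
  show "(\<lambda>\<omega>. X \<omega> + Y \<omega>) \<in> borel_measurable M" by measurable
  show "integrable M (\<lambda>\<omega>. 2 * (norm (X \<omega>))\<^sup>2 + 2 * (norm (Y \<omega>))\<^sup>2)"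
    using X Y by (auto simp: sq_integrable_def)
  fix \<omega>
  have "(norm (X \<omega> + Y \<omega>))\<^sup>2 \<le> (norm (X \<omega>) + norm (Y \<omega>))\<^sup>2"
    by (intro power_mono norm_triangle_ineq norm_ge_zero)
  also have "\<dots> \<le> 2 * (norm (X \<omega>))\<^sup>2 + 2 * (norm (Y \<omega>))\<^sup>2"
    using sum_squares_bound[of "norm (X \<omega>)" "norm (Y \<omega>)"] by (simp add: power2_sum)
  finally show "(norm (X \<omega> + Y \<omega>))\<^sup>2 \<le> 2 * (norm (X \<omega>))\<^sup>2 + 2 * (norm (Y \<omega>))\<^sup>2" .
qed

lemma sq_integrable_uminus: "sq_integrable X \<Longrightarrow> sq_integrable (\<lambda>\<omega>. - X \<omega>)"
  by (simp add: sq_integrable_def)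

lemma sq_integrable_diff:
  assumes "sq_integrable X" "sq_integrable Y"
  shows "sq_integrable (\<lambda>\<omega>. X \<omega> - Y \<omega>)"
  using sq_integrable_add[OF assms(1) sq_integrable_uminus[OF assms(2)]] by simp

lemma sq_integrable_mult:
  assumes X: "sq_integrable X" and Y: "sq_integrable Y"
  shows "integrable M (\<lambda>\<omega>. norm (X \<omega>) * norm (Y \<omega>))"
proof (rule Bochner_Integration.integrable_bound)
  note [measurable] = sq_integrableD(1)[OF X] sq_integrableD(1)[OF Y]
  show "integrable M (\<lambda>\<omega>. (norm (X \<omega>))\<^sup>2 + (norm (Y \<omega>))\<^sup>2)"
    using X Y by (auto simp: sq_integrable_def)
  show "(\<lambda>\<omega>. norm (X \<omega>) * norm (Y \<omega>)) \<in> borel_measurable M" by measurable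
  show "AE \<omega> in M. norm (norm (X \<omega>) * norm (Y \<omega>)) \<le> norm ((norm (X \<omega>))\<^sup>2 + (norm (Y \<omega>))\<^sup>2)"
  proof (rule AE_I2)
    fix \<omega>
    have "norm (X \<omega>) * norm (Y \<omega>) \<le> (norm (X \<omega>))\<^sup>2 + (norm (Y \<omega>))\<^sup>2"
      using sum_squares_bound[of "norm (X \<omega>)" "norm (Y \<omega>)"]
        mult_nonneg_nonneg[OF norm_ge_zero[of "X \<omega>"] norm_ge_zero[of "Y \<omega>"]] by linarith
    thus "norm (norm (X \<omega>) * norm (Y \<omega>)) \<le> norm ((norm (X \<omega>))\<^sup>2 + (norm (Y \<omega>))\<^sup>2)" by simp
  qed
qed

lemma sq_integrable_inner:
  fixes X Y :: "'a \<Rightarrow> 'b::euclidean_space"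
  assumes X: "sq_integrable X" and Y: "sq_integrable Y"
  shows "integrable M (\<lambda>\<omega>. X \<omega> \<bullet> Y \<omega>)"
proof (rule Bochner_Integration.integrable_bound[OF sq_integrable_mult[OF X Y]])
  note [measurable] = sq_integrableD(1)[OF X] sq_integrableD(1)[OF Y]
  show "(\<lambda>\<omega>. X \<omega> \<bullet> Y \<omega>) \<in> borel_measurable M" by measurable
qed (auto intro: Cauchy_Schwarz_ineq2)

lemma sq_integrable_imp_integrable:
  fixes X :: "'a \<Rightarrow> 'b::euclidean_space"
  assumes X: "sq_integrable X"
  shows "integrable M X"
proof (rule Bochner_Integration.integrable_bound)
  show "integrable M (\<lambda>\<omega>. 1 + (norm (X \<omega>))\<^sup>2)" using X by (auto simp: sq_integrable_def)
  show "X \<in> borel_measurable M" using X by (rule sq_integrableD)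
  show "AE \<omega> in M. norm (X \<omega>) \<le> norm (1 + (norm (X \<omega>))\<^sup>2)"
  proof (rule AE_I2)
    fix \<omega> show "norm (X \<omega>) \<le> norm (1 + (norm (X \<omega>))\<^sup>2)"
      using sum_squares_bound[of 1 "norm (X \<omega>)"] norm_ge_zero[of "X \<omega>"]
      by (simp only: real_norm_def one_power2 mult_1_right)
  qed
qed

text \<open>The bound \<open>g\<close> of the coefficient only has to be integrable, not square integrable, because the
  noise \<open>\<xi>\<close> is independent of it.\<close>

lemma indep_rv_sq_bound:
  fixes \<xi> :: "'a \<Rightarrow> 'c::euclidean_space" and G :: "'a \<Rightarrow> 'd::{real_normed_vector,second_countable_topology}"
  assumes ind: "indep_rv borel g borel \<xi>" and g: "integrable M g" and \<xi>: "sq_integrable \<xi>"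
    and G: "G \<in> borel_measurable M"
    and le: "\<And>\<omega>. \<omega> \<in> space M \<Longrightarrow> (norm (G \<omega>))\<^sup>2 \<le> g \<omega> * (norm (\<xi> \<omega>))\<^sup>2"
  shows "sq_integrable G"
    and "(\<integral>\<omega>. (norm (G \<omega>))\<^sup>2 \<partial>M) \<le> (\<integral>\<omega>. g \<omega> \<partial>M) * (\<integral>\<omega>. (norm (\<xi> \<omega>))\<^sup>2 \<partial>M)"
proof -
  have ind': "indep_rv borel g borel (\<lambda>\<omega>. (norm (\<xi> \<omega>))\<^sup>2)"
    by (rule indep_rv_compose[OF ind, where g = "\<lambda>x. x"]) auto
  note mult = indep_rv_real_mult[OF ind' g sq_integrableD(2)[OF \<xi>]]
  show *: "sq_integrable G" by (rule sq_integrable_bound[OF mult(1) G le])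
  show "(\<integral>\<omega>. (norm (G \<omega>))\<^sup>2 \<partial>M) \<le> (\<integral>\<omega>. g \<omega> \<partial>M) * (\<integral>\<omega>. (norm (\<xi> \<omega>))\<^sup>2 \<partial>M)"
    unfolding mult(2)[symmetric]
    by (intro integral_mono sq_integrableD[OF *] mult(1) le)
qed

text \<open>Moving the matrix to the other side of the inner product separates the past \<open>D, A\<close> from \<open>\<xi>\<close>.\<close>

lemma indep_rv_inner_matrix:
  fixes D :: "'a \<Rightarrow> real ^ 'd" and A :: "'a \<Rightarrow> real ^ 'm ^ 'd" and \<xi> :: "'a \<Rightarrow> real ^ 'm"
  assumes ind: "indep_rv borel (\<lambda>\<omega>. D \<omega> v* A \<omega>) borel \<xi>"
    and DA: "integrable M (\<lambda>\<omega>. D \<omega> v* A \<omega>)" and \<xi>: "integrable M \<xi>"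
  shows "(\<integral>\<omega>. D \<omega> \<bullet> (A \<omega> *v \<xi> \<omega>) \<partial>M) = (\<integral>\<omega>. D \<omega> \<bullet> (A \<omega> *v (\<integral>\<omega>. \<xi> \<omega> \<partial>M)) \<partial>M)"
  using indep_rv_inner(2)[OF ind DA \<xi>] by (simp add: dot_lmul_matrix)

end

section \<open>One Euler step\<close>

text \<open>A matrix and its transpose have the same operator norm: testing \<open>A\<close> on the
  vector \<open>d v* A\<close> itself produces the square of its norm, and one factor
  cancels.\<close>

lemma norm_vector_matrix_le:
  fixes A :: "real ^ 'm ^ 'd" and d :: "real ^ 'd"
  assumes A: "\<And>v. norm (A *v v) \<le> c * norm v"
  shows "norm (d v* A) \<le> c * norm d"
proof -
  let ?V = "d v* A"
  \<comment> \<open>Any unit vector shows this; \<open>undefined\<close> merely names some index of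
    the nonempty index type.\<close>
  have c: "0 \<le> c" using order_trans[OF norm_ge_zero A[of "axis undefined 1"]] by (simp add: norm_axis_1)
  have "(norm ?V)\<^sup>2 = d \<bullet> (A *v ?V)" by (simp add: power2_norm_eq_inner dot_lmul_matrix)
  also have "\<dots> \<le> norm d * norm (A *v ?V)" by (rule norm_cauchy_schwarz)
  also have "\<dots> \<le> norm d * (c * norm ?V)" by (intro mult_left_mono A norm_ge_zero)
  finally have "norm ?V * norm ?V \<le> (c * norm d) * norm ?V" by (simp add: power2_eq_square mult_ac)
  thus ?thesis
    using c by (cases "norm ?V = 0") (auto simp: mult_le_cancel_right)
qed

text \<open>The conditions are put on the action on vectors, which is all that a compatible matrix
  norm has to provide; no matrix norm appears from here on until the final theorem.\<close>

locale euler_coefficient =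
  fixes a :: "real ^ 'd \<Rightarrow> real ^ 'm ^ 'd" and La Ba :: real
  assumes La: "0 \<le> La" and Ba: "0 \<le> Ba"
    and lip: "norm ((a x - a x') *v v) \<le> La * norm (x - x') * norm v"
    and growth: "(norm (a x *v v))\<^sup>2 \<le> Ba\<^sup>2 * (1 + (norm x)\<^sup>2) * (norm v)\<^sup>2"
begin

lemma growth_sqrt: "norm (a x *v v) \<le> Ba * sqrt (1 + (norm x)\<^sup>2) * norm v"
  by (rule power2_le_imp_le) (use growth[of x v] Ba in \<open>auto simp: power_mult_distrib\<close>)

text \<open>Each matrix entry is a component of the action on a basis vector, so it inherits the
  Lipschitz bound. Continuity is what makes the Euler paths measurable.\<close>

lemma continuous_coefficient: "continuous_on UNIV a"
proof -
  have "continuous_on UNIV (\<lambda>x. a x $ i $ j)" for i j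
  proof (rule Lipschitz.lipschitz_on_continuous_on[of La], rule lipschitz_onI)
    fix x y
    have "dist (a x $ i $ j) (a y $ i $ j) = \<bar>((a x - a y) *v axis j 1) $ i\<bar>"
      by (simp add: matrix_vector_mult_basis column_def dist_real_def)
    also have "\<dots> \<le> norm ((a x - a y) *v axis j 1)" by (rule component_le_norm_cart)
    also have "\<dots> \<le> La * dist x y" using lip[of x y "axis j 1"] by (simp add: dist_norm norm_axis_1)
    finally show "dist (a x $ i $ j) (a y $ i $ j) \<le> La * dist x y" .
  qed (rule La)
  hence "continuous_on UNIV (\<lambda>x. \<chi> i j. a x $ i $ j)"
    by (intro continuous_on_vec_lambda)
  thus ?thesis by simp
qed

lemma coefficient_mult_measurable[measurable]:
  assumes [measurable]: "x \<in> borel_measurable N" "v \<in> borel_measurable N"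
  shows "(\<lambda>\<omega>. a (x \<omega>) *v v \<omega>) \<in> borel_measurable N"
proof -
  have "continuous_on UNIV (\<lambda>p. a (fst p) *v snd p)"
    unfolding matrix_vector_mult_def
    by (intro continuous_intros continuous_on_vec_lambda continuous_on_component
        continuous_on_compose2[OF continuous_coefficient]) auto
  hence [measurable]: "(\<lambda>p. a (fst p) *v snd p) \<in> borel_measurable borel"
    by (rule borel_measurable_continuous_onI)
  have "(\<lambda>\<omega>. a (fst (x \<omega>, v \<omega>)) *v snd (x \<omega>, v \<omega>)) \<in> borel_measurable N"
    by (rule measurable_compose[of "\<lambda>\<omega>. (x \<omega>, v \<omega>)" N borel]) measurable
  thus ?thesis by simp
qed

lemma mult_coefficient_measurable[measurable]:
  assumes [measurable]: "x \<in> borel_measurable N" "d \<in> borel_measurable N"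
  shows "(\<lambda>\<omega>. d \<omega> v* a (x \<omega>)) \<in> borel_measurable N"
proof -
  have "continuous_on UNIV (\<lambda>p. snd p v* a (fst p))"
    unfolding vector_matrix_mult_def
    by (intro continuous_intros continuous_on_vec_lambda continuous_on_component
        continuous_on_compose2[OF continuous_coefficient]) auto
  hence [measurable]: "(\<lambda>p. snd p v* a (fst p)) \<in> borel_measurable borel"
    by (rule borel_measurable_continuous_onI)
  have "(\<lambda>\<omega>. snd (x \<omega>, d \<omega>) v* a (fst (x \<omega>, d \<omega>))) \<in> borel_measurable N"
    by (rule measurable_compose[of "\<lambda>\<omega>. (x \<omega>, d \<omega>)" N borel]) measurable
  thus ?thesis by simp
qed

end

locale euler_scheme = prob_space M + euler_coefficient a La Ba
  for M :: "'w measure" and a :: "real ^ 'd \<Rightarrow> real ^ 'm ^ 'd" and La Ba :: real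
begin

text \<open>State and noise are independent, so the expectation of the product of their squared
  norms factorises; second moments of both suffice, fourth moments never appear.\<close>

lemma coefficient_noise:
  assumes ind: "indep_rv borel x borel \<xi>" and x: "sq_integrable x" and \<xi>: "sq_integrable \<xi>"
  shows "sq_integrable (\<lambda>\<omega>. a (x \<omega>) *v \<xi> \<omega>)"
    and "(\<integral>\<omega>. (norm (a (x \<omega>) *v \<xi> \<omega>))\<^sup>2 \<partial>M)
      \<le> Ba\<^sup>2 * (1 + (\<integral>\<omega>. (norm (x \<omega>))\<^sup>2 \<partial>M)) * (\<integral>\<omega>. (norm (\<xi> \<omega>))\<^sup>2 \<partial>M)"
proof -
  note [measurable] = sq_integrableD(1)[OF x] sq_integrableD(1)[OF \<xi>]
  have ind': "indep_rv borel (\<lambda>\<omega>. Ba\<^sup>2 * (1 + (norm (x \<omega>))\<^sup>2)) borel \<xi>"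
    by (rule indep_rv_compose[OF ind, where h = "\<lambda>x. x"]) auto
  have int: "integrable M (\<lambda>\<omega>. Ba\<^sup>2 * (1 + (norm (x \<omega>))\<^sup>2))"
    using sq_integrableD(2)[OF x] by auto
  note b = indep_rv_sq_bound[OF ind' int \<xi>, of "\<lambda>\<omega>. a (x \<omega>) *v \<xi> \<omega>", OF _ growth]
  show "sq_integrable (\<lambda>\<omega>. a (x \<omega>) *v \<xi> \<omega>)" by (rule b) measurable
  have "(\<integral>\<omega>. (norm (a (x \<omega>) *v \<xi> \<omega>))\<^sup>2 \<partial>M)
      \<le> (\<integral>\<omega>. Ba\<^sup>2 * (1 + (norm (x \<omega>))\<^sup>2) \<partial>M) * (\<integral>\<omega>. (norm (\<xi> \<omega>))\<^sup>2 \<partial>M)"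
    by (rule b) measurable
  thus "(\<integral>\<omega>. (norm (a (x \<omega>) *v \<xi> \<omega>))\<^sup>2 \<partial>M)
      \<le> Ba\<^sup>2 * (1 + (\<integral>\<omega>. (norm (x \<omega>))\<^sup>2 \<partial>M)) * (\<integral>\<omega>. (norm (\<xi> \<omega>))\<^sup>2 \<partial>M)"
    using sq_integrableD(2)[OF x] by (simp add: prob_space)
qed

text \<open>Serves two purposes in a coupled step: comparing the fine with the coarse state, and
  comparing the fine state halfway through the step with its starting value.\<close>

lemma coefficient_diff_noise:
  assumes ind: "indep_rv borel (\<lambda>\<omega>. (x \<omega>, y \<omega>)) borel \<xi>"
    and xm[measurable]: "x \<in> borel_measurable M" "y \<in> borel_measurable M"
    and xy: "sq_integrable (\<lambda>\<omega>. x \<omega> - y \<omega>)" and \<xi>: "sq_integrable \<xi>"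
  shows "sq_integrable (\<lambda>\<omega>. (a (x \<omega>) - a (y \<omega>)) *v \<xi> \<omega>)"
    and "(\<integral>\<omega>. (norm ((a (x \<omega>) - a (y \<omega>)) *v \<xi> \<omega>))\<^sup>2 \<partial>M)
      \<le> La\<^sup>2 * (\<integral>\<omega>. (norm (x \<omega> - y \<omega>))\<^sup>2 \<partial>M) * (\<integral>\<omega>. (norm (\<xi> \<omega>))\<^sup>2 \<partial>M)"
proof -
  note [measurable] = sq_integrableD(1)[OF \<xi>]
  have ind': "indep_rv borel (\<lambda>\<omega>. La\<^sup>2 * (norm (fst (x \<omega>, y \<omega>) - snd (x \<omega>, y \<omega>)))\<^sup>2) borel \<xi>"
    by (rule indep_rv_compose[OF ind, where h = "\<lambda>x. x"]) measurable
  have int: "integrable M (\<lambda>\<omega>. La\<^sup>2 * (norm (fst (x \<omega>, y \<omega>) - snd (x \<omega>, y \<omega>)))\<^sup>2)"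
    using sq_integrableD(2)[OF xy] by auto
  have le: "(norm ((a (x \<omega>) - a (y \<omega>)) *v \<xi> \<omega>))\<^sup>2
    \<le> La\<^sup>2 * (norm (fst (x \<omega>, y \<omega>) - snd (x \<omega>, y \<omega>)))\<^sup>2 * (norm (\<xi> \<omega>))\<^sup>2" for \<omega>
    using power_mono[OF lip[of "x \<omega>" "y \<omega>" "\<xi> \<omega>"] norm_ge_zero, of 2] by (simp add: power_mult_distrib)
  have meas: "(\<lambda>\<omega>. (a (x \<omega>) - a (y \<omega>)) *v \<xi> \<omega>) \<in> borel_measurable M"
    unfolding matrix_vector_mult_diff_rdistrib by measurable
  note b = indep_rv_sq_bound[OF ind' int \<xi> meas le]
  show "sq_integrable (\<lambda>\<omega>. (a (x \<omega>) - a (y \<omega>)) *v \<xi> \<omega>)" by (rule b)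
  show "(\<integral>\<omega>. (norm ((a (x \<omega>) - a (y \<omega>)) *v \<xi> \<omega>))\<^sup>2 \<partial>M)
      \<le> La\<^sup>2 * (\<integral>\<omega>. (norm (x \<omega> - y \<omega>))\<^sup>2 \<partial>M) * (\<integral>\<omega>. (norm (\<xi> \<omega>))\<^sup>2 \<partial>M)"
    using b(2) by simp
qed

text \<open>Only the mean of the noise enters the drift terms, which makes them of order \<open>step\<close> rather
  than \<open>sqrt step\<close>.\<close>

lemma drift_coefficient:
  assumes ind: "indep_rv borel (\<lambda>\<omega>. (d \<omega>, x \<omega>)) borel \<xi>"
    and d: "sq_integrable d" and x: "sq_integrable x" and \<xi>: "sq_integrable \<xi>"
  shows "(\<integral>\<omega>. d \<omega> \<bullet> (a (x \<omega>) *v \<xi> \<omega>) \<partial>M) = (\<integral>\<omega>. d \<omega> \<bullet> (a (x \<omega>) *v (\<integral>\<omega>. \<xi> \<omega> \<partial>M)) \<partial>M)"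
proof (rule indep_rv_inner_matrix)
  note [measurable] = sq_integrableD(1)[OF x] sq_integrableD(1)[OF \<xi>] sq_integrableD(1)[OF d]
  have "indep_rv borel (\<lambda>\<omega>. fst (d \<omega>, x \<omega>) v* a (snd (d \<omega>, x \<omega>))) borel \<xi>"
    by (rule indep_rv_compose[OF ind, where h = "\<lambda>x. x"]) measurable
  thus "indep_rv borel (\<lambda>\<omega>. d \<omega> v* a (x \<omega>)) borel \<xi>" by simp
  show "integrable M \<xi>" by (rule sq_integrable_imp_integrable[OF \<xi>])
  \<comment> \<open>Linear growth bounds the transposed product by \<open>Ba\<close> times this
    square integrable factor times \<open>norm d\<close>, so a product of two square integrable
    variables dominates it.\<close>
  have s: "sq_integrable (\<lambda>\<omega>. sqrt (1 + (norm (x \<omega>))\<^sup>2))"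
    by (rule sq_integrable_bound[of "\<lambda>\<omega>. 1 + (norm (x \<omega>))\<^sup>2"]) (use sq_integrableD(2)[OF x] in auto)
  have i: "integrable M (\<lambda>\<omega>. Ba * (norm (sqrt (1 + (norm (x \<omega>))\<^sup>2)) * norm (d \<omega>)))"
    using sq_integrable_mult[OF s d] by auto
  show "integrable M (\<lambda>\<omega>. d \<omega> v* a (x \<omega>))"
  proof (rule Bochner_Integration.integrable_bound[OF i _ AE_I2])
    fix \<omega>
    have "norm (d \<omega> v* a (x \<omega>)) \<le> Ba * sqrt (1 + (norm (x \<omega>))\<^sup>2) * norm (d \<omega>)"
      by (rule norm_vector_matrix_le) (rule growth_sqrt)
    thus "norm (d \<omega> v* a (x \<omega>)) \<le> norm (Ba * (norm (sqrt (1 + (norm (x \<omega>))\<^sup>2)) * norm (d \<omega>)))"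
      using Ba by (simp add: abs_mult)
  qed measurable
qed

text \<open>\<open>d\<close> is kept separate from \<open>x - y\<close> because one application
  pairs the current error with a different increment, that of the fine path within the step. The
  product of norms is left for the caller to estimate.\<close>

lemma drift_coefficient_diff:
  assumes ind: "indep_rv borel (\<lambda>\<omega>. (d \<omega>, x \<omega>, y \<omega>)) borel \<xi>"
    and d: "sq_integrable d" and xm[measurable]: "x \<in> borel_measurable M" "y \<in> borel_measurable M"
    and xy: "sq_integrable (\<lambda>\<omega>. x \<omega> - y \<omega>)" and \<xi>: "sq_integrable \<xi>"
  shows "(\<integral>\<omega>. d \<omega> \<bullet> ((a (x \<omega>) - a (y \<omega>)) *v \<xi> \<omega>) \<partial>M)
    \<le> La * norm (\<integral>\<omega>. \<xi> \<omega> \<partial>M) * (\<integral>\<omega>. norm (d \<omega>) * norm (x \<omega> - y \<omega>) \<partial>M)"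
proof -
  note [measurable] = sq_integrableD(1)[OF \<xi>] sq_integrableD(1)[OF d]
  let ?m = "\<integral>\<omega>. \<xi> \<omega> \<partial>M"
  have V: "d v* (a x - a y) = d v* a x - d v* a y" for d x y
    by (simp add: vector_matrix_mult_def vec_eq_iff algebra_simps sum_subtractf)
  note i = sq_integrable_mult[OF d xy]
  have "(\<integral>\<omega>. d \<omega> \<bullet> ((a (x \<omega>) - a (y \<omega>)) *v \<xi> \<omega>) \<partial>M)
      = (\<integral>\<omega>. d \<omega> \<bullet> ((a (x \<omega>) - a (y \<omega>)) *v ?m) \<partial>M)"
  proof (rule indep_rv_inner_matrix)
    have "indep_rv borel (\<lambda>\<omega>. fst (d \<omega>, x \<omega>, y \<omega>) v* a (fst (snd (d \<omega>, x \<omega>, y \<omega>)))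
       - fst (d \<omega>, x \<omega>, y \<omega>) v* a (snd (snd (d \<omega>, x \<omega>, y \<omega>)))) borel \<xi>"
      by (rule indep_rv_compose[OF ind, where h = "\<lambda>x. x"]) measurable
    thus "indep_rv borel (\<lambda>\<omega>. d \<omega> v* (a (x \<omega>) - a (y \<omega>))) borel \<xi>" by (simp add: V)
    show "integrable M \<xi>" by (rule sq_integrable_imp_integrable[OF \<xi>])
    show "integrable M (\<lambda>\<omega>. d \<omega> v* (a (x \<omega>) - a (y \<omega>)))"
    proof (rule Bochner_Integration.integrable_bound[OF integrable_mult_right[OF i, of La] _ AE_I2])
      fix \<omega>
      have "norm (d \<omega> v* (a (x \<omega>) - a (y \<omega>))) \<le> La * norm (x \<omega> - y \<omega>) * norm (d \<omega>)"
        by (rule norm_vector_matrix_le) (rule lip)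
      thus "norm (d \<omega> v* (a (x \<omega>) - a (y \<omega>))) \<le> norm (La * (norm (d \<omega>) * norm (x \<omega> - y \<omega>)))"
        using La by (simp add: abs_mult mult_ac)
    qed (unfold V, measurable)
  qed
  also have "\<dots> \<le> (\<integral>\<omega>. La * norm ?m * (norm (d \<omega>) * norm (x \<omega> - y \<omega>)) \<partial>M)"
  proof (rule integral_mono')
    show "integrable M (\<lambda>\<omega>. La * norm ?m * (norm (d \<omega>) * norm (x \<omega> - y \<omega>)))" using i by auto
    fix \<omega>
    have "d \<omega> \<bullet> ((a (x \<omega>) - a (y \<omega>)) *v ?m) \<le> norm (d \<omega>) * norm ((a (x \<omega>) - a (y \<omega>)) *v ?m)"
      by (rule norm_cauchy_schwarz)
    also have "\<dots> \<le> norm (d \<omega>) * (La * norm (x \<omega> - y \<omega>) * norm ?m)"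
      by (intro mult_left_mono lip norm_ge_zero)
    finally show "d \<omega> \<bullet> ((a (x \<omega>) - a (y \<omega>)) *v ?m) \<le> La * norm ?m * (norm (d \<omega>) * norm (x \<omega> - y \<omega>))"
      by (simp add: mult_ac)
    show "0 \<le> La * norm ?m * (norm (d \<omega>) * norm (x \<omega> - y \<omega>))" using La by simp
  qed
  finally show ?thesis by simp
qed

text \<open>Adding 1 to the second moment makes linear growth homogeneous: the cross term
  contributes \<open>2 * Ba * k\<close> and the noise \<open>Ba\<^sup>2 * k\<close> times the same
  quantity, so the recursion is purely multiplicative.\<close>

lemma euler_step_moment:
  assumes ind: "indep_rv borel x borel \<xi>" and x: "sq_integrable x" and \<xi>: "sq_integrable \<xi>"
    and k: "(\<integral>\<omega>. (norm (\<xi> \<omega>))\<^sup>2 \<partial>M) \<le> k" "norm (\<integral>\<omega>. \<xi> \<omega> \<partial>M) \<le> k"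
  shows "sq_integrable (\<lambda>\<omega>. x \<omega> + a (x \<omega>) *v \<xi> \<omega>)"
    and "1 + (\<integral>\<omega>. (norm (x \<omega> + a (x \<omega>) *v \<xi> \<omega>))\<^sup>2 \<partial>M)
      \<le> (1 + (2 * Ba + Ba\<^sup>2) * k) * (1 + (\<integral>\<omega>. (norm (x \<omega>))\<^sup>2 \<partial>M))"
proof -
  note [measurable] = sq_integrableD(1)[OF x] sq_integrableD(1)[OF \<xi>]
  note g = coefficient_noise[OF ind x \<xi>]
  note [simp] = sq_integrableD(2)[OF x] sq_integrableD(2)[OF g(1)] sq_integrable_inner[OF x g(1)]
  let ?m = "\<integral>\<omega>. \<xi> \<omega> \<partial>M" and ?X = "\<integral>\<omega>. (norm (x \<omega>))\<^sup>2 \<partial>M"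
  have X: "0 \<le> ?X" by simp
  show "sq_integrable (\<lambda>\<omega>. x \<omega> + a (x \<omega>) *v \<xi> \<omega>)" by (rule sq_integrable_add[OF x g(1)])
  have "(\<integral>\<omega>. x \<omega> \<bullet> (a (x \<omega>) *v \<xi> \<omega>) \<partial>M) = (\<integral>\<omega>. x \<omega> \<bullet> (a (x \<omega>) *v ?m) \<partial>M)"
    by (intro drift_coefficient x \<xi> indep_rv_compose[OF ind, where h = "\<lambda>x. x"]) measurable
  also have "\<dots> \<le> (\<integral>\<omega>. Ba * k * (1 + (norm (x \<omega>))\<^sup>2) \<partial>M)"
  proof (rule integral_mono')
    show "integrable M (\<lambda>\<omega>. Ba * k * (1 + (norm (x \<omega>))\<^sup>2))" by simp
    fix \<omega>
    have k0: "0 \<le> k" using order_trans[OF norm_ge_zero k(2)] .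
    thus "0 \<le> Ba * k * (1 + (norm (x \<omega>))\<^sup>2)" using Ba by simp
    let ?s = "sqrt (1 + (norm (x \<omega>))\<^sup>2)"
    have "x \<omega> \<bullet> (a (x \<omega>) *v ?m) \<le> norm (x \<omega>) * norm (a (x \<omega>) *v ?m)" by (rule norm_cauchy_schwarz)
    \<comment> \<open>Enlarging \<open>norm x\<close> to the same square root that bounds the
      coefficient makes the product exactly a multiple of
      \<open>1 + (norm x)\<^sup>2\<close>.\<close>
    also have "\<dots> \<le> ?s * (Ba * ?s * k)"
    proof (rule mult_mono)
      show "norm (x \<omega>) \<le> ?s" by (rule real_le_rsqrt) simp
      show "norm (a (x \<omega>) *v ?m) \<le> Ba * ?s * k"
        by (rule order_trans[OF growth_sqrt mult_left_mono[OF k(2)]]) (use Ba in simp)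
    qed simp_all
    also have "\<dots> = Ba * k * ?s\<^sup>2" by (simp only: power2_eq_square mult_ac)
    also have "\<dots> = Ba * k * (1 + (norm (x \<omega>))\<^sup>2)" by simp
    finally show "x \<omega> \<bullet> (a (x \<omega>) *v ?m) \<le> Ba * k * (1 + (norm (x \<omega>))\<^sup>2)" .
  qed
  also have "\<dots> = Ba * k * (1 + ?X)" by (simp add: prob_space)
  finally have drift: "(\<integral>\<omega>. x \<omega> \<bullet> (a (x \<omega>) *v \<xi> \<omega>) \<partial>M) \<le> Ba * k * (1 + ?X)" .
  have noise: "(\<integral>\<omega>. (norm (a (x \<omega>) *v \<xi> \<omega>))\<^sup>2 \<partial>M) \<le> Ba\<^sup>2 * (1 + ?X) * k"
    by (rule order_trans[OF g(2)], rule mult_left_mono[OF k(1)]) (use X in simp)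
  have "(\<integral>\<omega>. (norm (x \<omega> + a (x \<omega>) *v \<xi> \<omega>))\<^sup>2 \<partial>M)
    = ?X + 2 * (\<integral>\<omega>. x \<omega> \<bullet> (a (x \<omega>) *v \<xi> \<omega>) \<partial>M) + (\<integral>\<omega>. (norm (a (x \<omega>) *v \<xi> \<omega>))\<^sup>2 \<partial>M)"

  proof -
    have "(norm (x \<omega> + a (x \<omega>) *v \<xi> \<omega>))\<^sup>2
      = (norm (x \<omega>))\<^sup>2 + 2 * (x \<omega> \<bullet> (a (x \<omega>) *v \<xi> \<omega>)) + (norm (a (x \<omega>) *v \<xi> \<omega>))\<^sup>2" for \<omega>
      by (simp add: dot_norm field_simps)
    thus ?thesis by simp
  qed
  thus "1 + (\<integral>\<omega>. (norm (x \<omega> + a (x \<omega>) *v \<xi> \<omega>))\<^sup>2 \<partial>M) \<le> (1 + (2 * Ba + Ba\<^sup>2) * k) * (1 + ?X)"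
    using drift noise by (simp add: algebra_simps)
qed

end

section \<open>One step of the coupled Euler schemes\<close>

text \<open>For the three noise terms of a coupled step, which depend on each other: convexity
  avoids their mixed moments at the price of the factor 3.\<close>

lemma norm_sum3_squared_le:
  "(norm (u + v + w))\<^sup>2 \<le> 3 * ((norm u)\<^sup>2 + (norm v)\<^sup>2 + (norm w)\<^sup>2)"
proof -
  have "norm (u + v + w) \<le> norm u + norm v + norm w"
    using norm_triangle_ineq[of "u + v" w] norm_triangle_ineq[of u v] by simp
  hence "(norm (u + v + w))\<^sup>2 \<le> (norm u + norm v + norm w)\<^sup>2" by (intro power_mono) auto
  also have "\<dots> \<le> 3 * ((norm u)\<^sup>2 + (norm v)\<^sup>2 + (norm w)\<^sup>2)"
    using sum_squares_bound[of "norm u" "norm v"] sum_squares_bound[of "norm u" "norm w"]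
      sum_squares_bound[of "norm v" "norm w"]
    by (simp add: power2_eq_square algebra_simps)
  finally show ?thesis .
qed

lemma norm_add_squared_le: "(norm (u + v))\<^sup>2 \<le> 2 * ((norm u)\<^sup>2 + (norm v)\<^sup>2)"
proof -
  have "(norm (u + v))\<^sup>2 \<le> (norm u + norm v)\<^sup>2" by (intro power_mono norm_triangle_ineq) auto
  also have "\<dots> \<le> 2 * ((norm u)\<^sup>2 + (norm v)\<^sup>2)"
    using sum_squares_bound[of "norm u" "norm v"] by (simp add: power2_sum)
  finally show ?thesis .
qed

lemma (in prob_space) second_moment_add_le:
  fixes X Y :: "'a \<Rightarrow> 'b::{real_normed_vector,second_countable_topology}"
  assumes X: "sq_integrable X" and Y: "sq_integrable Y"
  shows "(\<integral>\<omega>. (norm (X \<omega> + Y \<omega>))\<^sup>2 \<partial>M)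
    \<le> 2 * ((\<integral>\<omega>. (norm (X \<omega>))\<^sup>2 \<partial>M) + (\<integral>\<omega>. (norm (Y \<omega>))\<^sup>2 \<partial>M))"
proof -
  have "(\<integral>\<omega>. (norm (X \<omega> + Y \<omega>))\<^sup>2 \<partial>M) \<le> (\<integral>\<omega>. 2 * ((norm (X \<omega>))\<^sup>2 + (norm (Y \<omega>))\<^sup>2) \<partial>M)"
    using sq_integrableD(2)[OF X] sq_integrableD(2)[OF Y] sq_integrableD(2)[OF sq_integrable_add[OF X Y]]
    by (intro integral_mono norm_add_squared_le) auto
  thus ?thesis using sq_integrableD(2)[OF X] sq_integrableD(2)[OF Y] by simp
qed

context euler_scheme
begin

text \<open>Here \<open>k\<close> stands for \<open>K * \<delta>\<close>, so
  \<open>k * \<delta>\<close> is the second order bound for the residual. The coarse noise is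
  \<open>\<xi>1 + \<xi>2\<close> plus the residual, and the fine path differs from a single step
  also because its coefficient is updated halfway; this yields the three error terms
  \<open>G1\<close>, \<open>G2\<close>, \<open>G3\<close> besides the inherited error
  \<open>D\<close>.\<close>

lemma coupled_step:
  fixes x y :: "'w \<Rightarrow> real ^ 'd" and \<xi>1 \<xi>2 \<eta> :: "'w \<Rightarrow> real ^ 'm"
  assumes ind: "indep_rv borel (\<lambda>\<omega>. (x \<omega>, y \<omega>)) borel (\<lambda>\<omega>. (\<xi>1 \<omega>, \<xi>2 \<omega>, \<eta> \<omega>))"
    and ind12: "indep_rv borel \<xi>1 borel \<xi>2"
    and x: "sq_integrable x" and y: "sq_integrable y"
    and \<xi>1: "sq_integrable \<xi>1" and \<xi>2: "sq_integrable \<xi>2"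
    and R: "sq_integrable (\<lambda>\<omega>. \<eta> \<omega> - \<xi>1 \<omega> - \<xi>2 \<omega>)" "(\<integral>\<omega>. \<eta> \<omega> - \<xi>1 \<omega> - \<xi>2 \<omega> \<partial>M) = 0"
      "(\<integral>\<omega>. (norm (\<eta> \<omega> - \<xi>1 \<omega> - \<xi>2 \<omega>))\<^sup>2 \<partial>M) \<le> k * \<delta>"
    and k1: "(\<integral>\<omega>. (norm (\<xi>1 \<omega>))\<^sup>2 \<partial>M) \<le> k" "norm (\<integral>\<omega>. \<xi>1 \<omega> \<partial>M) \<le> k"
    and k2: "(\<integral>\<omega>. (norm (\<xi>2 \<omega>))\<^sup>2 \<partial>M) \<le> k" "norm (\<integral>\<omega>. \<xi>2 \<omega> \<partial>M) \<le> k"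
    and \<delta>: "0 \<le> \<delta>"
  defines "x' \<equiv> \<lambda>\<omega>. x \<omega> + a (x \<omega>) *v \<xi>1 \<omega>"
  defines "x'' \<equiv> \<lambda>\<omega>. x' \<omega> + a (x' \<omega>) *v \<xi>2 \<omega>"
  defines "y'' \<equiv> \<lambda>\<omega>. y \<omega> + a (y \<omega>) *v \<eta> \<omega>"
  shows "sq_integrable x''" "sq_integrable y''"
    and "1 + (\<integral>\<omega>. (norm (x'' \<omega>))\<^sup>2 \<partial>M)
      \<le> (1 + (2 * Ba + Ba\<^sup>2) * k)\<^sup>2 * (1 + (\<integral>\<omega>. (norm (x \<omega>))\<^sup>2 \<partial>M))"
    and "(\<integral>\<omega>. (norm (x'' \<omega> - y'' \<omega>))\<^sup>2 \<partial>M)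
      \<le> (1 + (5 * La + 12 * La\<^sup>2) * k + 6 * Ba\<^sup>2 * k * \<delta>) * (\<integral>\<omega>. (norm (x \<omega> - y \<omega>))\<^sup>2 \<partial>M)
        + ((La + 3 * La\<^sup>2) * Ba\<^sup>2 * k\<^sup>2 + 6 * Ba\<^sup>2 * k * \<delta>) * (1 + (\<integral>\<omega>. (norm (x \<omega>))\<^sup>2 \<partial>M))"
proof -
  have k: "0 \<le> k" using order_trans[OF norm_ge_zero k1(2)] .
  note [measurable] = sq_integrableD(1)[OF x] sq_integrableD(1)[OF y] sq_integrableD(1)[OF \<xi>1]
    sq_integrableD(1)[OF \<xi>2]
  define D where "D \<omega> = x \<omega> - y \<omega>" for \<omega>
  define R where "R \<omega> = \<eta> \<omega> - \<xi>1 \<omega> - \<xi>2 \<omega>" for \<omega>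
  note Rsq = R(1)[folded R_def] and Rmean = R(2)[folded R_def] and Rmom = R(3)[folded R_def]
  let ?X = "\<integral>\<omega>. (norm (x \<omega>))\<^sup>2 \<partial>M" and ?Y = "\<integral>\<omega>. (norm (y \<omega>))\<^sup>2 \<partial>M"
    and ?E = "\<integral>\<omega>. (norm (D \<omega>))\<^sup>2 \<partial>M"
  have D: "sq_integrable D" unfolding D_def by (rule sq_integrable_diff[OF x y])
  note [measurable] = sq_integrableD(1)[OF D]
  note past = indep_rv_compose[OF ind, where S' = borel and T' = borel]
  have x_\<xi>1: "indep_rv borel x borel \<xi>1" by (rule past[of fst fst, unfolded fst_conv snd_conv]) measurable
  \<comment> \<open>\<open>\<eta>\<close> is discarded before \<open>\<xi>1\<close> joins the past:
    it may depend on both fine increments, while the intermediate state \<open>x'\<close> needs only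
    that \<open>\<xi>2\<close> is independent of \<open>x\<close>, \<open>y\<close> and
    \<open>\<xi>1\<close>.\<close>
  have "indep_rv borel (\<lambda>\<omega>. (x \<omega>, y \<omega>)) (borel \<Otimes>\<^sub>M borel) (\<lambda>\<omega>. (\<xi>1 \<omega>, \<xi>2 \<omega>))"
    using indep_rv_compose[OF ind, of "\<lambda>x. x" borel "\<lambda>z. (fst z, fst (snd z))" "borel \<Otimes>\<^sub>M borel"] by simp
  from indep_rv_pair_assoc[OF this ind12]
  have past_\<xi>2: "indep_rv (borel \<Otimes>\<^sub>M borel) (\<lambda>\<omega>. ((x \<omega>, y \<omega>), \<xi>1 \<omega>)) borel \<xi>2" .
  note past2 = indep_rv_compose[OF past_\<xi>2, where S' = borel and T' = borel and h = "\<lambda>x. x",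
      OF _ measurable_ident_sets[OF refl]]

  have x'_\<xi>2: "indep_rv borel x' borel \<xi>2"
    unfolding x'_def
    by (rule past2[of "\<lambda>z. fst (fst z) + a (fst (fst z)) *v snd z",
        unfolded fst_conv snd_conv]) measurable
  have x': "x \<omega> + a (x \<omega>) *v \<xi>1 \<omega> = x' \<omega>" for \<omega> by (simp add: x'_def)
  note step1 = euler_step_moment[OF x_\<xi>1 x \<xi>1 k1, unfolded x']
  note step2 = euler_step_moment[OF x'_\<xi>2 step1(1) \<xi>2 k2]
  show x'': "sq_integrable x''" unfolding x''_def by (rule step2(1))
  have "1 + (\<integral>\<omega>. (norm (x'' \<omega>))\<^sup>2 \<partial>M)
    \<le> (1 + (2 * Ba + Ba\<^sup>2) * k) * ((1 + (2 * Ba + Ba\<^sup>2) * k) * (1 + ?X))"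
    unfolding x''_def
    by (rule order_trans[OF step2(2) mult_left_mono[OF step1(2)]]) (use k Ba in simp)
  thus "1 + (\<integral>\<omega>. (norm (x'' \<omega>))\<^sup>2 \<partial>M) \<le> (1 + (2 * Ba + Ba\<^sup>2) * k)\<^sup>2 * (1 + ?X)"
    by (simp only: power2_eq_square mult.assoc)

  have \<eta>: "sq_integrable \<eta>"
    using sq_integrable_add[OF sq_integrable_add[OF Rsq \<xi>1] \<xi>2] by (simp add: R_def)
  have y_\<eta>: "indep_rv borel y borel \<eta>" by (rule past[of snd "\<lambda>z. snd (snd z)", unfolded fst_conv snd_conv]) measurable
  show y'': "sq_integrable y''"
    unfolding y''_def by (rule sq_integrable_add[OF y coefficient_noise(1)[OF y_\<eta> y \<eta>]])

  \<comment> \<open>\<open>G1\<close> is proportional to the inherited error, \<open>G2\<close>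
    comes from the coefficient update halfway through the fine step, \<open>G3\<close> from the
    coupling residual.\<close>
  define G1 where "G1 \<omega> = (a (x \<omega>) - a (y \<omega>)) *v (\<xi>1 \<omega> + \<xi>2 \<omega>)" for \<omega>
  define G2 where "G2 \<omega> = (a (x' \<omega>) - a (x \<omega>)) *v \<xi>2 \<omega>" for \<omega>
  define G3 where "G3 \<omega> = a (y \<omega>) *v R \<omega>" for \<omega>
  have decomp: "x'' \<omega> - y'' \<omega> = D \<omega> + (G1 \<omega> + G2 \<omega> + - G3 \<omega>)" for \<omega>
  proof -
    have "a (y \<omega>) *v \<eta> \<omega> = G3 \<omega> + a (y \<omega>) *v \<xi>1 \<omega> + a (y \<omega>) *v \<xi>2 \<omega>"
      by (simp add: G3_def R_def flip: matrix_vector_right_distrib)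
    thus ?thesis
      by (simp add: x''_def x'_def y''_def D_def G1_def G2_def matrix_vector_mult_diff_rdistrib
        matrix_vector_right_distrib)
  qed

  have \<xi>12: "sq_integrable (\<lambda>\<omega>. \<xi>1 \<omega> + \<xi>2 \<omega>)" by (rule sq_integrable_add[OF \<xi>1 \<xi>2])
  have \<xi>12_mom: "(\<integral>\<omega>. (norm (\<xi>1 \<omega> + \<xi>2 \<omega>))\<^sup>2 \<partial>M) \<le> 4 * k"
    using second_moment_add_le[OF \<xi>1 \<xi>2] k1 k2 by simp
  have \<xi>12_mean: "norm (\<integral>\<omega>. \<xi>1 \<omega> + \<xi>2 \<omega> \<partial>M) \<le> 2 * k"
    using sq_integrable_imp_integrable[OF \<xi>1] sq_integrable_imp_integrable[OF \<xi>2] k1 k2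
      norm_triangle_ineq[of "\<integral>\<omega>. \<xi>1 \<omega> \<partial>M" "\<integral>\<omega>. \<xi>2 \<omega> \<partial>M"] by simp
  have xy_\<xi>12: "indep_rv borel (\<lambda>\<omega>. (x \<omega>, y \<omega>)) borel (\<lambda>\<omega>. \<xi>1 \<omega> + \<xi>2 \<omega>)"
    by (rule past[of "\<lambda>x. x" "\<lambda>z. fst z + fst (snd z)", unfolded fst_conv snd_conv]) measurable
  have dxy_\<xi>12: "indep_rv borel (\<lambda>\<omega>. (D \<omega>, x \<omega>, y \<omega>)) borel (\<lambda>\<omega>. \<xi>1 \<omega> + \<xi>2 \<omega>)"
    unfolding D_def
    by (rule past[of "\<lambda>z. (fst z - snd z, fst z, snd z)"
        "\<lambda>z. fst z + fst (snd z)", unfolded fst_conv snd_conv]) measurable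
  note xm = sq_integrableD(1)[OF x] and ym = sq_integrableD(1)[OF y]
  note G1 = coefficient_diff_noise[OF xy_\<xi>12 xm ym D[unfolded D_def] \<xi>12, folded G1_def D_def]
  have "La\<^sup>2 * ?E * (\<integral>\<omega>. (norm (\<xi>1 \<omega> + \<xi>2 \<omega>))\<^sup>2 \<partial>M) \<le> La\<^sup>2 * ?E * (4 * k)"
    by (intro mult_left_mono \<xi>12_mom) simp
  hence G1_mom: "(\<integral>\<omega>. (norm (G1 \<omega>))\<^sup>2 \<partial>M) \<le> La\<^sup>2 * ?E * (4 * k)"
    using G1(2) by (rule order_trans[rotated])
  have "(\<integral>\<omega>. D \<omega> \<bullet> G1 \<omega> \<partial>M) \<le> La * norm (\<integral>\<omega>. \<xi>1 \<omega> + \<xi>2 \<omega> \<partial>M) * (\<integral>\<omega>. norm (D \<omega>) * norm (x \<omega> - y \<omega>) \<partial>M)"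
    unfolding G1_def by (rule drift_coefficient_diff[OF dxy_\<xi>12 D xm ym D[unfolded D_def] \<xi>12])
  also have "(\<integral>\<omega>. norm (D \<omega>) * norm (x \<omega> - y \<omega>) \<partial>M) = ?E"
    by (simp add: D_def power2_eq_square)
  also have "La * norm (\<integral>\<omega>. \<xi>1 \<omega> + \<xi>2 \<omega> \<partial>M) * ?E \<le> La * (2 * k) * ?E"
    by (intro mult_right_mono mult_left_mono \<xi>12_mean La) simp
  finally have G1_drift: "(\<integral>\<omega>. D \<omega> \<bullet> G1 \<omega> \<partial>M) \<le> La * (2 * k) * ?E" .

  define g where "g \<omega> = a (x \<omega>) *v \<xi>1 \<omega>" for \<omega>
  have g: "sq_integrable g" unfolding g_def by (rule coefficient_noise[OF x_\<xi>1 x \<xi>1])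
  have "(\<integral>\<omega>. (norm (g \<omega>))\<^sup>2 \<partial>M) \<le> Ba\<^sup>2 * (1 + ?X) * (\<integral>\<omega>. (norm (\<xi>1 \<omega>))\<^sup>2 \<partial>M)"
    unfolding g_def by (rule coefficient_noise[OF x_\<xi>1 x \<xi>1])
  also have "\<dots> \<le> Ba\<^sup>2 * (1 + ?X) * k" by (intro mult_left_mono k1) simp
  finally have g_mom: "(\<integral>\<omega>. (norm (g \<omega>))\<^sup>2 \<partial>M) \<le> Ba\<^sup>2 * (1 + ?X) * k" .
  have x'x: "x' \<omega> - x \<omega> = g \<omega>" for \<omega> by (simp add: x'_def g_def)
  have x'x_\<xi>2: "indep_rv borel (\<lambda>\<omega>. (x' \<omega>, x \<omega>)) borel \<xi>2"
    unfolding x'_def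
    by (rule past2[of "\<lambda>z. (fst (fst z) + a (fst (fst z)) *v snd z, fst (fst z))",
        unfolded fst_conv snd_conv]) measurable
  have dx'x_\<xi>2: "indep_rv borel (\<lambda>\<omega>. (D \<omega>, x' \<omega>, x \<omega>)) borel \<xi>2"
    unfolding x'_def D_def
    by (rule past2[of "\<lambda>z. (fst (fst z) - snd (fst z), fst (fst z) + a (fst (fst z)) *v snd z, fst (fst z))",
        unfolded fst_conv snd_conv]) measurable
  note x'm = sq_integrableD(1)[OF step1(1)]
  note G2 = coefficient_diff_noise[OF x'x_\<xi>2 x'm xm, unfolded x'x, OF g \<xi>2, folded G2_def]
  have "(\<integral>\<omega>. (norm (G2 \<omega>))\<^sup>2 \<partial>M) \<le> La\<^sup>2 * (\<integral>\<omega>. (norm (g \<omega>))\<^sup>2 \<partial>M) * k"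
    by (rule order_trans[OF G2(2) mult_left_mono[OF k2(1)]]) simp
  also have "\<dots> \<le> La\<^sup>2 * (Ba\<^sup>2 * (1 + ?X) * k) * k"
    by (intro mult_right_mono mult_left_mono g_mom k) simp
  finally have G2_mom: "(\<integral>\<omega>. (norm (G2 \<omega>))\<^sup>2 \<partial>M) \<le> La\<^sup>2 * (Ba\<^sup>2 * (1 + ?X) * k) * k" .
  note Dg = sq_integrable_mult[OF D g]
  \<comment> \<open>Young's inequality: the second moment of \<open>g\<close> is of order
    \<open>k\<close> and the mean of \<open>\<xi>2\<close> is at most \<open>k\<close>, so the mixed
    term splits into an order \<open>k\<close> multiple of the error and an inhomogeneity of order
    \<open>k\<^sup>2\<close>.\<close>
  have "norm (D \<omega>) * norm (g \<omega>) \<le> ((norm (D \<omega>))\<^sup>2 + (norm (g \<omega>))\<^sup>2) / 2" for \<omega>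
    using sum_squares_bound[of "norm (D \<omega>)" "norm (g \<omega>)"] by simp
  hence "(\<integral>\<omega>. norm (D \<omega>) * norm (g \<omega>) \<partial>M) \<le> (\<integral>\<omega>. ((norm (D \<omega>))\<^sup>2 + (norm (g \<omega>))\<^sup>2) / 2 \<partial>M)"
    using sq_integrableD(2)[OF D] sq_integrableD(2)[OF g]
    by (intro integral_mono Dg) simp_all
  also have "\<dots> = (?E + (\<integral>\<omega>. (norm (g \<omega>))\<^sup>2 \<partial>M)) / 2"
    using sq_integrableD(2)[OF D] sq_integrableD(2)[OF g] by simp
  also have "\<dots> \<le> (?E + Ba\<^sup>2 * (1 + ?X) * k) / 2"
    using g_mom by simp
  finally have Dg_le: "(\<integral>\<omega>. norm (D \<omega>) * norm (g \<omega>) \<partial>M) \<le> (?E + Ba\<^sup>2 * (1 + ?X) * k) / 2" .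
  have "(\<integral>\<omega>. D \<omega> \<bullet> G2 \<omega> \<partial>M) \<le> La * norm (\<integral>\<omega>. \<xi>2 \<omega> \<partial>M) * (\<integral>\<omega>. norm (D \<omega>) * norm (g \<omega>) \<partial>M)"
    using drift_coefficient_diff[OF dx'x_\<xi>2 D x'm xm, unfolded x'x, OF g \<xi>2] by (simp add: G2_def)
  also have "\<dots> \<le> La * k * ((?E + Ba\<^sup>2 * (1 + ?X) * k) / 2)"
  proof (rule mult_mono)
    show "La * norm (\<integral>\<omega>. \<xi>2 \<omega> \<partial>M) \<le> La * k" by (rule mult_left_mono[OF k2(2) La])
  qed (use Dg_le La k in auto)
  finally have G2_drift: "(\<integral>\<omega>. D \<omega> \<bullet> G2 \<omega> \<partial>M) \<le> La * k * ((?E + Ba\<^sup>2 * (1 + ?X) * k) / 2)" .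

  have y_R: "indep_rv borel y borel R"
    unfolding R_def[abs_def]
    by (rule past[of snd
        "\<lambda>z. snd (snd z) - fst z - fst (snd z)", unfolded fst_conv snd_conv]) measurable
  have dy_R: "indep_rv borel (\<lambda>\<omega>. (D \<omega>, y \<omega>)) borel R"
    unfolding R_def[abs_def] D_def
    by (rule past[of "\<lambda>z. (fst z - snd z, snd z)"
        "\<lambda>z. snd (snd z) - fst z - fst (snd z)", unfolded fst_conv snd_conv]) measurable
  note G3 = coefficient_noise[OF y_R y Rsq, folded G3_def]
  \<comment> \<open>The centring of the residual matters here: its second moment alone would allow a
    mean of order \<open>\<delta>\<close>, hence a cross term of first order in every step.\<close>
  have G3_drift: "(\<integral>\<omega>. D \<omega> \<bullet> G3 \<omega> \<partial>M) = 0"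
    using drift_coefficient[OF dy_R D y Rsq] by (simp add: G3_def Rmean)
  \<comment> \<open>Writing \<open>y = x - D\<close> removes the moment of the coarse path, so that
    only the fine moment and the error have to be tracked.\<close>
  have Y: "?Y \<le> 2 * ?X + 2 * ?E"
    using second_moment_add_le[OF x sq_integrable_uminus[OF D]] by (simp add: D_def norm_minus_commute)
  have "(\<integral>\<omega>. (norm (G3 \<omega>))\<^sup>2 \<partial>M) \<le> Ba\<^sup>2 * (1 + ?Y) * (k * \<delta>)"
    by (rule order_trans[OF G3(2) mult_left_mono[OF Rmom]]) simp
  also have "\<dots> \<le> Ba\<^sup>2 * (2 * (1 + ?X) + 2 * ?E) * (k * \<delta>)"
  proof (rule mult_right_mono[OF mult_left_mono])
    show "1 + ?Y \<le> 2 * (1 + ?X) + 2 * ?E" using Y by simp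
  qed (use k \<delta> in simp_all)
  finally have G3_mom: "(\<integral>\<omega>. (norm (G3 \<omega>))\<^sup>2 \<partial>M) \<le> Ba\<^sup>2 * (2 * (1 + ?X) + 2 * ?E) * (k * \<delta>)" .

  note sq = D G1(1) G2(1) G3(1)
  note [simp] = sq[THEN sq_integrableD(2)] sq_integrable_inner[OF D G1(1)]
    sq_integrable_inner[OF D G2(1)] sq_integrable_inner[OF D G3(1)]
  have bound: "(norm (x'' \<omega> - y'' \<omega>))\<^sup>2 \<le> (norm (D \<omega>))\<^sup>2 + 2 * (D \<omega> \<bullet> G1 \<omega>) + 2 * (D \<omega> \<bullet> G2 \<omega>)
      - 2 * (D \<omega> \<bullet> G3 \<omega>) + 3 * (norm (G1 \<omega>))\<^sup>2 + 3 * (norm (G2 \<omega>))\<^sup>2 + 3 * (norm (G3 \<omega>))\<^sup>2" for \<omega>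
  proof -
    define H where "H = G1 \<omega> + G2 \<omega> + - G3 \<omega>"
    have "(norm (D \<omega> + H))\<^sup>2 = (norm (D \<omega>))\<^sup>2 + 2 * (D \<omega> \<bullet> H) + (norm H)\<^sup>2"
      by (simp add: dot_norm field_simps)
    moreover have "D \<omega> \<bullet> H = D \<omega> \<bullet> G1 \<omega> + D \<omega> \<bullet> G2 \<omega> - D \<omega> \<bullet> G3 \<omega>"
      unfolding H_def by (simp add: inner_add_right inner_diff_right)
    moreover have "(norm H)\<^sup>2 \<le> 3 * ((norm (G1 \<omega>))\<^sup>2 + (norm (G2 \<omega>))\<^sup>2 + (norm (G3 \<omega>))\<^sup>2)"
      using norm_sum3_squared_le[of "G1 \<omega>" "G2 \<omega>" "- G3 \<omega>"] unfolding H_def norm_minus_cancel .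
    ultimately show ?thesis unfolding decomp H_def[symmetric] by (simp add: algebra_simps)
  qed
  have "(\<integral>\<omega>. (norm (x'' \<omega> - y'' \<omega>))\<^sup>2 \<partial>M) \<le> (\<integral>\<omega>. (norm (D \<omega>))\<^sup>2 + 2 * (D \<omega> \<bullet> G1 \<omega>) + 2 * (D \<omega> \<bullet> G2 \<omega>)
      - 2 * (D \<omega> \<bullet> G3 \<omega>) + 3 * (norm (G1 \<omega>))\<^sup>2 + 3 * (norm (G2 \<omega>))\<^sup>2 + 3 * (norm (G3 \<omega>))\<^sup>2 \<partial>M)"
    by (intro integral_mono bound sq_integrableD(2)[OF sq_integrable_diff[OF x'' y'']]) simp
  also have "\<dots> = ?E + 2 * (\<integral>\<omega>. D \<omega> \<bullet> G1 \<omega> \<partial>M) + 2 * (\<integral>\<omega>. D \<omega> \<bullet> G2 \<omega> \<partial>M)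
      - 2 * (\<integral>\<omega>. D \<omega> \<bullet> G3 \<omega> \<partial>M) + 3 * (\<integral>\<omega>. (norm (G1 \<omega>))\<^sup>2 \<partial>M)
      + 3 * (\<integral>\<omega>. (norm (G2 \<omega>))\<^sup>2 \<partial>M) + 3 * (\<integral>\<omega>. (norm (G3 \<omega>))\<^sup>2 \<partial>M)"
    by simp
  also have "\<dots> \<le> ?E + 2 * (La * (2 * k) * ?E) + 2 * (La * k * ((?E + Ba\<^sup>2 * (1 + ?X) * k) / 2))
      - 2 * 0 + 3 * (La\<^sup>2 * ?E * (4 * k)) + 3 * (La\<^sup>2 * (Ba\<^sup>2 * (1 + ?X) * k) * k)
      + 3 * (Ba\<^sup>2 * (2 * (1 + ?X) + 2 * ?E) * (k * \<delta>))"
    unfolding G3_drift using G1_drift G2_drift G1_mom G2_mom G3_mom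
    by (intro add_mono diff_mono mult_left_mono) simp_all
  \<comment> \<open>The 5 is 4 from the cross term of \<open>G1\<close> plus 1 from that of
    \<open>G2\<close>; 12 is three times the 4 in the second moment of
    \<open>\<xi>1 + \<xi>2\<close>; 6 is three times the 2 in the bound of the coarse
    moment.\<close>
  also have "\<dots> = (1 + (5 * La + 12 * La\<^sup>2) * k + 6 * Ba\<^sup>2 * k * \<delta>) * ?E
        + ((La + 3 * La\<^sup>2) * Ba\<^sup>2 * k\<^sup>2 + 6 * Ba\<^sup>2 * k * \<delta>) * (1 + ?X)"
    by (simp add: field_simps power2_eq_square)
  finally show "(\<integral>\<omega>. (norm (x'' \<omega> - y'' \<omega>))\<^sup>2 \<partial>M)
      \<le> (1 + (5 * La + 12 * La\<^sup>2) * k + 6 * Ba\<^sup>2 * k * \<delta>) * (\<integral>\<omega>. (norm (x \<omega> - y \<omega>))\<^sup>2 \<partial>M)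
        + ((La + 3 * La\<^sup>2) * Ba\<^sup>2 * k\<^sup>2 + 6 * Ba\<^sup>2 * k * \<delta>) * (1 + ?X)"
    by (simp add: D_def)
qed

end

section \<open>Coupled Euler paths\<close>

context euler_scheme
begin

text \<open>Iterates the one-step estimate over blocks of two fine columns and one coarse column;
  independence is required across blocks and, within a block, only between the two fine columns. The
  closed form with factor \<open>real j\<close> is cruder than the geometric sum but simpler to
  propagate.\<close>

lemma coupled_euler_paths:
  fixes X0 :: "'w \<Rightarrow> real ^ 'd" and z s :: "'w \<Rightarrow> nat \<Rightarrow> real ^ 'm"
  assumes B: "indep_vars (\<lambda>_. borel) (\<lambda>j \<omega>. (z \<omega> (2 * j - 1), z \<omega> (2 * j), s \<omega> j)) {1..J}"
    and P0: "indep_rv borel X0 (PiM {1..J} (\<lambda>_. borel))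
      (\<lambda>\<omega>. \<lambda>j\<in>{1..J}. (z \<omega> (2 * j - 1), z \<omega> (2 * j), s \<omega> j))"
    and ind: "\<And>j. j \<in> {1..J} \<Longrightarrow> indep_rv borel (\<lambda>\<omega>. z \<omega> (2 * j - 1)) borel (\<lambda>\<omega>. z \<omega> (2 * j))"
    and X0: "sq_integrable X0"
    and z: "\<And>i. i \<in> {1..2 * J} \<Longrightarrow> sq_integrable (\<lambda>\<omega>. z \<omega> i)"
      "\<And>i. i \<in> {1..2 * J} \<Longrightarrow> (\<integral>\<omega>. (norm (z \<omega> i))\<^sup>2 \<partial>M) \<le> k"
      "\<And>i. i \<in> {1..2 * J} \<Longrightarrow> norm (\<integral>\<omega>. z \<omega> i \<partial>M) \<le> k"
    and R: "\<And>j. j \<in> {1..J} \<Longrightarrow> sq_integrable (\<lambda>\<omega>. s \<omega> j - z \<omega> (2 * j - 1) - z \<omega> (2 * j))"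
      "\<And>j. j \<in> {1..J} \<Longrightarrow> (\<integral>\<omega>. s \<omega> j - z \<omega> (2 * j - 1) - z \<omega> (2 * j) \<partial>M) = 0"
      "\<And>j. j \<in> {1..J} \<Longrightarrow> (\<integral>\<omega>. (norm (s \<omega> j - z \<omega> (2 * j - 1) - z \<omega> (2 * j)))\<^sup>2 \<partial>M) \<le> k * \<delta>"
    and k: "0 \<le> k" and \<delta>: "0 \<le> \<delta>"
  defines "p \<equiv> (5 * La + 12 * La\<^sup>2) * k + 6 * Ba\<^sup>2 * k * \<delta>"
    and "q \<equiv> ((La + 3 * La\<^sup>2) * Ba\<^sup>2 * k\<^sup>2 + 6 * Ba\<^sup>2 * k * \<delta>)
      * ((1 + (2 * Ba + Ba\<^sup>2) * k) ^ (2 * J) * (1 + (\<integral>\<omega>. (norm (X0 \<omega>))\<^sup>2 \<partial>M)))"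
  assumes j: "j \<le> J"
  shows "sq_integrable (\<lambda>\<omega>. euler a (X0 \<omega>) (z \<omega>) (2 * j))"
    and "sq_integrable (\<lambda>\<omega>. euler a (X0 \<omega>) (s \<omega>) j)"
    and "1 + (\<integral>\<omega>. (norm (euler a (X0 \<omega>) (z \<omega>) (2 * j)))\<^sup>2 \<partial>M)
      \<le> (1 + (2 * Ba + Ba\<^sup>2) * k) ^ (2 * j) * (1 + (\<integral>\<omega>. (norm (X0 \<omega>))\<^sup>2 \<partial>M))"
    and "(\<integral>\<omega>. (norm (euler a (X0 \<omega>) (z \<omega>) (2 * j) - euler a (X0 \<omega>) (s \<omega>) j))\<^sup>2 \<partial>M)
      \<le> real j * q * (1 + p) ^ j"
proof -
  define x where "x j = (\<lambda>\<omega>. euler a (X0 \<omega>) (z \<omega>) (2 * j))" for j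
  define y where "y j = (\<lambda>\<omega>. euler a (X0 \<omega>) (s \<omega>) j)" for j
  let ?B = "\<lambda>j \<omega>. (z \<omega> (2 * j - 1), z \<omega> (2 * j), s \<omega> j)"
  \<comment> \<open>The joint update of both paths by one block: two fine steps and one coarse
    step.\<close>
  define h :: "((real ^ 'd) \<times> (real ^ 'd)) \<times> (real ^ 'm) \<times> (real ^ 'm) \<times> (real ^ 'm) \<Rightarrow> (real ^ 'd) \<times> (real ^ 'd)"
    where "h r = (let x = fst (fst r); y = snd (fst r); b = snd r; x' = x + a x *v fst b
      in (x' + a x' *v fst (snd b), y + a y *v snd (snd b)))" for r
  have indep: "indep_rv borel (\<lambda>\<omega>. (x j \<omega>, y j \<omega>)) borel (?B (Suc j))" if "j < J" for j
  proof (rule indep_rv_recursion[where h = h and P = "\<lambda>j \<omega>. (x j \<omega>, y j \<omega>)", OF B _ _ _ that])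
    have "indep_rv borel (\<lambda>\<omega>. (X0 \<omega>, X0 \<omega>)) (PiM {1..J} (\<lambda>_. borel)) (\<lambda>\<omega>. \<lambda>j\<in>{1..J}. ?B j \<omega>)"
      by (rule indep_rv_compose[OF P0, where h = "\<lambda>x. x"]) measurable
    thus "indep_rv borel (\<lambda>\<omega>. (x 0 \<omega>, y 0 \<omega>)) (PiM {1..J} (\<lambda>_. borel)) (\<lambda>\<omega>. \<lambda>j\<in>{1..J}. ?B j \<omega>)"
      unfolding x_def y_def by (simp only: mult_0_right euler.simps)
    show "h \<in> measurable (borel \<Otimes>\<^sub>M borel) borel" unfolding h_def Let_def by measurable
    show "(x (Suc j) \<omega>, y (Suc j) \<omega>) = h ((x j \<omega>, y j \<omega>), ?B (Suc j) \<omega>)" for j \<omega>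
      by (simp add: h_def x_def y_def Let_def)
  qed
  have p: "0 \<le> p" and q: "0 \<le> q" using La Ba k \<delta> by (auto simp: p_def q_def)
  let ?c = "1 + (2 * Ba + Ba\<^sup>2) * k" and ?m = "1 + (\<integral>\<omega>. (norm (X0 \<omega>))\<^sup>2 \<partial>M)"
  have c: "1 \<le> ?c" using k Ba by simp
  have main: "sq_integrable (x j) \<and> sq_integrable (y j) \<and>
    1 + (\<integral>\<omega>. (norm (x j \<omega>))\<^sup>2 \<partial>M) \<le> ?c ^ (2 * j) * ?m \<and>
    (\<integral>\<omega>. (norm (x j \<omega> - y j \<omega>))\<^sup>2 \<partial>M) \<le> real j * q * (1 + p) ^ j"
    using j
  proof (induction j)
    case 0
    then show ?case using X0 by (simp add: x_def y_def)
  next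
    case (Suc j)
    hence j: "j < J" and IH: "sq_integrable (x j)" "sq_integrable (y j)"
      "1 + (\<integral>\<omega>. (norm (x j \<omega>))\<^sup>2 \<partial>M) \<le> ?c ^ (2 * j) * ?m"
      "(\<integral>\<omega>. (norm (x j \<omega> - y j \<omega>))\<^sup>2 \<partial>M) \<le> real j * q * (1 + p) ^ j" by auto
    have i: "2 * Suc j - 1 \<in> {1..2 * J}" "2 * Suc j \<in> {1..2 * J}" "Suc j \<in> {1..J}" using j by auto
    note step = coupled_step[OF indep[OF j] ind[OF i(3)] IH(1,2) z(1)[OF i(1)] z(1)[OF i(2)] R[OF i(3)]
      z(2,3)[OF i(1)] z(2,3)[OF i(2)] \<delta>]
    have xs: "(\<lambda>\<omega>. x j \<omega> + a (x j \<omega>) *v z \<omega> (2 * Suc j - 1) +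
        a (x j \<omega> + a (x j \<omega>) *v z \<omega> (2 * Suc j - 1)) *v z \<omega> (2 * Suc j)) = x (Suc j)"
      by (simp add: x_def fun_eq_iff)
    have ys: "(\<lambda>\<omega>. y j \<omega> + a (y j \<omega>) *v s \<omega> (Suc j)) = y (Suc j)" by (simp add: y_def fun_eq_iff)
    note step = step[unfolded xs ys fun_cong[OF xs] fun_cong[OF ys]]
    have "1 + (\<integral>\<omega>. (norm (x (Suc j) \<omega>))\<^sup>2 \<partial>M) \<le> ?c\<^sup>2 * (?c ^ (2 * j) * ?m)"
      by (rule order_trans[OF step(3) mult_left_mono[OF IH(3)]]) simp
    also have "\<dots> = ?c ^ (2 * Suc j) * ?m" by (simp add: power2_eq_square)
    finally have mom: "1 + (\<integral>\<omega>. (norm (x (Suc j) \<omega>))\<^sup>2 \<partial>M) \<le> ?c ^ (2 * Suc j) * ?m" .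
    \<comment> \<open>The moment bound grows with \<open>j\<close>, so its value after the last
      block makes the inhomogeneity \<open>q\<close> the same in all steps.\<close>
    have "((La + 3 * La\<^sup>2) * Ba\<^sup>2 * k\<^sup>2 + 6 * Ba\<^sup>2 * k * \<delta>) * (1 + (\<integral>\<omega>. (norm (x j \<omega>))\<^sup>2 \<partial>M)) \<le> q"
      unfolding q_def
    proof (rule mult_left_mono)
      show "1 + (\<integral>\<omega>. (norm (x j \<omega>))\<^sup>2 \<partial>M) \<le> ?c ^ (2 * J) * ?m"
        by (rule order_trans[OF IH(3) mult_right_mono[OF power_increasing[OF _ c]]]) (use j in auto)
    qed (use La Ba k \<delta> in simp)
    hence "(\<integral>\<omega>. (norm (x (Suc j) \<omega> - y (Suc j) \<omega>))\<^sup>2 \<partial>M)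
        \<le> (1 + p) * (\<integral>\<omega>. (norm (x j \<omega> - y j \<omega>))\<^sup>2 \<partial>M) + q"
      using step(4) by (simp add: p_def add.assoc)
    \<comment> \<open>Inflating \<open>q\<close> by a power of \<open>1 + p\<close> lets it join the
      induction hypothesis as one more equal summand.\<close>
    also have "\<dots> \<le> (1 + p) * (real j * q * (1 + p) ^ j) + q * (1 + p) ^ Suc j"
    proof (rule add_mono)
      show "(1 + p) * (\<integral>\<omega>. (norm (x j \<omega> - y j \<omega>))\<^sup>2 \<partial>M) \<le> (1 + p) * (real j * q * (1 + p) ^ j)"
        by (rule mult_left_mono[OF IH(4)]) (use p in simp)
      have "1 \<le> (1 + p) ^ Suc j" by (rule one_le_power) (use p in simp)
      from mult_left_mono[OF this q] show "q \<le> q * (1 + p) ^ Suc j" by simp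
    qed
    also have "\<dots> = real (Suc j) * q * (1 + p) ^ Suc j" by (simp add: algebra_simps)
    finally show ?case using step(1,2) mom by blast
  qed
  show "sq_integrable (\<lambda>\<omega>. euler a (X0 \<omega>) (z \<omega>) (2 * j))"
    and "sq_integrable (\<lambda>\<omega>. euler a (X0 \<omega>) (s \<omega>) j)"
    and "1 + (\<integral>\<omega>. (norm (euler a (X0 \<omega>) (z \<omega>) (2 * j)))\<^sup>2 \<partial>M)
      \<le> (1 + (2 * Ba + Ba\<^sup>2) * k) ^ (2 * j) * (1 + (\<integral>\<omega>. (norm (X0 \<omega>))\<^sup>2 \<partial>M))"
    and "(\<integral>\<omega>. (norm (euler a (X0 \<omega>) (z \<omega>) (2 * j) - euler a (X0 \<omega>) (s \<omega>) j))\<^sup>2 \<partial>M)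
      \<le> real j * q * (1 + p) ^ j"
    using main unfolding x_def y_def by auto
qed

text \<open>Discrete Gronwall: with \<open>2 * J\<close> steps of size \<open>\<delta> = T / (2 * J)\<close>, the growth factors per step
  accumulate to an exponential in \<open>T\<close>, and the local errors of order \<open>\<delta>\<^sup>2\<close> to one of order \<open>\<delta>\<close>.\<close>

definition moment_bound :: "real \<Rightarrow> real \<Rightarrow> real \<Rightarrow> real" where
  "moment_bound K T m = exp ((2 * Ba + Ba\<^sup>2) * K * T) * (1 + m)"

definition coupling_bound :: "real \<Rightarrow> real \<Rightarrow> real \<Rightarrow> real" where
  "coupling_bound K T m = T * ((La + 3 * La\<^sup>2) * Ba\<^sup>2 * K\<^sup>2 + 6 * Ba\<^sup>2 * K) * moment_bound K T m
     * exp (((5 * La + 12 * La\<^sup>2) * K + 6 * Ba\<^sup>2 * K * T) * T)"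

lemma coupled_euler_ends:
  fixes X0 :: "'w \<Rightarrow> real ^ 'd" and z s :: "'w \<Rightarrow> nat \<Rightarrow> real ^ 'm"
  assumes B: "indep_vars (\<lambda>_. borel) (\<lambda>j \<omega>. (z \<omega> (2 * j - 1), z \<omega> (2 * j), s \<omega> j)) {1..J}"
    and P0: "indep_rv borel X0 (PiM {1..J} (\<lambda>_. borel))
      (\<lambda>\<omega>. \<lambda>j\<in>{1..J}. (z \<omega> (2 * j - 1), z \<omega> (2 * j), s \<omega> j))"
    and ind: "\<And>j. j \<in> {1..J} \<Longrightarrow> indep_rv borel (\<lambda>\<omega>. z \<omega> (2 * j - 1)) borel (\<lambda>\<omega>. z \<omega> (2 * j))"
    and X0: "sq_integrable X0"
    and z: "\<And>i. i \<in> {1..2 * J} \<Longrightarrow> sq_integrable (\<lambda>\<omega>. z \<omega> i)"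
      "\<And>i. i \<in> {1..2 * J} \<Longrightarrow> (\<integral>\<omega>. (norm (z \<omega> i))\<^sup>2 \<partial>M) \<le> K * \<delta>"
      "\<And>i. i \<in> {1..2 * J} \<Longrightarrow> norm (\<integral>\<omega>. z \<omega> i \<partial>M) \<le> K * \<delta>"
    and R: "\<And>j. j \<in> {1..J} \<Longrightarrow> sq_integrable (\<lambda>\<omega>. s \<omega> j - z \<omega> (2 * j - 1) - z \<omega> (2 * j))"
      "\<And>j. j \<in> {1..J} \<Longrightarrow> (\<integral>\<omega>. s \<omega> j - z \<omega> (2 * j - 1) - z \<omega> (2 * j) \<partial>M) = 0"
      "\<And>j. j \<in> {1..J} \<Longrightarrow> (\<integral>\<omega>. (norm (s \<omega> j - z \<omega> (2 * j - 1) - z \<omega> (2 * j)))\<^sup>2 \<partial>M) \<le> K * \<delta>\<^sup>2"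
    and K: "0 \<le> K" and \<delta>: "0 \<le> \<delta>" and J: "1 \<le> J" and T: "2 * real J * \<delta> = T"
  defines "m \<equiv> \<integral>\<omega>. (norm (X0 \<omega>))\<^sup>2 \<partial>M"
  shows "sq_integrable (\<lambda>\<omega>. euler a (X0 \<omega>) (z \<omega>) (2 * J))"
    and "sq_integrable (\<lambda>\<omega>. euler a (X0 \<omega>) (s \<omega>) J)"
    and "(\<integral>\<omega>. (norm (euler a (X0 \<omega>) (z \<omega>) (2 * J)))\<^sup>2 \<partial>M) \<le> moment_bound K T m"
    and "(\<integral>\<omega>. (norm (euler a (X0 \<omega>) (z \<omega>) (2 * J) - euler a (X0 \<omega>) (s \<omega>) J))\<^sup>2 \<partial>M)
      \<le> coupling_bound K T m * \<delta>"
proof -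
  have R3: "(\<integral>\<omega>. (norm (s \<omega> j - z \<omega> (2 * j - 1) - z \<omega> (2 * j)))\<^sup>2 \<partial>M) \<le> (K * \<delta>) * \<delta>"
    if "j \<in> {1..J}" for j using R(3)[OF that] by (simp add: power2_eq_square mult.assoc)
  have k: "0 \<le> K * \<delta>" using K \<delta> by simp
  note paths = coupled_euler_paths[OF B P0 ind X0 z R(1,2) R3 k \<delta> order_refl, folded m_def]
  have m: "0 \<le> m" by (simp add: m_def)
  \<comment> \<open>At least one block exists, so \<open>\<delta>\<close> is at most
    \<open>T\<close>. This absorbs the \<open>\<delta>\<^sup>2\<close> term of the growth rate
    \<open>p\<close> into a multiple of \<open>\<delta>\<close>, whence the extra \<open>T\<close>
    in the exponent of \<open>coupling_bound\<close>.\<close>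
  have \<delta>T: "\<delta> \<le> T" using T J \<delta> mult_right_mono[of 1 "2 * real J" \<delta>] by simp
  hence T0: "0 \<le> T" using \<delta> by simp
  have pow: "(1 + u) ^ n \<le> exp (real n * u)" if "0 \<le> u" for u :: real and n
    using power_mono[OF exp_ge_add_one_self[of u], of n] that by (simp add: exp_of_nat_mult)
  show "sq_integrable (\<lambda>\<omega>. euler a (X0 \<omega>) (z \<omega>) (2 * J))"
    "sq_integrable (\<lambda>\<omega>. euler a (X0 \<omega>) (s \<omega>) J)" using paths(1,2) by blast+
  have "(1 + (2 * Ba + Ba\<^sup>2) * (K * \<delta>)) ^ (2 * J) \<le> exp (real (2 * J) * ((2 * Ba + Ba\<^sup>2) * (K * \<delta>)))"
    using Ba k by (intro pow) simp
  also have "real (2 * J) * ((2 * Ba + Ba\<^sup>2) * (K * \<delta>)) = (2 * Ba + Ba\<^sup>2) * K * T"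
    unfolding T[symmetric] by simp
  finally have "(1 + (2 * Ba + Ba\<^sup>2) * (K * \<delta>)) ^ (2 * J) * (1 + m) \<le> moment_bound K T m"
    unfolding moment_bound_def using m by (intro mult_right_mono) auto
  note mom = this
  show "(\<integral>\<omega>. (norm (euler a (X0 \<omega>) (z \<omega>) (2 * J)))\<^sup>2 \<partial>M) \<le> moment_bound K T m"
    using order_trans[OF paths(3) mom] by simp

  define p where "p = (5 * La + 12 * La\<^sup>2) * (K * \<delta>) + 6 * Ba\<^sup>2 * (K * \<delta>) * \<delta>"
  define r where "r = (La + 3 * La\<^sup>2) * Ba\<^sup>2 * (K * \<delta>)\<^sup>2 + 6 * Ba\<^sup>2 * (K * \<delta>) * \<delta>"
  let ?C = "(La + 3 * La\<^sup>2) * Ba\<^sup>2 * K\<^sup>2 + 6 * Ba\<^sup>2 * K"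
  let ?E = "exp (((5 * La + 12 * La\<^sup>2) * K + 6 * Ba\<^sup>2 * K * T) * T)"
  have p0: "0 \<le> p" using La Ba K \<delta> by (simp add: p_def)
  have r: "r = ?C * \<delta>\<^sup>2" by (simp add: r_def power2_eq_square algebra_simps)
  have C: "0 \<le> ?C" using La Ba K by simp
  have mb: "0 \<le> moment_bound K T m" using m by (simp add: moment_bound_def)
  have pT: "p \<le> ((5 * La + 12 * La\<^sup>2) * K + 6 * Ba\<^sup>2 * K * T) * \<delta>"
  proof -
    have "6 * Ba\<^sup>2 * K * \<delta> * \<delta> \<le> 6 * Ba\<^sup>2 * K * \<delta> * T" using K \<delta> \<delta>T by (intro mult_left_mono) auto
    thus ?thesis by (simp add: p_def algebra_simps)
  qed
  have "(1 + p) ^ J \<le> exp (real J * p)" by (rule pow[OF p0])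
  \<comment> \<open>Doubling the number of steps wastes a factor but lets
    \<open>2 * J * \<delta>\<close> be replaced by \<open>T\<close>.\<close>
  also have "real J * p \<le> real (2 * J) * (((5 * La + 12 * La\<^sup>2) * K + 6 * Ba\<^sup>2 * K * T) * \<delta>)"
    using pT p0 by (intro mult_mono) auto
  also have "\<dots> = ((5 * La + 12 * La\<^sup>2) * K + 6 * Ba\<^sup>2 * K * T) * (2 * real J * \<delta>)" by simp
  also have "\<dots> = ((5 * La + 12 * La\<^sup>2) * K + 6 * Ba\<^sup>2 * K * T) * T" unfolding T ..
  finally have pE: "(1 + p) ^ J \<le> ?E" by simp
  have "(\<integral>\<omega>. (norm (euler a (X0 \<omega>) (z \<omega>) (2 * J) - euler a (X0 \<omega>) (s \<omega>) J))\<^sup>2 \<partial>M)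
    \<le> real J * (r * ((1 + (2 * Ba + Ba\<^sup>2) * (K * \<delta>)) ^ (2 * J) * (1 + m))) * (1 + p) ^ J"
    using paths(4) by (simp only: p_def r_def)
  also have "\<dots> \<le> real J * (r * moment_bound K T m) * ?E"
  proof (rule mult_mono[OF mult_left_mono[OF mult_left_mono[OF mom]] pE])
    show r0: "0 \<le> r" using C unfolding r by simp
    show "0 \<le> real J * (r * moment_bound K T m)" using r0 mb by simp
  qed (use p0 in auto)
  also have "\<dots> = (real J * \<delta>) * (?C * moment_bound K T m * ?E * \<delta>)"
    by (simp add: r power2_eq_square)
  also have "\<dots> \<le> T * (?C * moment_bound K T m * ?E * \<delta>)"
    using T \<delta> C mb T0 by (intro mult_right_mono mult_nonneg_nonneg) auto
  finally show "(\<integral>\<omega>. (norm (euler a (X0 \<omega>) (z \<omega>) (2 * J) - euler a (X0 \<omega>) (s \<omega>) J))\<^sup>2 \<partial>M)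
      \<le> coupling_bound K T m * \<delta>"
    by (simp add: coupling_bound_def mult_ac)
qed

end

section \<open>The levels of the multilevel estimate\<close>

lemma lipschitz_measurable:
  fixes f :: "'a::real_normed_vector \<Rightarrow> real"
  assumes "Kf-lipschitz_on UNIV f"
  shows "f \<in> borel_measurable borel"
  using Lipschitz.lipschitz_on_continuous_on[OF assms] by (rule borel_measurable_continuous_onI)

lemma lipschitz_sq_le:
  fixes f :: "'a::real_normed_vector \<Rightarrow> real"
  assumes "Kf-lipschitz_on UNIV f"
  shows "(f x - f y)\<^sup>2 \<le> Kf\<^sup>2 * (norm (x - y))\<^sup>2"
proof -
  have "\<bar>f x - f y\<bar> \<le> Kf * norm (x - y)"
    using lipschitz_onD[OF assms, of x y] by (simp add: dist_norm)
  from power_mono[OF this, of 2] show ?thesis by (simp add: power_mult_distrib)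
qed

lemma same_distr_integral:
  fixes g :: "'b \<Rightarrow> 'c::{banach, second_countable_topology}"
  assumes X: "X \<in> measurable M N" and Y: "Y \<in> measurable M' N" and g: "g \<in> borel_measurable N"
    and eq: "distr M N X = distr M' N Y"
  shows "integrable M (\<lambda>\<omega>. g (X \<omega>)) \<longleftrightarrow> integrable M' (\<lambda>\<omega>. g (Y \<omega>))"
    and "(\<integral>\<omega>. g (X \<omega>) \<partial>M) = (\<integral>\<omega>. g (Y \<omega>) \<partial>M')"
  using integrable_distr_eq[OF X g] integrable_distr_eq[OF Y g] integral_distr[OF X g]
    integral_distr[OF Y g] eq by simp_all

context euler_coefficient
begin

lemma euler_measurable:
  assumes u: "u \<in> borel_measurable N" and w: "w \<in> measurable N (mat_space l)" and n: "n \<le> 2 ^ l"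
  shows "(\<lambda>\<omega>. euler a (u \<omega>) (w \<omega>) n) \<in> borel_measurable N"
  using n
proof (induction n)
  case 0
  then show ?case using u by simp
next
  case (Suc n)
  hence [measurable]: "(\<lambda>\<omega>. euler a (u \<omega>) (w \<omega>) n) \<in> borel_measurable N" by simp
  have [measurable]: "(\<lambda>\<omega>. w \<omega> (Suc n)) \<in> borel_measurable N"
    using Suc.prems
    by (intro measurable_compose[OF w] measurable_component_singleton) (auto simp: mat_space_def)
  show ?case by simp
qed

end

text \<open>One fixed finest level \<open>L\<close>. The constant \<open>K\<close> serves all levels
  \<open>l\<close>, so bounds in terms of it are uniform in \<open>l\<close> and remain valid when
  \<open>L\<close> is chosen in dependence on the accuracy.\<close>

locale coupled_levels = euler_scheme M a La Ba
  for M :: "'w measure" and a :: "real ^ 'd \<Rightarrow> real ^ 'm ^ 'd" and La Ba :: real +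
  fixes L :: nat and X0 :: "'w \<Rightarrow> real ^ 'd" and \<zeta> :: "nat \<Rightarrow> 'w \<Rightarrow> nat \<Rightarrow> real ^ 'm"
    and \<sigma> :: "nat \<Rightarrow> (nat \<Rightarrow> real ^ 'm) \<Rightarrow> nat \<Rightarrow> real ^ 'm" and T K :: real
  assumes L: "1 \<le> L" and T: "0 < T" and K: "0 \<le> K"
    and coupled: "coupled_matrices M L \<zeta> \<sigma>"
    and X0: "sq_integrable X0"
    and init: "l \<le> L \<Longrightarrow> indep_rv borel X0 (mat_space l) (\<zeta> l)"
    and iid: "1 \<le> l \<Longrightarrow> l \<le> L \<Longrightarrow> iid_vars M borel (\<lambda>j \<omega>. \<zeta> l \<omega> j) {1..2 ^ l}"
    and residual_iid: "1 \<le> l \<Longrightarrow> l \<le> L \<Longrightarrow> iid_vars M borel (coupling_residual \<zeta> \<sigma> l) {1..2 ^ (l - 1)}"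
    and residual_mean: "1 \<le> l \<Longrightarrow> l \<le> L \<Longrightarrow> j \<in> {1..2 ^ (l - 1)} \<Longrightarrow>
      (\<integral>\<omega>. coupling_residual \<zeta> \<sigma> l j \<omega> \<partial>M) = 0"
    and moments: "1 \<le> l \<Longrightarrow> l \<le> L \<Longrightarrow>
      integrable M (\<lambda>\<omega>. (norm (\<zeta> l \<omega> 1))\<^sup>2) \<and>
      (\<integral>\<omega>. (norm (\<zeta> l \<omega> 1))\<^sup>2 \<partial>M) \<le> K * step T l \<and>
      norm (\<integral>\<omega>. \<zeta> l \<omega> 1 \<partial>M) \<le> K * step T l \<and>
      integrable M (\<lambda>\<omega>. (norm (coupling_residual \<zeta> \<sigma> l 1 \<omega>))\<^sup>2) \<and>
      (\<integral>\<omega>. (norm (coupling_residual \<zeta> \<sigma> l 1 \<omega>))\<^sup>2 \<partial>M) \<le> K * (step T l)\<^sup>2"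
begin

abbreviation "m0 \<equiv> (\<integral>\<omega>. (norm (X0 \<omega>))\<^sup>2 \<partial>M)"

lemma \<zeta>_measurable: "l \<le> L \<Longrightarrow> \<zeta> l \<in> measurable M (mat_space l)"
  using indep_rv_measurable(2)[OF init] .

lemma \<sigma>_measurable: "1 \<le> l \<Longrightarrow> l \<le> L \<Longrightarrow> \<sigma> l \<in> measurable (mat_space l) (mat_space (l - 1))"
  using coupled by (auto simp: coupled_matrices_def)

text \<open>Level \<open>l\<close> consists of \<open>J = 2 ^ (l - 1)\<close> blocks, one for each
  step of level \<open>l - 1\<close>; what remains is to derive the block hypotheses from those on
  columns and residuals.\<close>

lemma level_ends:
  assumes l: "1 \<le> l" "l \<le> L"
  shows "sq_integrable (\<lambda>\<omega>. euler_end a l (X0 \<omega>) (\<zeta> l \<omega>))"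
    and "sq_integrable (\<lambda>\<omega>. euler_end a (l - 1) (X0 \<omega>) (\<sigma> l (\<zeta> l \<omega>)))"
    and "(\<integral>\<omega>. (norm (euler_end a l (X0 \<omega>) (\<zeta> l \<omega>)))\<^sup>2 \<partial>M) \<le> moment_bound K T m0"
    and "(\<integral>\<omega>. (norm (euler_end a l (X0 \<omega>) (\<zeta> l \<omega>) - euler_end a (l - 1) (X0 \<omega>) (\<sigma> l (\<zeta> l \<omega>))))\<^sup>2 \<partial>M)
      \<le> coupling_bound K T m0 * step T l"
proof -
  define J :: nat where "J = 2 ^ (l - 1)"
  have J: "2 * J = 2 ^ l" using l power_Suc[of "2::nat" "l - 1"] by (simp add: J_def)
  have J1: "1 \<le> J" by (simp add: J_def)
  have oneJ: "1 \<in> {1..J}" using J1 by simp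
  have \<delta>: "0 \<le> step T l" using T by (simp add: step_def)
  have "2 * real J = 2 ^ l" using arg_cong[OF J, of real] by simp
  hence TJ: "2 * real J * step T l = T" by (simp add: step_def)
  have comp: "(\<lambda>v. v i) \<in> borel_measurable (mat_space k)" if "i \<in> {1..2 ^ k}" for i k
    using that unfolding mat_space_def by (rule measurable_component_singleton)
  have B: "indep_vars (\<lambda>_. borel) (\<lambda>j \<omega>. (\<zeta> l \<omega> (2 * j - 1), \<zeta> l \<omega> (2 * j), \<sigma> l (\<zeta> l \<omega>) j)) {1..J}"
    using coupled l by (auto simp: coupled_matrices_def J_def)
  have P0: "indep_rv borel X0 (PiM {1..J} (\<lambda>_. borel))
      (\<lambda>\<omega>. \<lambda>j\<in>{1..J}. (\<zeta> l \<omega> (2 * j - 1), \<zeta> l \<omega> (2 * j), \<sigma> l (\<zeta> l \<omega>) j))"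
  proof (rule indep_rv_compose[OF init[OF l(2)], where g = "\<lambda>x. x"
        and h = "\<lambda>v. \<lambda>j\<in>{1..J}. (v (2 * j - 1), v (2 * j), \<sigma> l v j)"])
    show "(\<lambda>v. \<lambda>j\<in>{1..J}. (v (2 * j - 1), v (2 * j), \<sigma> l v j))
        \<in> measurable (mat_space l) (PiM {1..J} (\<lambda>_. borel))"
    proof (intro measurable_restrict borel_measurable_Pair comp)
      fix j assume j: "j \<in> {1..J}"
      thus "2 * j - 1 \<in> {1..2 ^ l}" "2 * j \<in> {1..2 ^ l}" using J[symmetric] by auto
      show "(\<lambda>v. \<sigma> l v j) \<in> borel_measurable (mat_space l)"
        by (rule measurable_compose[OF \<sigma>_measurable[OF l] comp]) (use j in \<open>simp add: J_def\<close>)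
    qed
  qed simp
  have one: "1 \<in> {1..(2::nat) ^ l}" by simp
  have \<zeta>_indep: "indep_vars (\<lambda>_. borel) (\<lambda>j \<omega>. \<zeta> l \<omega> j) {1..2 ^ l}"
    and \<zeta>_id: "\<And>i. i \<in> {1..2 ^ l} \<Longrightarrow> distr M borel (\<lambda>\<omega>. \<zeta> l \<omega> i) = distr M borel (\<lambda>\<omega>. \<zeta> l \<omega> 1)"
    using iid[OF l] one unfolding iid_vars_def by blast+
  \<comment> \<open>The block condition says nothing about independence inside a triple; for the two
    fine columns it comes from the i.i.d. assumption.\<close>
  have ind: "indep_rv borel (\<lambda>\<omega>. \<zeta> l \<omega> (2 * j - 1)) borel (\<lambda>\<omega>. \<zeta> l \<omega> (2 * j))" if "j \<in> {1..J}" for j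
  proof -
    let ?i = "2 * j - 1" and ?k = "2 * j"
    have "indep_rv (PiM {?i} (\<lambda>_. borel)) (\<lambda>\<omega>. \<lambda>j\<in>{?i}. \<zeta> l \<omega> j) (PiM {?k} (\<lambda>_. borel)) (\<lambda>\<omega>. \<lambda>j\<in>{?k}. \<zeta> l \<omega> j)"
      unfolding indep_rv_eq_indep_var using that J
      by (intro indep_var_restrict[OF \<zeta>_indep]) auto
    from indep_rv_compose[OF this, of "\<lambda>v. v ?i" borel "\<lambda>v. v ?k" borel] show ?thesis by simp
  qed
  have z_rv: "(\<lambda>\<omega>. \<zeta> l \<omega> i) \<in> borel_measurable M" if "i \<in> {1..2 ^ l}" for i
    using \<zeta>_indep that by (auto simp: indep_vars_def)
  have sq_meas: "(\<lambda>v. (norm v)\<^sup>2) \<in> borel_measurable borel" by measurable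
  have id_meas: "(\<lambda>v. v) \<in> borel_measurable borel" by measurable
  \<comment> \<open>Moments are assumed for the first column only; equality in law carries them to
    the others, and likewise for the residuals below.\<close>
  note z_sq = same_distr_integral[OF z_rv z_rv[OF one] sq_meas \<zeta>_id]
  note z_mean = same_distr_integral(2)[OF z_rv z_rv[OF one] id_meas \<zeta>_id]
  have z: "sq_integrable (\<lambda>\<omega>. \<zeta> l \<omega> i)" "(\<integral>\<omega>. (norm (\<zeta> l \<omega> i))\<^sup>2 \<partial>M) \<le> K * step T l"
    "norm (\<integral>\<omega>. \<zeta> l \<omega> i \<partial>M) \<le> K * step T l" if "i \<in> {1..2 * J}" for i
    using moments[OF l] that z_rv z_sq[OF _ that[unfolded J]] z_mean[OF _ that[unfolded J]]
    by (simp_all add: sq_integrable_def J)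
  let ?R = "coupling_residual \<zeta> \<sigma> l"
  have R_rv: "?R j \<in> borel_measurable M" if "j \<in> {1..J}" for j
    using residual_iid[OF l] that by (auto simp: iid_vars_def indep_vars_def J_def)
  have R_id: "distr M borel (?R j) = distr M borel (?R 1)" if "j \<in> {1..J}" for j
    using residual_iid[OF l] that oneJ unfolding iid_vars_def J_def by blast
  note R_sq = same_distr_integral[OF R_rv R_rv[OF oneJ] sq_meas R_id]
  have R: "sq_integrable (\<lambda>\<omega>. \<sigma> l (\<zeta> l \<omega>) j - \<zeta> l \<omega> (2 * j - 1) - \<zeta> l \<omega> (2 * j))"
    "(\<integral>\<omega>. \<sigma> l (\<zeta> l \<omega>) j - \<zeta> l \<omega> (2 * j - 1) - \<zeta> l \<omega> (2 * j) \<partial>M) = 0"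
    "(\<integral>\<omega>. (norm (\<sigma> l (\<zeta> l \<omega>) j - \<zeta> l \<omega> (2 * j - 1) - \<zeta> l \<omega> (2 * j)))\<^sup>2 \<partial>M) \<le> K * (step T l)\<^sup>2"
    if "j \<in> {1..J}" for j
    using moments[OF l] R_sq[OF that that] R_rv[OF that] residual_mean[OF l, of j] that
    unfolding J_def[symmetric] sq_integrable_def coupling_residual_def[symmetric] by auto
  note ends = coupled_euler_ends[OF B P0 ind X0 z R K \<delta> J1 TJ, unfolded J, unfolded J_def]
  show "sq_integrable (\<lambda>\<omega>. euler_end a l (X0 \<omega>) (\<zeta> l \<omega>))"
    and "sq_integrable (\<lambda>\<omega>. euler_end a (l - 1) (X0 \<omega>) (\<sigma> l (\<zeta> l \<omega>)))"
    and "(\<integral>\<omega>. (norm (euler_end a l (X0 \<omega>) (\<zeta> l \<omega>)))\<^sup>2 \<partial>M) \<le> moment_bound K T m0"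
    and "(\<integral>\<omega>. (norm (euler_end a l (X0 \<omega>) (\<zeta> l \<omega>) - euler_end a (l - 1) (X0 \<omega>) (\<sigma> l (\<zeta> l \<omega>))))\<^sup>2 \<partial>M)
      \<le> coupling_bound K T m0 * step T l"
    using ends by blast+
qed

text \<open>Equality in law of the two matrices extends to the pairs with \<open>X0\<close>, because
  \<open>X0\<close> is independent of both and the joint laws are products.\<close>

lemma coarse_distr:
  assumes l: "1 \<le> l" "l \<le> L"
  shows "distr M (borel \<Otimes>\<^sub>M mat_space (l - 1)) (\<lambda>\<omega>. (X0 \<omega>, \<zeta> (l - 1) \<omega>))
    = distr M (borel \<Otimes>\<^sub>M mat_space (l - 1)) (\<lambda>\<omega>. (X0 \<omega>, \<sigma> l (\<zeta> l \<omega>)))"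
proof -
  have "indep_rv borel X0 (mat_space (l - 1)) (\<lambda>\<omega>. \<sigma> l (\<zeta> l \<omega>))"
    by (rule indep_rv_compose[OF init[OF l(2)] _ \<sigma>_measurable[OF l], where g = "\<lambda>x. x"]) simp
  moreover have "indep_rv borel X0 (mat_space (l - 1)) (\<zeta> (l - 1))" by (rule init) (use l in simp)
  moreover have "distr M (mat_space (l - 1)) (\<zeta> (l - 1)) = distr M (mat_space (l - 1)) (\<lambda>\<omega>. \<sigma> l (\<zeta> l \<omega>))"
    using coupled l by (auto simp: coupled_matrices_def)
  ultimately show ?thesis unfolding indep_rv_def by metis
qed

lemma coarse_integral:
  fixes g :: "real ^ 'd \<Rightarrow> real"
  assumes l: "1 \<le> l" "l \<le> L" and g: "g \<in> borel_measurable borel"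
  shows "integrable M (\<lambda>\<omega>. g (euler_end a (l - 1) (X0 \<omega>) (\<zeta> (l - 1) \<omega>)))
      \<longleftrightarrow> integrable M (\<lambda>\<omega>. g (euler_end a (l - 1) (X0 \<omega>) (\<sigma> l (\<zeta> l \<omega>))))"
    and "(\<integral>\<omega>. g (euler_end a (l - 1) (X0 \<omega>) (\<zeta> (l - 1) \<omega>)) \<partial>M)
      = (\<integral>\<omega>. g (euler_end a (l - 1) (X0 \<omega>) (\<sigma> l (\<zeta> l \<omega>))) \<partial>M)"
proof -
  have [measurable]: "X0 \<in> borel_measurable M" "\<zeta> (l - 1) \<in> measurable M (mat_space (l - 1))"
    "\<zeta> l \<in> measurable M (mat_space l)" "\<sigma> l \<in> measurable (mat_space l) (mat_space (l - 1))"
    using sq_integrableD(1)[OF X0] \<zeta>_measurable \<sigma>_measurable l by auto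
  have g': "(\<lambda>p. g (euler_end a (l - 1) (fst p) (snd p))) \<in> borel_measurable (borel \<Otimes>\<^sub>M mat_space (l - 1))"
    by (rule measurable_compose[OF euler_measurable[where l = "l - 1"] g]) simp_all
  have "(\<lambda>\<omega>. (X0 \<omega>, \<zeta> (l - 1) \<omega>)) \<in> measurable M (borel \<Otimes>\<^sub>M mat_space (l - 1))"
    "(\<lambda>\<omega>. (X0 \<omega>, \<sigma> l (\<zeta> l \<omega>))) \<in> measurable M (borel \<Otimes>\<^sub>M mat_space (l - 1))" by measurable
  from same_distr_integral[OF this g' coarse_distr[OF l]]
  show "integrable M (\<lambda>\<omega>. g (euler_end a (l - 1) (X0 \<omega>) (\<zeta> (l - 1) \<omega>)))
      \<longleftrightarrow> integrable M (\<lambda>\<omega>. g (euler_end a (l - 1) (X0 \<omega>) (\<sigma> l (\<zeta> l \<omega>))))"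
    and "(\<integral>\<omega>. g (euler_end a (l - 1) (X0 \<omega>) (\<zeta> (l - 1) \<omega>)) \<partial>M)
      = (\<integral>\<omega>. g (euler_end a (l - 1) (X0 \<omega>) (\<sigma> l (\<zeta> l \<omega>))) \<partial>M)" by simp_all
qed

end

section \<open>Second moments and means of the level differences\<close>

text \<open>Level 0 is treated as a difference with vanishing coarse part, which makes the estimate
  one weighted sum over pairs of level and sample, each term a function of a single copy of initial
  value and noise.\<close>

definition mlmc_summand ::
  "(real ^ 'd \<Rightarrow> real) \<Rightarrow> (real ^ 'd \<Rightarrow> real ^ 'm ^ 'd) \<Rightarrow>
   (nat \<Rightarrow> (nat \<Rightarrow> real ^ 'm) \<Rightarrow> nat \<Rightarrow> real ^ 'm) \<Rightarrow> nat \<Rightarrow> (real ^ 'd) \<times> (nat \<Rightarrow> real ^ 'm) \<Rightarrow> real" where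
  "mlmc_summand f a \<sigma> l p = f (euler_end a l (fst p) (snd p)) -
     (if l = 0 then 0 else f (euler_end a (l - 1) (fst p) (\<sigma> l (snd p))))"

lemma mlmc_estimate_eq:
  "mlmc_estimate f a \<sigma> U W L N \<omega> = (\<Sum>(l, n)\<in>(SIGMA l:{..L}. {1..N l}).
     1 / real (N l) * mlmc_summand f a \<sigma> l (U l n \<omega>, W l n \<omega>))"
proof -
  have "mlmc_estimate f a \<sigma> U W L N \<omega> = (\<Sum>l\<in>insert 0 {1..L}. \<Sum>n=1..N l.
      1 / real (N l) * mlmc_summand f a \<sigma> l (U l n \<omega>, W l n \<omega>))"
    by (subst sum.insert) (auto simp: mlmc_estimate_def mlmc_summand_def sum_distrib_left intro!: sum.cong)
  also have "insert 0 {1..L} = {..L}" by auto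
  finally show ?thesis by (simp add: sum.Sigma)
qed

context coupled_levels
begin

text \<open>The first two summands bound the second moment at level 0, the last one that of the
  differences at positive levels before division by \<open>2 ^ l\<close>; their sum serves
  both.\<close>

definition variance_constant :: "real \<Rightarrow> real \<Rightarrow> real" where
  "variance_constant Kf f0 = 2 * f0\<^sup>2 + 4 * Kf\<^sup>2 * (moment_bound K T m0 + coupling_bound K T m0 * T)
     + Kf\<^sup>2 * coupling_bound K T m0 * T"

lemma mlmc_summand_measurable:
  assumes f: "f \<in> borel_measurable borel" and l: "l \<le> L"
  shows "mlmc_summand f a \<sigma> l \<in> borel_measurable (borel \<Otimes>\<^sub>M mat_space l)"
proof -
  have 1: "(\<lambda>p. f (euler_end a l (fst p) (snd p))) \<in> borel_measurable (borel \<Otimes>\<^sub>M mat_space l)"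
    by (rule measurable_compose[OF euler_measurable[where l = l] f]) simp_all
  have 2: "(\<lambda>p. f (euler_end a (l - 1) (fst p) (\<sigma> l (snd p)))) \<in> borel_measurable (borel \<Otimes>\<^sub>M mat_space l)"
    if "l \<noteq> 0"
  proof (rule measurable_compose[OF euler_measurable[where l = "l - 1"] f])
    show "(\<lambda>p. \<sigma> l (snd p)) \<in> measurable (borel \<Otimes>\<^sub>M mat_space l) (mat_space (l - 1))"
      by (rule measurable_compose[OF measurable_snd \<sigma>_measurable]) (use that l in auto)
  qed simp_all
  have "mlmc_summand f a \<sigma> l = (\<lambda>p. f (euler_end a l (fst p) (snd p)) -
     (if l = 0 then 0 else f (euler_end a (l - 1) (fst p) (\<sigma> l (snd p)))))"
    by (simp add: mlmc_summand_def fun_eq_iff)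
  thus ?thesis using 1 2 by (cases "l = 0") simp_all
qed

text \<open>At positive levels the Lipschitz bound reduces the claim to the distance of the coupled
  endpoints. At level 0 boundedness suffices. Second moments stand in for variances, which they
  dominate.\<close>

lemma mlmc_summand_second_moment:
  assumes f: "Kf-lipschitz_on UNIV f" and l: "l \<le> L"
  shows "integrable M (\<lambda>\<omega>. (mlmc_summand f a \<sigma> l (X0 \<omega>, \<zeta> l \<omega>))\<^sup>2)"
    and "(\<integral>\<omega>. (mlmc_summand f a \<sigma> l (X0 \<omega>, \<zeta> l \<omega>))\<^sup>2 \<partial>M) \<le> variance_constant Kf (f 0) / 2 ^ l"
proof -
  note fm = lipschitz_measurable[OF f]
  have m0: "0 \<le> m0" by simp
  have mb: "0 \<le> moment_bound K T m0" using m0 by (simp add: moment_bound_def del: integral_nonneg)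
  have cb: "0 \<le> coupling_bound K T m0" using La K T mb by (simp add: coupling_bound_def)
  have "integrable M (\<lambda>\<omega>. (mlmc_summand f a \<sigma> l (X0 \<omega>, \<zeta> l \<omega>))\<^sup>2) \<and>
    (\<integral>\<omega>. (mlmc_summand f a \<sigma> l (X0 \<omega>, \<zeta> l \<omega>))\<^sup>2 \<partial>M) \<le> variance_constant Kf (f 0) / 2 ^ l"
  proof (cases "l = 0")
    case True
    \<comment> \<open>No moments are assumed at level 0, so its path is replaced by the coarse path
      of level 1, equal in law, and compared with the fine path of level 1.\<close>
    let ?x = "\<lambda>\<omega>. euler_end a 1 (X0 \<omega>) (\<zeta> 1 \<omega>)"
    let ?y = "\<lambda>\<omega>. euler_end a 0 (X0 \<omega>) (\<sigma> 1 (\<zeta> 1 \<omega>))"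
    note ends = level_ends[OF order_refl L, unfolded diff_self_eq_0]
    have "step T 1 \<le> T" using T by (simp add: step_def)
    hence D: "(\<integral>\<omega>. (norm (?x \<omega> - ?y \<omega>))\<^sup>2 \<partial>M) \<le> coupling_bound K T m0 * T"
      by (rule order_trans[OF ends(4) mult_left_mono[OF _ cb]])
    have add: "(\<integral>\<omega>. (norm (u \<omega>))\<^sup>2 \<partial>M)
        \<le> 2 * ((\<integral>\<omega>. (norm (w \<omega>))\<^sup>2 \<partial>M) + (\<integral>\<omega>. (norm (w \<omega> - u \<omega>))\<^sup>2 \<partial>M))"
      if "sq_integrable w" "sq_integrable u" for u w :: "'w \<Rightarrow> real ^ 'd"
      using second_moment_add_le[OF that(1) sq_integrable_uminus[OF sq_integrable_diff[OF that]]]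
      by (simp add: norm_minus_commute)
    have y: "(\<integral>\<omega>. (norm (?y \<omega>))\<^sup>2 \<partial>M) \<le> 2 * (moment_bound K T m0 + coupling_bound K T m0 * T)"
      by (rule order_trans[OF add[OF ends(1,2)] mult_left_mono[OF add_mono[OF ends(3) D]]]) simp
    have fy: "(f (?y \<omega>))\<^sup>2 \<le> 2 * (f 0)\<^sup>2 + 2 * Kf\<^sup>2 * (norm (?y \<omega>))\<^sup>2" for \<omega>
    proof -
      have "(f (?y \<omega>))\<^sup>2 \<le> 2 * ((f 0)\<^sup>2 + (f (?y \<omega>) - f 0)\<^sup>2)"
        using norm_add_squared_le[of "f 0" "f (?y \<omega>) - f 0"] by simp
      thus ?thesis using lipschitz_sq_le[OF f, of "?y \<omega>" 0] by simp
    qed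
    have ym: "?y \<in> borel_measurable M" by (rule sq_integrableD[OF ends(2)])
    have int: "integrable M (\<lambda>\<omega>. 2 * (f 0)\<^sup>2 + 2 * Kf\<^sup>2 * (norm (?y \<omega>))\<^sup>2)"
      using sq_integrableD(2)[OF ends(2)] by simp
    have "sq_integrable (\<lambda>\<omega>. f (?y \<omega>))"
      by (rule sq_integrable_bound[OF int measurable_compose[OF ym fm]]) (use fy in simp)
    hence sq: "integrable M (\<lambda>\<omega>. (f (?y \<omega>))\<^sup>2)" by (simp add: sq_integrable_def)
    have "(\<integral>\<omega>. (f (?y \<omega>))\<^sup>2 \<partial>M) \<le> (\<integral>\<omega>. 2 * (f 0)\<^sup>2 + 2 * Kf\<^sup>2 * (norm (?y \<omega>))\<^sup>2 \<partial>M)"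
      by (rule integral_mono[OF sq int fy])
    also have "\<dots> = 2 * (f 0)\<^sup>2 + 2 * Kf\<^sup>2 * (\<integral>\<omega>. (norm (?y \<omega>))\<^sup>2 \<partial>M)"
      using sq_integrableD(2)[OF ends(2)] by (simp add: prob_space)
    also have "\<dots> \<le> 2 * (f 0)\<^sup>2 + 2 * Kf\<^sup>2 * (2 * (moment_bound K T m0 + coupling_bound K T m0 * T))"
      by (intro add_left_mono mult_left_mono y) simp
    also have "\<dots> \<le> variance_constant Kf (f 0)"
    proof -
      have "0 \<le> Kf\<^sup>2 * coupling_bound K T m0 * T" using cb T by simp
      thus ?thesis by (simp add: variance_constant_def algebra_simps)
    qed
    finally have le: "(\<integral>\<omega>. (f (?y \<omega>))\<^sup>2 \<partial>M) \<le> variance_constant Kf (f 0)" .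
    have f2: "(\<lambda>x. (f x)\<^sup>2) \<in> borel_measurable borel" using fm by measurable
    note coarse = coarse_integral[OF order_refl L f2, unfolded diff_self_eq_0]
    have "integrable M (\<lambda>\<omega>. (f (euler_end a 0 (X0 \<omega>) (\<zeta> 0 \<omega>)))\<^sup>2)" using coarse(1) sq by blast
    moreover have "(\<integral>\<omega>. (f (euler_end a 0 (X0 \<omega>) (\<zeta> 0 \<omega>)))\<^sup>2 \<partial>M) \<le> variance_constant Kf (f 0)"
      using coarse(2) le by simp
    ultimately show ?thesis using True by (simp add: mlmc_summand_def)
  next
    case False
    hence l1: "1 \<le> l" by simp
    let ?x = "\<lambda>\<omega>. euler_end a l (X0 \<omega>) (\<zeta> l \<omega>)"
    let ?y = "\<lambda>\<omega>. euler_end a (l - 1) (X0 \<omega>) (\<sigma> l (\<zeta> l \<omega>))"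
    note ends = level_ends[OF l1 l]
    have S: "mlmc_summand f a \<sigma> l (X0 \<omega>, \<zeta> l \<omega>) = f (?x \<omega>) - f (?y \<omega>)" for \<omega>
      using False by (simp add: mlmc_summand_def)
    have int: "integrable M (\<lambda>\<omega>. Kf\<^sup>2 * (norm (?x \<omega> - ?y \<omega>))\<^sup>2)"
      using sq_integrableD(2)[OF sq_integrable_diff[OF ends(1,2)]] by simp
    have meas: "(\<lambda>\<omega>. f (?x \<omega>) - f (?y \<omega>)) \<in> borel_measurable M"
      by (intro borel_measurable_diff measurable_compose[OF _ fm] sq_integrableD(1)[OF ends(1)]
          sq_integrableD(1)[OF ends(2)])
    have "sq_integrable (\<lambda>\<omega>. f (?x \<omega>) - f (?y \<omega>))"
      by (rule sq_integrable_bound[OF int meas]) (use lipschitz_sq_le[OF f] in simp)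
    hence sq: "integrable M (\<lambda>\<omega>. (f (?x \<omega>) - f (?y \<omega>))\<^sup>2)" by (simp add: sq_integrable_def)
    have "(\<integral>\<omega>. (f (?x \<omega>) - f (?y \<omega>))\<^sup>2 \<partial>M) \<le> (\<integral>\<omega>. Kf\<^sup>2 * (norm (?x \<omega> - ?y \<omega>))\<^sup>2 \<partial>M)"
      by (rule integral_mono[OF sq int lipschitz_sq_le[OF f]])
    also have "\<dots> \<le> Kf\<^sup>2 * (coupling_bound K T m0 * step T l)"
      using mult_left_mono[OF ends(4), of "Kf\<^sup>2"] by simp
    also have "\<dots> = (Kf\<^sup>2 * coupling_bound K T m0 * T) / 2 ^ l" by (simp add: step_def)
    also have "\<dots> \<le> variance_constant Kf (f 0) / 2 ^ l"
      using mb cb T by (intro divide_right_mono) (simp_all add: variance_constant_def)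
    finally show ?thesis using sq unfolding S by blast
  qed
  thus "integrable M (\<lambda>\<omega>. (mlmc_summand f a \<sigma> l (X0 \<omega>, \<zeta> l \<omega>))\<^sup>2)"
    and "(\<integral>\<omega>. (mlmc_summand f a \<sigma> l (X0 \<omega>, \<zeta> l \<omega>))\<^sup>2 \<partial>M) \<le> variance_constant Kf (f 0) / 2 ^ l"
    by auto
qed

text \<open>The coarse path of one level has the law of the fine path one level below, so
  consecutive means cancel although the estimate samples the levels separately.\<close>

lemma mlmc_mean_telescope:
  assumes f: "Kf-lipschitz_on UNIV f" and n: "n \<le> L"
  shows "(\<Sum>l\<le>n. (\<integral>\<omega>. mlmc_summand f a \<sigma> l (X0 \<omega>, \<zeta> l \<omega>) \<partial>M))
    = (\<integral>\<omega>. f (euler_end a n (X0 \<omega>) (\<zeta> n \<omega>)) \<partial>M)"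
  using n
proof (induction n)
  case 0
  then show ?case by (simp add: mlmc_summand_def)
next
  case (Suc n)
  note fm = lipschitz_measurable[OF f]
  have l: "1 \<le> Suc n" by simp
  note ends = level_ends[OF l Suc.prems]
  have int: "integrable M (\<lambda>\<omega>. f (x \<omega>))" if x: "sq_integrable x" for x
  proof (rule Bochner_Integration.integrable_bound)
    show "integrable M (\<lambda>\<omega>. \<bar>f 0\<bar> + Kf * norm (x \<omega>))"
      using sq_integrable_imp_integrable[OF x] by simp
    show "(\<lambda>\<omega>. f (x \<omega>)) \<in> borel_measurable M"
      by (rule measurable_compose[OF sq_integrableD(1)[OF x] fm])
    show "AE \<omega> in M. norm (f (x \<omega>)) \<le> norm (\<bar>f 0\<bar> + Kf * norm (x \<omega>))"
    proof (rule AE_I2)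
      fix \<omega>
      have "\<bar>f (x \<omega>) - f 0\<bar> \<le> Kf * norm (x \<omega>)"
        using lipschitz_onD[OF f, of "x \<omega>" 0] by (simp add: dist_norm)
      thus "norm (f (x \<omega>)) \<le> norm (\<bar>f 0\<bar> + Kf * norm (x \<omega>))" by simp
    qed
  qed
  have "(\<integral>\<omega>. mlmc_summand f a \<sigma> (Suc n) (X0 \<omega>, \<zeta> (Suc n) \<omega>) \<partial>M)
    = (\<integral>\<omega>. f (euler_end a (Suc n) (X0 \<omega>) (\<zeta> (Suc n) \<omega>)) \<partial>M)
      - (\<integral>\<omega>. f (euler_end a (Suc n - 1) (X0 \<omega>) (\<sigma> (Suc n) (\<zeta> (Suc n) \<omega>))) \<partial>M)"
    unfolding mlmc_summand_def using int[OF ends(1)] int[OF ends(2)]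
    by (simp add: Bochner_Integration.integral_diff del: power_Suc euler.simps)
  also have "(\<integral>\<omega>. f (euler_end a (Suc n - 1) (X0 \<omega>) (\<sigma> (Suc n) (\<zeta> (Suc n) \<omega>))) \<partial>M)
      = (\<integral>\<omega>. f (euler_end a n (X0 \<omega>) (\<zeta> n \<omega>)) \<partial>M)"
    using coarse_integral(2)[OF l Suc.prems fm] by simp
  finally show ?case using Suc by simp
qed

end

section \<open>Mean square error and cost\<close>

context coupled_levels
begin

text \<open>Variance plus squared bias: the second moment of an independent sum about
  \<open>v\<close>, whose mean telescopes to that of level \<open>L\<close>.\<close>

lemma mlmc_mean_square_error:
  assumes f: "Kf-lipschitz_on UNIV f" and copies: "iid_copies M L X0 \<zeta> U W"
    and N: "\<And>l. l \<le> L \<Longrightarrow> 1 \<le> N l"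
  shows "integrable M (\<lambda>\<omega>. (mlmc_estimate f a \<sigma> U W L N \<omega> - v)\<^sup>2)"
    and "(\<integral>\<omega>. (mlmc_estimate f a \<sigma> U W L N \<omega> - v)\<^sup>2 \<partial>M)
      \<le> (\<Sum>l\<le>L. variance_constant Kf (f 0) / 2 ^ l / real (N l))
        + ((\<integral>\<omega>. f (euler_end a L (X0 \<omega>) (\<zeta> L \<omega>)) \<partial>M) - v)\<^sup>2"
proof -
  \<comment> \<open>Levels and samples form a single index set, so independence across levels and
    within a level is used at once.\<close>
  define I where "I = (SIGMA l:{..L}. {1..N l})"
  define S where "S i \<omega> = mlmc_summand f a \<sigma> (fst i) (U (fst i) (snd i) \<omega>, W (fst i) (snd i) \<omega>)" for i \<omega>
  define S0 where "S0 l \<omega> = mlmc_summand f a \<sigma> l (X0 \<omega>, \<zeta> l \<omega>)" for l \<omega>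
  define V where "V i \<omega> = 1 / real (N (fst i)) * S i \<omega>" for i \<omega>
  have I: "finite I" "I \<subseteq> {..L} \<times> {1..}" by (auto simp: I_def)
  note sm = mlmc_summand_measurable[OF lipschitz_measurable[OF f]]
  have copies_indep: "indep_vars (\<lambda>i. borel \<Otimes>\<^sub>M mat_space (fst i))
      (\<lambda>i \<omega>. (U (fst i) (snd i) \<omega>, W (fst i) (snd i) \<omega>)) I"
    using indep_vars_subset[OF _ I(2)] copies unfolding iid_copies_def case_prod_beta by blast
  have indep: "indep_vars (\<lambda>_. borel) V I"
    unfolding V_def S_def
  proof (rule indep_vars_compose2[OF copies_indep])
    fix i assume "i \<in> I"
    hence "fst i \<le> L" by (auto simp: I_def)
    from sm[OF this] show "(\<lambda>p. 1 / real (N (fst i)) * mlmc_summand f a \<sigma> (fst i) p)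
        \<in> borel_measurable (borel \<Otimes>\<^sub>M mat_space (fst i))" by measurable
  qed
  have S: "integrable M (\<lambda>\<omega>. (S i \<omega>)\<^sup>2)" "S i \<in> borel_measurable M"
    "(\<integral>\<omega>. (S i \<omega>)\<^sup>2 \<partial>M) \<le> variance_constant Kf (f 0) / 2 ^ fst i"
    "expectation (S i) = expectation (S0 (fst i))" if i: "i \<in> I" for i
  proof -
    have l: "fst i \<le> L" and n: "1 \<le> snd i" using i by (auto simp: I_def)
    have UW: "(\<lambda>\<omega>. (U (fst i) (snd i) \<omega>, W (fst i) (snd i) \<omega>)) \<in> measurable M (borel \<Otimes>\<^sub>M mat_space (fst i))"
      using copies_indep i by (auto simp: indep_vars_def)
    have X\<zeta>: "(\<lambda>\<omega>. (X0 \<omega>, \<zeta> (fst i) \<omega>)) \<in> measurable M (borel \<Otimes>\<^sub>M mat_space (fst i))"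
      using sq_integrableD(1)[OF X0] \<zeta>_measurable[OF l] by measurable
    have eq: "distr M (borel \<Otimes>\<^sub>M mat_space (fst i)) (\<lambda>\<omega>. (U (fst i) (snd i) \<omega>, W (fst i) (snd i) \<omega>))
      = distr M (borel \<Otimes>\<^sub>M mat_space (fst i)) (\<lambda>\<omega>. (X0 \<omega>, \<zeta> (fst i) \<omega>))"
      using copies l n unfolding iid_copies_def by blast
    have sq: "(\<lambda>p. (mlmc_summand f a \<sigma> (fst i) p)\<^sup>2) \<in> borel_measurable (borel \<Otimes>\<^sub>M mat_space (fst i))"
      using sm[OF l] by measurable
    note m2 = mlmc_summand_second_moment[OF f l]
    show "integrable M (\<lambda>\<omega>. (S i \<omega>)\<^sup>2)"
      using same_distr_integral(1)[OF UW X\<zeta> sq eq] m2(1) by (simp add: S_def)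
    show "(\<integral>\<omega>. (S i \<omega>)\<^sup>2 \<partial>M) \<le> variance_constant Kf (f 0) / 2 ^ fst i"
      using same_distr_integral(2)[OF UW X\<zeta> sq eq] m2(2) by (simp add: S_def)
    show "expectation (S i) = expectation (S0 (fst i))"
      using same_distr_integral(2)[OF UW X\<zeta> sm[OF l] eq] by (simp add: S_def[abs_def] S0_def[abs_def])
    show "S i \<in> borel_measurable M"
      unfolding S_def by (rule measurable_compose[OF UW sm[OF l]])
  qed
  have V2: "integrable M (\<lambda>\<omega>. (V i \<omega>)\<^sup>2)" if "i \<in> I" for i
    using S(1)[OF that] by (simp add: V_def power_mult_distrib power_divide)
  have var: "variance (V i) \<le> variance_constant Kf (f 0) / 2 ^ fst i / (real (N (fst i)))\<^sup>2" if i: "i \<in> I" for i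
  proof -
    have int: "integrable M (V i)"
      by (rule square_integrable_imp_integrable[OF _ V2[OF i]])
        (use S(2)[OF i] in \<open>simp add: V_def[abs_def]\<close>)
    have "variance (V i) = expectation (\<lambda>\<omega>. (V i \<omega>)\<^sup>2) - (expectation (V i))\<^sup>2"
      by (rule variance_eq[OF int V2[OF i]])
    also have "\<dots> \<le> expectation (\<lambda>\<omega>. (V i \<omega>)\<^sup>2)" by simp
    also have "\<dots> = (\<integral>\<omega>. (S i \<omega>)\<^sup>2 \<partial>M) / (real (N (fst i)))\<^sup>2"
      by (simp add: V_def power_mult_distrib power_divide)
    also have "\<dots> \<le> variance_constant Kf (f 0) / 2 ^ fst i / (real (N (fst i)))\<^sup>2"
      by (rule divide_right_mono[OF S(3)[OF i]]) simp
    finally show ?thesis .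
  qed
  have est: "mlmc_estimate f a \<sigma> U W L N \<omega> = (\<Sum>i\<in>I. V i \<omega>)" for \<omega>
    unfolding mlmc_estimate_eq I_def V_def S_def by (simp add: case_prod_beta)
  have mean: "(\<Sum>i\<in>I. expectation (V i)) = (\<integral>\<omega>. f (euler_end a L (X0 \<omega>) (\<zeta> L \<omega>)) \<partial>M)"
  proof -
    have "(\<Sum>i\<in>I. expectation (V i)) = (\<Sum>i\<in>I. expectation (S0 (fst i)) / real (N (fst i)))"
    proof (rule sum.cong[OF refl])
      fix i assume "i \<in> I"
      from S(4)[OF this] show "expectation (V i) = expectation (S0 (fst i)) / real (N (fst i))"
        by (simp add: V_def[abs_def])
    qed
    also have "\<dots> = (\<Sum>l\<le>L. \<Sum>n=1..N l. expectation (S0 l) / real (N l))"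
      unfolding I_def by (subst sum.Sigma) (auto simp: case_prod_beta)
    \<comment> \<open>Here \<open>N l\<close> must be positive: since \<open>1 / 0 = 0\<close>, a
      level without samples would drop out of the mean and break the telescoping.\<close>
    also have "\<dots> = (\<Sum>l\<le>L. expectation (S0 l))"
    proof (rule sum.cong[OF refl])
      fix l assume "l \<in> {..L}"
      hence "1 \<le> N l" using N by simp
      thus "(\<Sum>n=1..N l. expectation (S0 l) / real (N l)) = expectation (S0 l)" by simp
    qed
    also have "\<dots> = (\<integral>\<omega>. f (euler_end a L (X0 \<omega>) (\<zeta> L \<omega>)) \<partial>M)"
      using mlmc_mean_telescope[OF f order_refl] by (simp add: S0_def[abs_def])
    finally show ?thesis .
  qed
  have "(\<Sum>i\<in>I. variance (V i)) \<le> (\<Sum>i\<in>I. variance_constant Kf (f 0) / 2 ^ fst i / (real (N (fst i)))\<^sup>2)"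
    by (rule sum_mono[OF var])
  also have "\<dots> = (\<Sum>l\<le>L. \<Sum>n=1..N l. variance_constant Kf (f 0) / 2 ^ l / (real (N l))\<^sup>2)"
    unfolding I_def by (subst sum.Sigma) (auto simp: case_prod_beta)
  also have "\<dots> = (\<Sum>l\<le>L. variance_constant Kf (f 0) / 2 ^ l / real (N l))"
    by (rule sum.cong[OF refl]) (simp add: power2_eq_square)
  finally have total: "(\<Sum>i\<in>I. variance (V i)) \<le> (\<Sum>l\<le>L. variance_constant Kf (f 0) / 2 ^ l / real (N l))" .
  show "integrable M (\<lambda>\<omega>. (mlmc_estimate f a \<sigma> U W L N \<omega> - v)\<^sup>2)"
    unfolding est by (rule sum_indep_second_moment(1)[OF I(1) indep V2])
  show "(\<integral>\<omega>. (mlmc_estimate f a \<sigma> U W L N \<omega> - v)\<^sup>2 \<partial>M)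
      \<le> (\<Sum>l\<le>L. variance_constant Kf (f 0) / 2 ^ l / real (N l))
        + ((\<integral>\<omega>. f (euler_end a L (X0 \<omega>) (\<zeta> L \<omega>)) \<partial>M) - v)\<^sup>2"
  proof -
    have "(\<integral>\<omega>. ((\<Sum>i\<in>I. V i \<omega>) - v)\<^sup>2 \<partial>M)
        = (\<Sum>i\<in>I. variance (V i)) + ((\<Sum>i\<in>I. expectation (V i)) - v)\<^sup>2"
      by (rule sum_indep_second_moment(2)[OF I(1) indep V2])
    with total show ?thesis unfolding est mean by simp
  qed
qed

end

section \<open>Choice of the finest level and the sample sizes, and the resulting cost\<close>

text \<open>The level is chosen such that \<open>A / 2 ^ L \<le> \<epsilon>\<^sup>2\<close>, and the sample sizes such that each
  level contributes the same amount to the variance.\<close>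

definition level_choice :: "real \<Rightarrow> real \<Rightarrow> nat" where
  "level_choice A \<epsilon> = nat \<lceil>log 2 (A / \<epsilon>\<^sup>2)\<rceil> + 1"

definition sample_choice :: "real \<Rightarrow> real \<Rightarrow> real \<Rightarrow> nat \<Rightarrow> nat" where
  "sample_choice A C \<epsilon> l = nat \<lceil>2 * C * (real (level_choice A \<epsilon>) + 1) / (\<epsilon>\<^sup>2 * 2 ^ l)\<rceil>"

text \<open>Truncation of a negative logarithm by \<open>nat\<close> only enlarges the level. The
  extra 1 in \<open>level_choice\<close> keeps the level positive for every
  \<open>\<epsilon>\<close>.\<close>

lemma level_choice_pow:
  assumes "0 < A" "0 < \<epsilon>"
  shows "A / \<epsilon>\<^sup>2 \<le> 2 ^ level_choice A \<epsilon>"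
proof -
  have "log 2 (A / \<epsilon>\<^sup>2) \<le> real (level_choice A \<epsilon>)" unfolding level_choice_def by linarith
  hence "2 powr log 2 (A / \<epsilon>\<^sup>2) \<le> 2 powr real (level_choice A \<epsilon>)" by (rule powr_mono) simp
  thus ?thesis using assms by (simp add: powr_realpow)
qed

text \<open>Rounding up costs less than one additional sample per level; the last bound records this
  for the cost estimate.\<close>

lemma sample_choice_ge:
  assumes "0 < C" "0 < \<epsilon>"
  shows "2 * C * (real (level_choice A \<epsilon>) + 1) / (\<epsilon>\<^sup>2 * 2 ^ l) \<le> real (sample_choice A C \<epsilon> l)"
    and "1 \<le> sample_choice A C \<epsilon> l"
    and "real (sample_choice A C \<epsilon> l) \<le> 2 * C * (real (level_choice A \<epsilon>) + 1) / (\<epsilon>\<^sup>2 * 2 ^ l) + 1"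
proof -
  have pos: "0 < 2 * C * (real (level_choice A \<epsilon>) + 1) / (\<epsilon>\<^sup>2 * 2 ^ l)" using assms by simp
  show "2 * C * (real (level_choice A \<epsilon>) + 1) / (\<epsilon>\<^sup>2 * 2 ^ l) \<le> real (sample_choice A C \<epsilon> l)"
    "real (sample_choice A C \<epsilon> l) \<le> 2 * C * (real (level_choice A \<epsilon>) + 1) / (\<epsilon>\<^sup>2 * 2 ^ l) + 1"
    unfolding sample_choice_def using pos by linarith+
  show "1 \<le> sample_choice A C \<epsilon> l" unfolding sample_choice_def using pos by linarith
qed

text \<open>The factor \<open>2 * (L + 1)\<close> in the sample sizes grants each of the
  \<open>L + 1\<close> levels an equal share of half the squared accuracy; the other half is
  reserved for the bias.\<close>

lemma sample_choice_variance:
  assumes "0 < C" "0 < \<epsilon>"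
  shows "(\<Sum>l\<le>level_choice A \<epsilon>. C / 2 ^ l / real (sample_choice A C \<epsilon> l)) \<le> \<epsilon>\<^sup>2 / 2"
proof -
  let ?L = "level_choice A \<epsilon>"
  have "C / 2 ^ l / real (sample_choice A C \<epsilon> l) \<le> \<epsilon>\<^sup>2 / (2 * (real ?L + 1))" for l
  proof -
    have "C / 2 ^ l / real (sample_choice A C \<epsilon> l)
        \<le> C / 2 ^ l / (2 * C * (real ?L + 1) / (\<epsilon>\<^sup>2 * 2 ^ l))"
    proof (rule divide_left_mono[OF sample_choice_ge(1)[OF assms]])
      have "0 < 2 * C * (real ?L + 1) / (\<epsilon>\<^sup>2 * 2 ^ l)" using assms by simp
      thus "0 < real (sample_choice A C \<epsilon> l) * (2 * C * (real ?L + 1) / (\<epsilon>\<^sup>2 * 2 ^ l))"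
        using sample_choice_ge(2)[OF assms, of A l] by (intro mult_pos_pos) simp_all
    qed (use assms in simp)
    also have "\<dots> = \<epsilon>\<^sup>2 / (2 * (real ?L + 1))" using assms by (simp add: divide_simps)
    finally show ?thesis .
  qed
  hence "(\<Sum>l\<le>?L. C / 2 ^ l / real (sample_choice A C \<epsilon> l)) \<le> (\<Sum>l\<le>?L. \<epsilon>\<^sup>2 / (2 * (real ?L + 1)))"
    by (intro sum_mono)
  also have "\<dots> = (real ?L + 1) * (\<epsilon>\<^sup>2 / (2 * (real ?L + 1)))" by (simp add: add.commute)
  also have "\<dots> = \<epsilon>\<^sup>2 / 2" by (simp add: divide_simps)
  finally show ?thesis .
qed

text \<open>A coarse path needs no more steps than its fine partner, so leaving it out changes the
  cost by a factor of at most 2.\<close>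

lemma mlmc_cost_bounds:
  "(\<Sum>l\<le>L. N l * 2 ^ l) \<le> mlmc_cost L N" "mlmc_cost L N \<le> 2 * (\<Sum>l\<le>L. N l * 2 ^ l)"
proof -
  have split: "(\<Sum>l\<le>L. N l * 2 ^ l) = N 0 + (\<Sum>l=1..L. N l * 2 ^ l)"
    by (simp add: atMost_atLeast0 sum.atLeast_Suc_atMost)
  show "(\<Sum>l\<le>L. N l * 2 ^ l) \<le> mlmc_cost L N"
    unfolding split mlmc_cost_def by (intro add_left_mono sum_mono mult_left_mono) auto
  have "mlmc_cost L N \<le> N 0 + (\<Sum>l=1..L. 2 * (N l * 2 ^ l))"
    unfolding mlmc_cost_def
  proof (intro add_left_mono sum_mono)
    fix l
    have "(2::nat) ^ (l - 1) \<le> 2 ^ l" by (intro power_increasing) auto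
    from mult_left_mono[OF this, of "N l"]
    show "N l * (2 ^ l + 2 ^ (l - 1)) \<le> 2 * (N l * 2 ^ l)" by (simp add: algebra_simps)
  qed
  thus "mlmc_cost L N \<le> 2 * (\<Sum>l\<le>L. N l * 2 ^ l)"
    unfolding split by (simp add: sum_distrib_left)
qed

text \<open>Up to rounding, each of the \<open>L + 1\<close> levels costs
  \<open>2 * C * (L + 1) / \<epsilon>\<^sup>2\<close>, so the total is quadratic in
  \<open>L + 1\<close>, which lies between \<open>x\<close> and \<open>5 * x\<close> for
  \<open>x = - ln \<epsilon>\<close>.\<close>

lemma mlmc_cost_order:
  assumes A: "0 < A" and C: "0 < C"
  shows "(\<lambda>\<epsilon>. real (mlmc_cost (level_choice A \<epsilon>) (sample_choice A C \<epsilon>)))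
    \<in> \<Theta>[at_right 0](\<lambda>\<epsilon>. \<epsilon> powr (-2) * (ln \<epsilon>)\<^sup>2)"
proof (rule bigthetaI')
  \<comment> \<open>The upper constant is twice \<open>50 * C + 8 * A\<close>: the factor 2 pays for
    the coarse paths, \<open>50 = 2 * 5\<^sup>2\<close> comes from \<open>L + 1 \<le> 5 * x\<close>,
    and \<open>8 * A\<close> pays for rounding.\<close>
  show "0 < 2 * C" "0 < 100 * C + 16 * A" using A C by auto
  show "\<forall>\<^sub>F \<epsilon> in at_right 0.
      2 * C * norm (\<epsilon> powr (-2) * (ln \<epsilon>)\<^sup>2) \<le> norm (real (mlmc_cost (level_choice A \<epsilon>) (sample_choice A C \<epsilon>))) \<and>
      norm (real (mlmc_cost (level_choice A \<epsilon>) (sample_choice A C \<epsilon>)))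
        \<le> (100 * C + 16 * A) * norm (\<epsilon> powr (-2) * (ln \<epsilon>)\<^sup>2)"
  proof (rule eventually_at_rightI)
    \<comment> \<open>The threshold makes \<open>x = - ln \<epsilon>\<close> exceed both 3 and
      \<open>2 * \<bar>ln A\<bar>\<close>, so that \<open>ln A\<close> and the rounding constants
      are absorbed into multiples of \<open>x\<close>.\<close>
    fix \<epsilon> :: real assume "\<epsilon> \<in> {0<..<exp (- (2 * \<bar>ln A\<bar> + 3))}"
    hence \<epsilon>: "0 < \<epsilon>" and "\<epsilon> < exp (- (2 * \<bar>ln A\<bar> + 3))" by auto
    hence "ln \<epsilon> < ln (exp (- (2 * \<bar>ln A\<bar> + 3)))" by (subst ln_less_cancel_iff) auto
    hence "ln \<epsilon> < - (2 * \<bar>ln A\<bar> + 3)" by (simp only: ln_exp)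
    moreover define x where "x = - ln \<epsilon>"
    ultimately have x: "2 * \<bar>ln A\<bar> + 3 < x" by simp
    let ?L = "level_choice A \<epsilon>" and ?N = "sample_choice A C \<epsilon>"
    define y where "y = log 2 (A / \<epsilon>\<^sup>2)"
    have y: "y = (ln A + 2 * x) / ln 2"
      using A \<epsilon> by (simp add: y_def log_def ln_div x_def ln_realpow)
    have ln2: "2 / 3 \<le> ln (2::real)" "ln (2::real) < 1" using ln2_ge_two_thirds ln_2_less_1 by auto
    have s: "x \<le> ln A + 2 * x" "ln A + 2 * x \<le> 5 / 2 * x" using x by linarith+
    have "(ln A + 2 * x) * ln 2 \<le> (ln A + 2 * x) * 1" using s x ln2 by (intro mult_left_mono) auto
    hence "ln A + 2 * x \<le> y" unfolding y using ln2 by (subst pos_le_divide_eq) auto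
    with s have y1: "x \<le> y" by linarith
    have "y \<le> (ln A + 2 * x) / (2 / 3)"
      unfolding y using s x ln2 by (intro divide_left_mono) auto
    also have "\<dots> \<le> 4 * x" using s by simp
    finally have y2: "y \<le> 4 * x" .
    have L1: "x \<le> real ?L + 1" using y1 unfolding level_choice_def y_def[symmetric] by linarith
    have Ly: "real ?L \<le> y + 2" using y1 x unfolding level_choice_def y_def[symmetric] by linarith
    have L2: "real ?L + 1 \<le> 5 * x" using Ly y2 x by linarith
    have "2 ^ ?L = 2 powr real ?L" by (simp add: powr_realpow)
    also have "\<dots> \<le> 2 powr (y + 2)" using Ly by (rule powr_mono) simp
    also have "\<dots> = 4 * (A / \<epsilon>\<^sup>2)" using A \<epsilon> by (simp add: powr_add y_def)
    finally have pow: "2 ^ ?L \<le> 4 * (A / \<epsilon>\<^sup>2)" .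
    define S where "S = (\<Sum>l\<le>?L. real (?N l) * 2 ^ l)"
    have S_nat: "real (\<Sum>l\<le>?L. ?N l * 2 ^ l) = S" by (simp add: S_def)
    have cost: "S \<le> real (mlmc_cost ?L ?N)" "real (mlmc_cost ?L ?N) \<le> 2 * S"
      using mlmc_cost_bounds(1)[of ?N ?L, folded of_nat_le_iff[where 'a = real]]
        mlmc_cost_bounds(2)[of ?L ?N, folded of_nat_le_iff[where 'a = real]] S_nat by simp_all
    let ?q = "2 * C * (real ?L + 1) / \<epsilon>\<^sup>2"
    have low: "?q \<le> real (?N l) * 2 ^ l" and up: "real (?N l) * 2 ^ l \<le> ?q + 2 ^ l" for l
    proof -
      have eq: "?q = 2 * C * (real ?L + 1) / (\<epsilon>\<^sup>2 * 2 ^ l) * 2 ^ l" by simp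
      show "?q \<le> real (?N l) * 2 ^ l"
        unfolding eq by (intro mult_right_mono sample_choice_ge(1) C \<epsilon>) simp
      show "real (?N l) * 2 ^ l \<le> ?q + 2 ^ l"
        using mult_right_mono[OF sample_choice_ge(3)[OF C \<epsilon>, of A l], of "2 ^ l"]
        unfolding eq distrib_right by simp
    qed
    have geo: "(\<Sum>l\<le>?L. (2::real) ^ l) \<le> 2 * 2 ^ ?L"
      using sum_gp_basic[of "2::real" ?L] by simp
    have g: "norm (\<epsilon> powr (-2) * (ln \<epsilon>)\<^sup>2) = x\<^sup>2 / \<epsilon>\<^sup>2"
      using \<epsilon> by (simp add: x_def powr_minus_divide abs_mult)
    have "2 * C * (x\<^sup>2 / \<epsilon>\<^sup>2) \<le> 2 * C * ((real ?L + 1)\<^sup>2 / \<epsilon>\<^sup>2)"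
      using L1 x C by (intro mult_left_mono divide_right_mono power_mono) auto
    also have "\<dots> = (\<Sum>l\<le>?L. ?q)" by (simp add: power2_eq_square algebra_simps)
    also have "\<dots> \<le> S" unfolding S_def by (rule sum_mono[OF low])
    finally have lower: "2 * C * (x\<^sup>2 / \<epsilon>\<^sup>2) \<le> real (mlmc_cost ?L ?N)" using cost by linarith
    have "S \<le> (\<Sum>l\<le>?L. ?q + 2 ^ l)" unfolding S_def by (rule sum_mono[OF up])
    also have "\<dots> = 2 * C * ((real ?L + 1)\<^sup>2 / \<epsilon>\<^sup>2) + (\<Sum>l\<le>?L. 2 ^ l)"
      by (simp add: sum.distrib power2_eq_square algebra_simps)
    \<comment> \<open>Rounding adds up to \<open>2 ^ l\<close> steps at level \<open>l\<close>, a
      geometric sum of order \<open>2 ^ L\<close>, hence of order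
      \<open>1 / \<epsilon>\<^sup>2\<close> and dominated by the main term.\<close>
    also have "\<dots> \<le> 2 * C * ((5 * x)\<^sup>2 / \<epsilon>\<^sup>2) + 2 * (4 * (A / \<epsilon>\<^sup>2))"
    proof (rule add_mono)
      show "2 * C * ((real ?L + 1)\<^sup>2 / \<epsilon>\<^sup>2) \<le> 2 * C * ((5 * x)\<^sup>2 / \<epsilon>\<^sup>2)"
        using L2 C by (intro mult_left_mono divide_right_mono power_mono) auto
    qed (use geo pow in linarith)
    also have "\<dots> \<le> 2 * C * ((5 * x)\<^sup>2 / \<epsilon>\<^sup>2) + 2 * (4 * (A * x\<^sup>2 / \<epsilon>\<^sup>2))"
    proof -
      have "1 \<le> x\<^sup>2" using x by (intro one_le_power) linarith
      hence "A * 1 / \<epsilon>\<^sup>2 \<le> A * x\<^sup>2 / \<epsilon>\<^sup>2" using A by (intro divide_right_mono mult_left_mono) auto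
      thus ?thesis by simp
    qed
    also have "\<dots> = (50 * C + 8 * A) * (x\<^sup>2 / \<epsilon>\<^sup>2)"
      by (simp add: power_mult_distrib add_divide_distrib algebra_simps)
    finally have "2 * S \<le> 2 * ((50 * C + 8 * A) * (x\<^sup>2 / \<epsilon>\<^sup>2))" by simp
    also have "\<dots> = (100 * C + 16 * A) * (x\<^sup>2 / \<epsilon>\<^sup>2)" by (simp only: mult.assoc[symmetric]) simp
    finally have "real (mlmc_cost ?L ?N) \<le> (100 * C + 16 * A) * (x\<^sup>2 / \<epsilon>\<^sup>2)"
      using cost(2) by linarith
    thus "2 * C * norm (\<epsilon> powr (-2) * (ln \<epsilon>)\<^sup>2) \<le> norm (real (mlmc_cost ?L ?N)) \<and>
      norm (real (mlmc_cost ?L ?N)) \<le> (100 * C + 16 * A) * norm (\<epsilon> powr (-2) * (ln \<epsilon>)\<^sup>2)"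
      unfolding g using lower by simp
  qed simp
qed

text \<open>Because \<open>2 * \<alpha> \<ge> 1\<close>, the squared bias is at most
  \<open>B / 2 ^ L\<close> with \<open>B = (c * T powr \<alpha>)\<^sup>2\<close>; choosing the level
  for \<open>2 * B\<close> makes this half of the squared accuracy.\<close>

lemma bias_bound:
  fixes c \<alpha> T \<epsilon> b :: real
  assumes c: "0 < c" and \<alpha>: "1 / 2 \<le> \<alpha>" and T: "0 < T" and \<epsilon>: "0 < \<epsilon>"
    and b: "\<bar>b\<bar> \<le> c * step T (level_choice (2 * (c * T powr \<alpha>)\<^sup>2) \<epsilon>) powr \<alpha>"
  shows "b\<^sup>2 \<le> \<epsilon>\<^sup>2 / 2"
proof -
  define B where "B = (c * T powr \<alpha>)\<^sup>2"
  let ?L = "level_choice (2 * B) \<epsilon>"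
  have B: "0 < B" using c T by (simp add: B_def)
  have pow: "2 * B / \<epsilon>\<^sup>2 \<le> 2 ^ ?L" by (rule level_choice_pow) (use B \<epsilon> in auto)
  have "(2::real) ^ ?L = (2 ^ ?L) powr 1" by simp
  also have "\<dots> \<le> (2 ^ ?L) powr (2 * \<alpha>)" by (rule powr_mono) (use \<alpha> in auto)
  also have "\<dots> = ((2 ^ ?L) powr \<alpha>)\<^sup>2" by (simp add: power2_eq_square flip: powr_add)
  finally have le: "(2::real) ^ ?L \<le> ((2 ^ ?L) powr \<alpha>)\<^sup>2" .
  have "b\<^sup>2 \<le> (c * step T ?L powr \<alpha>)\<^sup>2"
    using power_mono[OF b, of 2] by (simp add: B_def)
  also have "\<dots> = B / ((2 ^ ?L) powr \<alpha>)\<^sup>2"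
    using T by (simp add: step_def powr_divide B_def power_mult_distrib power_divide)
  also have "\<dots> \<le> B / 2 ^ ?L" by (rule divide_left_mono[OF le]) (use B in auto)
  also have "\<dots> \<le> \<epsilon>\<^sup>2 / 2"
    using pow \<epsilon> by (simp add: field_simps)
  finally show ?thesis .
qed

theorem proposition3:
  fixes M :: "'w measure" and F :: "real \<Rightarrow> 'w measure"
    and Z :: "real \<Rightarrow> 'w \<Rightarrow> real ^ 'm"
    and X0 :: "'w \<Rightarrow> real ^ 'd" and X :: "real \<Rightarrow> 'w \<Rightarrow> real ^ 'd"
    and a :: "real ^ 'd \<Rightarrow> real ^ 'm ^ 'd" and \<nu> :: "real ^ 'm ^ 'd \<Rightarrow> real"
    and f :: "real ^ 'd \<Rightarrow> real"
    and T La Ba c \<alpha> :: real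
    and \<zeta> :: "nat \<Rightarrow> nat \<Rightarrow> 'w \<Rightarrow> nat \<Rightarrow> real ^ 'm"
    and \<sigma> :: "nat \<Rightarrow> nat \<Rightarrow> (nat \<Rightarrow> real ^ 'm) \<Rightarrow> nat \<Rightarrow> real ^ 'm"
    and U :: "nat \<Rightarrow> nat \<Rightarrow> nat \<Rightarrow> 'w \<Rightarrow> real ^ 'd"
    and W :: "nat \<Rightarrow> nat \<Rightarrow> nat \<Rightarrow> 'w \<Rightarrow> nat \<Rightarrow> real ^ 'm"
  assumes T: "T > 0"
    and space: "filtered_space M F"
    and levy: "levy_process M F Z"
    and X0: "X0 \<in> borel_measurable (F 0)" "integrable M (\<lambda>\<omega>. (norm (X0 \<omega>))\<^sup>2)"
    and norm: "compatible_matrix_norm \<nu>"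
    and a: "La > 0" "Ba > 0" "\<And>x x'. \<nu> (a x - a x') \<le> La * norm (x - x')"
      "\<And>x. (\<nu> (a x))\<^sup>2 \<le> Ba\<^sup>2 * (1 + (norm x)\<^sup>2)"
    and X: "levy_sde_solution M F Z a X0 X"
    and f: "\<exists>K. K-lipschitz_on UNIV f"
    and coupled: "\<And>L. L \<ge> 1 \<Longrightarrow> coupled_matrices M L (\<zeta> L) (\<sigma> L)"
    and indep_init: "\<And>L l. L \<ge> 1 \<Longrightarrow> l \<le> L \<Longrightarrow>
      prob_space.indep_set M (sets (vimage_algebra (space M) X0 borel))
        (sets (vimage_algebra (space M) (\<zeta> L l) (mat_space l)))"
    and bias: "c > 0" "\<alpha> \<ge> 1 / 2" "integrable M (\<lambda>\<omega>. f (X T \<omega>))"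
      "\<And>L. L \<ge> 1 \<Longrightarrow>
        \<bar>(\<integral>\<omega>. f (euler_end a L (X0 \<omega>) (\<zeta> L L \<omega>)) \<partial>M) - (\<integral>\<omega>. f (X T \<omega>) \<partial>M)\<bar>
          \<le> c * step T L powr \<alpha>"
    and iid: "\<And>L l. 1 \<le> l \<Longrightarrow> l \<le> L \<Longrightarrow>
      iid_vars M borel (\<lambda>j \<omega>. \<zeta> L l \<omega> j) {1..2 ^ l}"
    and residual_iid: "\<And>L l. 1 \<le> l \<Longrightarrow> l \<le> L \<Longrightarrow>
      iid_vars M borel (coupling_residual (\<zeta> L) (\<sigma> L) l) {1..2 ^ (l - 1)}"
    and residual_mean: "\<And>L l j. 1 \<le> l \<Longrightarrow> l \<le> L \<Longrightarrow> j \<in> {1..2 ^ (l - 1)} \<Longrightarrow>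
      integrable M (coupling_residual (\<zeta> L) (\<sigma> L) l j) \<and>
      (\<integral>\<omega>. coupling_residual (\<zeta> L) (\<sigma> L) l j \<omega> \<partial>M) = 0"
    and moments: "\<exists>K. \<forall>L l. 1 \<le> l \<and> l \<le> L \<longrightarrow>
      integrable M (\<lambda>\<omega>. (norm (\<zeta> L l \<omega> 1))\<^sup>2) \<and>
      (\<integral>\<omega>. (norm (\<zeta> L l \<omega> 1))\<^sup>2 \<partial>M) \<le> K * step T l \<and>
      norm (\<integral>\<omega>. \<zeta> L l \<omega> 1 \<partial>M) \<le> K * step T l \<and>
      integrable M (\<lambda>\<omega>. (norm (coupling_residual (\<zeta> L) (\<sigma> L) l 1 \<omega>))\<^sup>2) \<and>
      (\<integral>\<omega>. (norm (coupling_residual (\<zeta> L) (\<sigma> L) l 1 \<omega>))\<^sup>2 \<partial>M) \<le> K * (step T l)\<^sup>2"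
    and copies: "\<And>L. L \<ge> 1 \<Longrightarrow> iid_copies M L X0 (\<zeta> L) (U L) (W L)"
  shows "\<exists>(L :: real \<Rightarrow> nat) (N :: real \<Rightarrow> nat \<Rightarrow> nat).
    (\<forall>\<epsilon>>0. L \<epsilon> \<ge> 1 \<and> (\<forall>l\<le>L \<epsilon>. N \<epsilon> l \<ge> 1) \<and>
      (let Y = mlmc_estimate f a (\<sigma> (L \<epsilon>)) (U (L \<epsilon>)) (W (L \<epsilon>)) (L \<epsilon>) (N \<epsilon>);
           v = (\<integral>\<omega>. f (X T \<omega>) \<partial>M)
       in integrable M (\<lambda>\<omega>. (Y \<omega> - v)\<^sup>2) \<and> sqrt (\<integral>\<omega>. (Y \<omega> - v)\<^sup>2 \<partial>M) \<le> \<epsilon>)) \<and>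
    (\<lambda>\<epsilon>. real (mlmc_cost (L \<epsilon>) (N \<epsilon>))) \<in> \<Theta>[at_right 0](\<lambda>\<epsilon>. \<epsilon> powr (-2) * (ln \<epsilon>)\<^sup>2)"
proof -
  interpret prob_space M using space by (simp add: filtered_space_def)
  from f obtain Kf where Kf: "Kf-lipschitz_on UNIV f" by blast
  from moments obtain K0 where K0: "\<And>L l. 1 \<le> l \<Longrightarrow> l \<le> L \<Longrightarrow>
      integrable M (\<lambda>\<omega>. (norm (\<zeta> L l \<omega> 1))\<^sup>2) \<and>
      (\<integral>\<omega>. (norm (\<zeta> L l \<omega> 1))\<^sup>2 \<partial>M) \<le> K0 * step T l \<and>
      norm (\<integral>\<omega>. \<zeta> L l \<omega> 1 \<partial>M) \<le> K0 * step T l \<and>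
      integrable M (\<lambda>\<omega>. (norm (coupling_residual (\<zeta> L) (\<sigma> L) l 1 \<omega>))\<^sup>2) \<and>
      (\<integral>\<omega>. (norm (coupling_residual (\<zeta> L) (\<sigma> L) l 1 \<omega>))\<^sup>2 \<partial>M) \<le> K0 * (step T l)\<^sup>2"
    by blast
  \<comment> \<open>The constant obtained from \<open>moments\<close> has no sign; its absolute
    value also serves and meets the nonnegativity required of \<open>K\<close>.\<close>
  have K: "r \<le> \<bar>K0\<bar> * x" if "r \<le> K0 * x" "0 \<le> x" for r x
    using that(1) mult_right_mono[OF abs_ge_self that(2), of K0] by linarith
  have step0: "0 \<le> step T l" "0 \<le> (step T l)\<^sup>2" for l using T by (simp_all add: step_def)
  have \<nu>: "norm (A *v v) \<le> \<nu> A * norm v" "0 \<le> \<nu> A" for A v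
    using norm by (auto simp: compatible_matrix_norm_def)
  \<comment> \<open>Compatibility of \<open>\<nu>\<close> passes the Lipschitz and growth bounds on
    to the action on vectors.\<close>
  interpret euler_scheme M a La Ba
  proof
    show "norm ((a x - a x') *v v) \<le> La * norm (x - x') * norm v" for x x' v
      by (rule order_trans[OF \<nu>(1) mult_right_mono[OF a(3)]]) simp
    show "(norm (a x *v v))\<^sup>2 \<le> Ba\<^sup>2 * (1 + (norm x)\<^sup>2) * (norm v)\<^sup>2" for x v
    proof -
      have "(norm (a x *v v))\<^sup>2 \<le> (\<nu> (a x))\<^sup>2 * (norm v)\<^sup>2"
        using power_mono[OF \<nu>(1)[of "a x" v] norm_ge_zero, of 2] by (simp add: power_mult_distrib)
      also have "\<dots> \<le> Ba\<^sup>2 * (1 + (norm x)\<^sup>2) * (norm v)\<^sup>2" by (rule mult_right_mono[OF a(4)]) simp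
      finally show ?thesis .
    qed
  qed (use a in auto)
  have "measurable (F 0) borel \<subseteq> measurable M (borel :: (real ^ 'd) measure)"
    using space by (intro measurable_mono) (auto simp: filtered_space_def filtration_def)
  hence X0_meas: "X0 \<in> borel_measurable M" using X0(1) by blast
  have levels: "coupled_levels M a La Ba L X0 (\<zeta> L) (\<sigma> L) T \<bar>K0\<bar>" if L: "1 \<le> L" for L
  proof
    fix l assume "l \<le> L"
    show "indep_rv borel X0 (mat_space l) (\<zeta> L l)"
    proof (rule indep_rvI[OF X0_meas _ indep_init[OF L \<open>l \<le> L\<close>]])
      show "\<zeta> L l \<in> measurable M (mat_space l)"
        using coupled[OF L] \<open>l \<le> L\<close> by (auto simp: coupled_matrices_def indep_vars_def)
    qed
  next
    fix l assume l: "1 \<le> l" "l \<le> L"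
    show "integrable M (\<lambda>\<omega>. (norm (\<zeta> L l \<omega> 1))\<^sup>2) \<and>
      (\<integral>\<omega>. (norm (\<zeta> L l \<omega> 1))\<^sup>2 \<partial>M) \<le> \<bar>K0\<bar> * step T l \<and>
      norm (\<integral>\<omega>. \<zeta> L l \<omega> 1 \<partial>M) \<le> \<bar>K0\<bar> * step T l \<and>
      integrable M (\<lambda>\<omega>. (norm (coupling_residual (\<zeta> L) (\<sigma> L) l 1 \<omega>))\<^sup>2) \<and>
      (\<integral>\<omega>. (norm (coupling_residual (\<zeta> L) (\<sigma> L) l 1 \<omega>))\<^sup>2 \<partial>M) \<le> \<bar>K0\<bar> * (step T l)\<^sup>2"
      using K0[OF l] K step0 by blast
    show "iid_vars M borel (\<lambda>j \<omega>. \<zeta> L l \<omega> j) {1..2 ^ l}" by (rule iid[OF l])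
    show "iid_vars M borel (coupling_residual (\<zeta> L) (\<sigma> L) l) {1..2 ^ (l - 1)}"
      by (rule residual_iid[OF l])
    show "(\<integral>\<omega>. coupling_residual (\<zeta> L) (\<sigma> L) l j \<omega> \<partial>M) = 0" if "j \<in> {1..2 ^ (l - 1)}" for j
      using residual_mean[OF l that] by blast
  next
    show "sq_integrable X0" using X0_meas X0(2) by (simp add: sq_integrable_def)
  qed (use L T coupled in auto)
  \<comment> \<open>\<open>variance_constant\<close> does not involve the level or the matrices, so
    \<open>C\<close> can be fixed before \<open>L\<close>. The absolute value and the 1 make it
    positive, as the sample sizes require.\<close>
  define C where "C = \<bar>coupled_levels.variance_constant M La Ba X0 T \<bar>K0\<bar> Kf (f 0)\<bar> + 1"
  define A where "A = 2 * (c * T powr \<alpha>)\<^sup>2"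
  have C: "0 < C" and A: "0 < A" using bias(1) T by (simp_all add: C_def A_def)
  define v where "v = (\<integral>\<omega>. f (X T \<omega>) \<partial>M)"
  have error: "integrable M (\<lambda>\<omega>. (mlmc_estimate f a (\<sigma> L) (U L) (W L) L N \<omega> - v)\<^sup>2) \<and>
      sqrt (\<integral>\<omega>. (mlmc_estimate f a (\<sigma> L) (U L) (W L) L N \<omega> - v)\<^sup>2 \<partial>M) \<le> \<epsilon>"
    if \<epsilon>: "0 < \<epsilon>" and L_def: "L = level_choice A \<epsilon>" and N_def: "N = sample_choice A C \<epsilon>" for \<epsilon> L N
  proof -
    have L: "1 \<le> L" by (simp add: L_def level_choice_def)
    interpret lev: coupled_levels M a La Ba L X0 "\<zeta> L" "\<sigma> L" T "\<bar>K0\<bar>" by (rule levels[OF L])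
    have N: "1 \<le> N l" for l unfolding N_def by (rule sample_choice_ge(2)[OF C \<epsilon>])
    note err = lev.mlmc_mean_square_error[where N = N and v = v, OF Kf copies[OF L] N]
    have "(\<Sum>l\<le>L. lev.variance_constant Kf (f 0) / 2 ^ l / real (N l)) \<le> (\<Sum>l\<le>L. C / 2 ^ l / real (N l))"
      by (intro sum_mono divide_right_mono) (simp_all add: C_def)
    also have "\<dots> \<le> \<epsilon>\<^sup>2 / 2" unfolding L_def N_def by (rule sample_choice_variance[OF C \<epsilon>])
    finally have var: "(\<Sum>l\<le>L. lev.variance_constant Kf (f 0) / 2 ^ l / real (N l)) \<le> \<epsilon>\<^sup>2 / 2" .
    have "((\<integral>\<omega>. f (euler_end a L (X0 \<omega>) (\<zeta> L L \<omega>)) \<partial>M) - v)\<^sup>2 \<le> \<epsilon>\<^sup>2 / 2"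
      using bias(4)[OF L] unfolding v_def[symmetric]
      by (intro bias_bound[OF bias(1,2) T \<epsilon>]) (simp add: L_def A_def)
    with err(2) var have "(\<integral>\<omega>. (mlmc_estimate f a (\<sigma> L) (U L) (W L) L N \<omega> - v)\<^sup>2 \<partial>M) \<le> \<epsilon>\<^sup>2"
      by linarith
    thus ?thesis using err(1) \<epsilon> by (auto intro: real_le_lsqrt)
  qed
  show ?thesis
  proof (intro exI conjI allI impI)
    show "(\<lambda>\<epsilon>. real (mlmc_cost (level_choice A \<epsilon>) (sample_choice A C \<epsilon>)))
        \<in> \<Theta>[at_right 0](\<lambda>\<epsilon>. \<epsilon> powr (-2) * (ln \<epsilon>)\<^sup>2)"
      by (rule mlmc_cost_order[OF A C])
    fix \<epsilon> :: real assume \<epsilon>: "\<epsilon> > 0"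
    show "1 \<le> level_choice A \<epsilon>" by (simp add: level_choice_def)
    show "1 \<le> sample_choice A C \<epsilon> l" for l by (rule sample_choice_ge(2)[OF C \<epsilon>])
    show "let Y = mlmc_estimate f a (\<sigma> (level_choice A \<epsilon>)) (U (level_choice A \<epsilon>)) (W (level_choice A \<epsilon>))
              (level_choice A \<epsilon>) (sample_choice A C \<epsilon>);
            v = (\<integral>\<omega>. f (X T \<omega>) \<partial>M)
        in integrable M (\<lambda>\<omega>. (Y \<omega> - v)\<^sup>2) \<and> sqrt (\<integral>\<omega>. (Y \<omega> - v)\<^sup>2 \<partial>M) \<le> \<epsilon>"
      using error[OF \<epsilon> refl refl] by (simp add: v_def Let_def)
  qed
qed

end
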